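(* Let $A$ be a basic non-semisimple Artin algebra that is QF-2, and suppose that each simple $A$-module is reflexive. Then $A$ is selfinjective.
   Context: Modules are finitely generated right modules unless stated otherwise. $(-)^{*}$ denotes the functor $\mathrm{Hom}_A(-,A)$, from right $A$-modules to left $A$-modules and from left $A$-modules to right $A$-modules. A module $M$ is reflexive if the canonical evaluation map $f_M : M \to M^{**}$, $f_M(m)(g)=g(m)$ for $m\in M$, $g\in M^{*}$, is an isomorphism. $A$ is a QF-2 algebra if the socle of each indecomposable projective module is simple. $A$ is selfinjective if the regular module $A$ is injective. *)

theory Defs
  imports "HOL-Algebra.Module" "HOL-Algebra.Ideal"
begin

section \<open>Modules over a noncommutative ring\<close>

text \<open>
  The library locale \<^locale>\<open>module\<close> requires a commutative ring of scalars, so left and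
  right modules are introduced here, over the same record type. In a right module, the term
  \<open>a \<odot>\<^bsub>M\<^esub> m\<close> stands for \<open>m \<cdot> a\<close>; hence the order of the factors in
  \<open>smult_mult\<close> below. The library notion \<^locale>\<open>submodule\<close> does not depend on
  commutativity nor on the side, and is used for both.
\<close>

locale left_module = R?: ring A + M?: abelian_group M
  for A :: "('a, 'z) ring_scheme" (structure) and M :: "('a, 'm, 'y) module_scheme" (structure) +
  assumes smult_closed [simp, intro]:
      "\<lbrakk>a \<in> carrier A; x \<in> carrier M\<rbrakk> \<Longrightarrow> a \<odot>\<^bsub>M\<^esub> x \<in> carrier M"
    and smult_l_distr:
      "\<lbrakk>a \<in> carrier A; b \<in> carrier A; x \<in> carrier M\<rbrakk> \<Longrightarrow>
        (a \<oplus> b) \<odot>\<^bsub>M\<^esub> x = a \<odot>\<^bsub>M\<^esub> x \<oplus>\<^bsub>M\<^esub> b \<odot>\<^bsub>M\<^esub> x"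
    and smult_r_distr:
      "\<lbrakk>a \<in> carrier A; x \<in> carrier M; y \<in> carrier M\<rbrakk> \<Longrightarrow>
        a \<odot>\<^bsub>M\<^esub> (x \<oplus>\<^bsub>M\<^esub> y) = a \<odot>\<^bsub>M\<^esub> x \<oplus>\<^bsub>M\<^esub> a \<odot>\<^bsub>M\<^esub> y"
    and smult_mult:
      "\<lbrakk>a \<in> carrier A; b \<in> carrier A; x \<in> carrier M\<rbrakk> \<Longrightarrow>
        (a \<otimes> b) \<odot>\<^bsub>M\<^esub> x = a \<odot>\<^bsub>M\<^esub> (b \<odot>\<^bsub>M\<^esub> x)"
    and smult_one [simp]: "x \<in> carrier M \<Longrightarrow> \<one> \<odot>\<^bsub>M\<^esub> x = x"

locale right_module = R?: ring A + M?: abelian_group M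
  for A :: "('a, 'z) ring_scheme" (structure) and M :: "('a, 'm, 'y) module_scheme" (structure) +
  assumes smult_closed [simp, intro]:
      "\<lbrakk>a \<in> carrier A; x \<in> carrier M\<rbrakk> \<Longrightarrow> a \<odot>\<^bsub>M\<^esub> x \<in> carrier M"
    and smult_l_distr:
      "\<lbrakk>a \<in> carrier A; b \<in> carrier A; x \<in> carrier M\<rbrakk> \<Longrightarrow>
        (a \<oplus> b) \<odot>\<^bsub>M\<^esub> x = a \<odot>\<^bsub>M\<^esub> x \<oplus>\<^bsub>M\<^esub> b \<odot>\<^bsub>M\<^esub> x"
    and smult_r_distr:
      "\<lbrakk>a \<in> carrier A; x \<in> carrier M; y \<in> carrier M\<rbrakk> \<Longrightarrow>
        a \<odot>\<^bsub>M\<^esub> (x \<oplus>\<^bsub>M\<^esub> y) = a \<odot>\<^bsub>M\<^esub> x \<oplus>\<^bsub>M\<^esub> a \<odot>\<^bsub>M\<^esub> y"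
    and smult_mult:
      "\<lbrakk>a \<in> carrier A; b \<in> carrier A; x \<in> carrier M\<rbrakk> \<Longrightarrow>
        (a \<otimes> b) \<odot>\<^bsub>M\<^esub> x = b \<odot>\<^bsub>M\<^esub> (a \<odot>\<^bsub>M\<^esub> x)"
    and smult_one [simp]: "x \<in> carrier M \<Longrightarrow> \<one> \<odot>\<^bsub>M\<^esub> x = x"

definition left_regular :: "('a, 'z) ring_scheme \<Rightarrow> ('a, 'a) module" where
  "left_regular A =
     \<lparr>carrier = carrier A, monoid.mult = monoid.mult A, one = one A,
      ring.zero = \<zero>\<^bsub>A\<^esub>, add = add A, smult = (\<lambda>a x. a \<otimes>\<^bsub>A\<^esub> x)\<rparr>"

definition right_regular :: "('a, 'z) ring_scheme \<Rightarrow> ('a, 'a) module" where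
  "right_regular A =
     \<lparr>carrier = carrier A, monoid.mult = monoid.mult A, one = one A,
      ring.zero = \<zero>\<^bsub>A\<^esub>, add = add A, smult = (\<lambda>a x. x \<otimes>\<^bsub>A\<^esub> a)\<rparr>"

text \<open>Homomorphisms are extensional, so that Hom sets carry no junk values.\<close>

definition mod_hom ::
    "('a, 'z) ring_scheme \<Rightarrow> ('a, 'm, 'y) module_scheme \<Rightarrow> ('a, 'n, 'x) module_scheme \<Rightarrow> ('m \<Rightarrow> 'n) set"
  where
  "mod_hom A M N = {f \<in> carrier M \<rightarrow>\<^sub>E carrier N.
     (\<forall>x\<in>carrier M. \<forall>y\<in>carrier M. f (x \<oplus>\<^bsub>M\<^esub> y) = f x \<oplus>\<^bsub>N\<^esub> f y) \<and>
     (\<forall>a\<in>carrier A. \<forall>x\<in>carrier M. f (a \<odot>\<^bsub>M\<^esub> x) = a \<odot>\<^bsub>N\<^esub> f x)}"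

definition mod_iso ::
    "('a, 'z) ring_scheme \<Rightarrow> ('a, 'm, 'y) module_scheme \<Rightarrow> ('a, 'n, 'x) module_scheme \<Rightarrow> ('m \<Rightarrow> 'n) set"
  where "mod_iso A M N = {f \<in> mod_hom A M N. bij_betw f (carrier M) (carrier N)}"

definition mod_isomorphic ::
    "('a, 'z) ring_scheme \<Rightarrow> ('a, 'm, 'y) module_scheme \<Rightarrow> ('a, 'n, 'x) module_scheme \<Rightarrow> bool"
  where "mod_isomorphic A M N \<longleftrightarrow> mod_iso A M N \<noteq> {}"

definition gen_submodule ::
    "('a, 'z) ring_scheme \<Rightarrow> ('a, 'm, 'y) module_scheme \<Rightarrow> 'm set \<Rightarrow> 'm set"
  where "gen_submodule A M S = \<Inter>{N. submodule N A M \<and> S \<subseteq> N}"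

definition fin_gen :: "('a, 'z) ring_scheme \<Rightarrow> ('a, 'm, 'y) module_scheme \<Rightarrow> bool" where
  "fin_gen A M \<longleftrightarrow> (\<exists>S. finite S \<and> S \<subseteq> carrier M \<and> gen_submodule A M S = carrier M)"

definition simple_module :: "('a, 'z) ring_scheme \<Rightarrow> ('a, 'm, 'y) module_scheme \<Rightarrow> bool" where
  "simple_module A M \<longleftrightarrow> carrier M \<noteq> {\<zero>\<^bsub>M\<^esub>} \<and>
     (\<forall>N. submodule N A M \<longrightarrow> N = {\<zero>\<^bsub>M\<^esub>} \<or> N = carrier M)"

definition indecomposable_module :: "('a, 'z) ring_scheme \<Rightarrow> ('a, 'm, 'y) module_scheme \<Rightarrow> bool"
  where
  "indecomposable_module A M \<longleftrightarrow> carrier M \<noteq> {\<zero>\<^bsub>M\<^esub>} \<and>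
     (\<forall>N L. submodule N A M \<and> submodule L A M \<and>
            N \<inter> L = {\<zero>\<^bsub>M\<^esub>} \<and> N <+>\<^bsub>M\<^esub> L = carrier M \<longrightarrow>
            N = {\<zero>\<^bsub>M\<^esub>} \<or> L = {\<zero>\<^bsub>M\<^esub>})"

definition socle :: "('a, 'z) ring_scheme \<Rightarrow> ('a, 'm, 'y) module_scheme \<Rightarrow> 'm set" where
  "socle A M =
     gen_submodule A M (\<Union>{N. submodule N A M \<and> simple_module A (M\<lparr>carrier := N\<rparr>)})"

text \<open>A module is semisimple if it is the sum of its simple submodules.\<close>

definition semisimple_module :: "('a, 'z) ring_scheme \<Rightarrow> ('a, 'm, 'y) module_scheme \<Rightarrow> bool" where
  "semisimple_module A M \<longleftrightarrow> socle A M = carrier M"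

text \<open>
  The lifting and extension properties below quantify over all right modules (finitely
  generated or not) whose elements belong to the type \<open>'t\<close>.
\<close>

definition projective_module ::
    "'t itself \<Rightarrow> ('a, 'z) ring_scheme \<Rightarrow> ('a, 'm, 'y) module_scheme \<Rightarrow> bool" where
  "projective_module T A P \<longleftrightarrow>
     (\<forall>(X :: ('a, 't) module) (Y :: ('a, 't) module).
        right_module A X \<and> right_module A Y \<longrightarrow>
        (\<forall>p\<in>mod_hom A X Y. \<forall>f\<in>mod_hom A P Y. p ` carrier X = carrier Y \<longrightarrow>
           (\<exists>h\<in>mod_hom A P X. \<forall>x\<in>carrier P. p (h x) = f x)))"

definition injective_module ::
    "'t itself \<Rightarrow> ('a, 'z) ring_scheme \<Rightarrow> ('a, 'm, 'y) module_scheme \<Rightarrow> bool" where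
  "injective_module T A Q \<longleftrightarrow>
     (\<forall>(X :: ('a, 't) module) (Y :: ('a, 't) module).
        right_module A X \<and> right_module A Y \<longrightarrow>
        (\<forall>i\<in>mod_hom A X Y. \<forall>f\<in>mod_hom A X Q. inj_on i (carrier X) \<longrightarrow>
           (\<exists>h\<in>mod_hom A Y Q. \<forall>x\<in>carrier X. h (i x) = f x)))"


section \<open>Duals and reflexive modules\<close>

text \<open>
  For a right module \<open>M\<close>, the left module \<open>Hom\<^sub>A(M, A)\<close> has action \<open>(a g)(m) = a g(m)\<close>;
  for a left module \<open>N\<close>, the right module \<open>Hom\<^sub>A(N, A)\<close> has action \<open>(g a)(n) = g(n) a\<close>.
\<close>

definition dual_of_right ::
    "('a, 'z) ring_scheme \<Rightarrow> ('a, 'm, 'y) module_scheme \<Rightarrow> ('a, 'm \<Rightarrow> 'a) module" where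
  "dual_of_right A M =
     \<lparr>carrier = mod_hom A M (right_regular A), monoid.mult = undefined, one = undefined,
      ring.zero = (\<lambda>m\<in>carrier M. \<zero>\<^bsub>A\<^esub>),
      add = (\<lambda>g h. \<lambda>m\<in>carrier M. g m \<oplus>\<^bsub>A\<^esub> h m),
      smult = (\<lambda>a g. \<lambda>m\<in>carrier M. a \<otimes>\<^bsub>A\<^esub> g m)\<rparr>"

definition dual_of_left ::
    "('a, 'z) ring_scheme \<Rightarrow> ('a, 'n, 'y) module_scheme \<Rightarrow> ('a, 'n \<Rightarrow> 'a) module" where
  "dual_of_left A N =
     \<lparr>carrier = mod_hom A N (left_regular A), monoid.mult = undefined, one = undefined,
      ring.zero = (\<lambda>n\<in>carrier N. \<zero>\<^bsub>A\<^esub>),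
      add = (\<lambda>g h. \<lambda>n\<in>carrier N. g n \<oplus>\<^bsub>A\<^esub> h n),
      smult = (\<lambda>a g. \<lambda>n\<in>carrier N. g n \<otimes>\<^bsub>A\<^esub> a)\<rparr>"

definition eval_map ::
    "('a, 'z) ring_scheme \<Rightarrow> ('a, 'm, 'y) module_scheme \<Rightarrow> 'm \<Rightarrow> ('m \<Rightarrow> 'a) \<Rightarrow> 'a" where
  "eval_map A M = (\<lambda>m\<in>carrier M. \<lambda>g\<in>carrier (dual_of_right A M). g m)"

definition reflexive_module :: "('a, 'z) ring_scheme \<Rightarrow> ('a, 'm, 'y) module_scheme \<Rightarrow> bool" where
  "reflexive_module A M \<longleftrightarrow> eval_map A M \<in> mod_iso A M (dual_of_left A (dual_of_right A M))"


section \<open>Artin algebras\<close>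

locale artinian_cring = cring R for R (structure) +
  assumes descending_chain:
    "\<lbrakk>\<And>n. ideal (I n) R; \<And>n. I (Suc n) \<subseteq> I n\<rbrakk> \<Longrightarrow> \<exists>n. \<forall>m\<ge>n. I m = I n"

definition restrict_scalars ::
    "('r \<Rightarrow> 'a) \<Rightarrow> ('a, 'z) ring_scheme \<Rightarrow> ('r, 'a) module" where
  "restrict_scalars \<phi> A =
     \<lparr>carrier = carrier A, monoid.mult = monoid.mult A, one = one A,
      ring.zero = \<zero>\<^bsub>A\<^esub>, add = add A, smult = (\<lambda>r x. \<phi> r \<otimes>\<^bsub>A\<^esub> x)\<rparr>"

text \<open>The algebra structure is given by the structure map \<open>\<phi>\<close> from \<open>R\<close> to the centre of \<open>A\<close>.\<close>

locale artin_algebra = R: artinian_cring R + A: ring A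
  for R :: "('r, 'q) ring_scheme" and \<phi> :: "'r \<Rightarrow> 'a" and A :: "('a, 'z) ring_scheme" +
  assumes structure_map: "\<phi> \<in> ring_hom R A"
    and central: "\<lbrakk>r \<in> carrier R; a \<in> carrier A\<rbrakk> \<Longrightarrow> \<phi> r \<otimes>\<^bsub>A\<^esub> a = a \<otimes>\<^bsub>A\<^esub> \<phi> r"
    and fin_gen: "fin_gen R (restrict_scalars \<phi> A)"

definition internal_direct_sum ::
    "('a, 'z) ring_scheme \<Rightarrow> ('a, 'm, 'y) module_scheme \<Rightarrow> 'i set \<Rightarrow> ('i \<Rightarrow> 'm set) \<Rightarrow> bool" where
  "internal_direct_sum A M I P \<longleftrightarrow>
     finite I \<and> (\<forall>i\<in>I. submodule (P i) A M) \<and>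
     (\<forall>m\<in>carrier M. \<exists>!p. p \<in> (\<Pi>\<^sub>E i\<in>I. P i) \<and> m = (\<Oplus>\<^bsub>M\<^esub>i\<in>I. p i))"

text \<open>
  An algebra is basic if the regular module is a direct sum of pairwise nonisomorphic
  indecomposable modules.
\<close>

definition basic_ring :: "('a, 'z) ring_scheme \<Rightarrow> bool" where
  "basic_ring A \<longleftrightarrow>
     (\<exists>(n :: nat) P. internal_direct_sum A (right_regular A) {..<n} P \<and>
        (\<forall>i<n. indecomposable_module A ((right_regular A)\<lparr>carrier := P i\<rparr>)) \<and>
        (\<forall>i<n. \<forall>j<n. i \<noteq> j \<longrightarrow>
           \<not> mod_isomorphic A ((right_regular A)\<lparr>carrier := P i\<rparr>)
                              ((right_regular A)\<lparr>carrier := P j\<rparr>)))"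

definition semisimple_ring :: "('a, 'z) ring_scheme \<Rightarrow> bool" where
  "semisimple_ring A \<longleftrightarrow> semisimple_module A (right_regular A)"

text \<open>
  HOL cannot quantify over modules with elements in arbitrary types inside a formula. The
  type \<open>(nat \<Rightarrow> 'a) set\<close> is large enough to contain an isomorphic copy of every finitely
  generated \<open>A\<close>-module (think of cosets in \<open>A\<^sup>n\<close>): see \<open>fin_gen_module_copy\<close> below.
  In particular, it contains copies of the modules needed to test whether a finitely
  generated module is projective, namely the module itself and finitely generated free modules.
\<close>

type_synonym 'a fg_module = "('a, (nat \<Rightarrow> 'a) set) module"

definition QF2 :: "('a, 'z) ring_scheme \<Rightarrow> bool" where
  "QF2 A \<longleftrightarrow>
     (\<forall>P :: 'a fg_module.
        right_module A P \<and> fin_gen A P \<and>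
        projective_module TYPE((nat \<Rightarrow> 'a) set) A P \<and> indecomposable_module A P \<longrightarrow>
        simple_module A (P\<lparr>carrier := socle A P\<rparr>))"

definition selfinjective :: "'t itself \<Rightarrow> ('a, 'z) ring_scheme \<Rightarrow> bool" where
  "selfinjective T A \<longleftrightarrow> injective_module T A (right_regular A)"


section \<open>Consistency of the definitions\<close>

lemma left_module_left_regular:
  assumes "ring A"
  shows "left_module A (left_regular A)"
proof -
  interpret ring A by fact
  have "abelian_group (left_regular A)"
    by (rule abelian_groupI)
       (auto simp: left_regular_def a_ac intro: bexI[of _ "\<ominus>\<^bsub>A\<^esub> _"] l_neg)
  then show ?thesis
    by (auto intro!: left_module.intro left_module_axioms.intro assms
        simp: left_regular_def l_distr r_distr m_assoc)
qed

lemma right_module_right_regular: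
  assumes "ring A"
  shows "right_module A (right_regular A)"
proof -
  interpret ring A by fact
  have "abelian_group (right_regular A)"
    by (rule abelian_groupI)
       (auto simp: right_regular_def a_ac intro: bexI[of _ "\<ominus>\<^bsub>A\<^esub> _"] l_neg)
  then show ?thesis
    by (auto intro!: right_module.intro right_module_axioms.intro assms
        simp: right_regular_def l_distr r_distr m_assoc)
qed

lemma left_module_dual_of_right:
  assumes "right_module A M"
  shows "left_module A (dual_of_right A M)"
proof -
  interpret right_module A M by fact
  note defs = dual_of_right_def mod_hom_def right_regular_def PiE_iff extensional_def
    restrict_def fun_eq_iff
  have "abelian_group (dual_of_right A M)"
  proof (rule abelian_groupI)
    fix g assume g: "g \<in> carrier (dual_of_right A M)"
    then have "(\<lambda>m\<in>carrier M. \<ominus>\<^bsub>A\<^esub> g m) \<in> carrier (dual_of_right A M)"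
      by (auto simp: defs R.minus_add R.l_minus R.r_minus R.a_comm)
    with g show "\<exists>h\<in>carrier (dual_of_right A M). h \<oplus>\<^bsub>dual_of_right A M\<^esub> g = \<zero>\<^bsub>dual_of_right A M\<^esub>"
      by (intro bexI[of _ "\<lambda>m\<in>carrier M. \<ominus>\<^bsub>A\<^esub> g m"]) (auto simp: defs R.l_neg)
  qed (auto simp: defs R.a_ac R.l_distr R.r_distr)
  then show ?thesis
    by (intro left_module.intro left_module_axioms.intro R.ring_axioms)
       (auto simp: defs R.m_assoc R.l_distr R.r_distr)
qed

lemma right_module_dual_of_left:
  assumes "left_module A N"
  shows "right_module A (dual_of_left A N)"
proof -
  interpret left_module A N by fact
  note defs = dual_of_left_def mod_hom_def left_regular_def PiE_iff extensional_def
    restrict_def fun_eq_iff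
  have "abelian_group (dual_of_left A N)"
  proof (rule abelian_groupI)
    fix g assume g: "g \<in> carrier (dual_of_left A N)"
    then have "(\<lambda>m\<in>carrier N. \<ominus>\<^bsub>A\<^esub> g m) \<in> carrier (dual_of_left A N)"
      by (auto simp: defs R.minus_add R.l_minus R.r_minus R.a_comm)
    with g show "\<exists>h\<in>carrier (dual_of_left A N). h \<oplus>\<^bsub>dual_of_left A N\<^esub> g = \<zero>\<^bsub>dual_of_left A N\<^esub>"
      by (intro bexI[of _ "\<lambda>m\<in>carrier N. \<ominus>\<^bsub>A\<^esub> g m"]) (auto simp: defs R.l_neg)
  qed (auto simp: defs R.a_ac R.l_distr R.r_distr)
  then show ?thesis
    by (intro right_module.intro right_module_axioms.intro R.ring_axioms)
       (auto simp: defs R.m_assoc R.l_distr R.r_distr)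
qed

lemma eval_map_hom:
  assumes "right_module A M"
  shows "eval_map A M \<in> mod_hom A M (dual_of_left A (dual_of_right A M))"
proof -
  interpret right_module A M by fact
  show ?thesis
    by (auto simp: eval_map_def dual_of_left_def dual_of_right_def mod_hom_def
        left_regular_def right_regular_def PiE_iff extensional_def
        restrict_def fun_eq_iff R.l_distr R.r_distr R.m_assoc R.a_ac)
qed

lemma (in right_module) smult_zero [simp]:
  "a \<in> carrier A \<Longrightarrow> a \<odot>\<^bsub>M\<^esub> \<zero>\<^bsub>M\<^esub> = \<zero>\<^bsub>M\<^esub>"
  by (metis M.add.r_cancel_one' M.l_zero M.zero_closed smult_closed smult_r_distr)

lemma (in right_module) zero_smult [simp]:
  "x \<in> carrier M \<Longrightarrow> \<zero> \<odot>\<^bsub>M\<^esub> x = \<zero>\<^bsub>M\<^esub>"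
  by (metis M.add.r_cancel_one' R.l_zero R.zero_closed smult_closed smult_l_distr)

lemma (in right_module) minus_smult:
  "\<lbrakk>a \<in> carrier A; x \<in> carrier M\<rbrakk> \<Longrightarrow> (\<ominus> a) \<odot>\<^bsub>M\<^esub> x = \<ominus>\<^bsub>M\<^esub> (a \<odot>\<^bsub>M\<^esub> x)"
  by (metis M.minus_equality R.a_inv_closed R.l_neg smult_closed smult_l_distr zero_smult)

lemma (in right_module) smult_finsum:
  assumes "finite I" "a \<in> carrier A" "f \<in> I \<rightarrow> carrier M"
  shows "a \<odot>\<^bsub>M\<^esub> (\<Oplus>\<^bsub>M\<^esub>i\<in>I. f i) = (\<Oplus>\<^bsub>M\<^esub>i\<in>I. a \<odot>\<^bsub>M\<^esub> f i)"
  using assms by (induct set: finite) (simp_all add: Pi_def smult_r_distr)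

lemma (in right_module) module_copy:
  fixes F :: "'m \<Rightarrow> 'd"
  assumes inj: "inj_on F (carrier M)"
  shows "\<exists>N :: ('a, 'd) module. right_module A N \<and> mod_isomorphic A M N"
proof -
  define G where "G = inv_into (carrier M) F"
  have G [simp]: "G (F x) = x" if "x \<in> carrier M" for x
    using inj that by (simp add: G_def)
  define N :: "('a, 'd) module" where "N =
     \<lparr>carrier = F ` carrier M, monoid.mult = undefined, one = undefined,
      ring.zero = F \<zero>\<^bsub>M\<^esub>, add = (\<lambda>x y. F (G x \<oplus>\<^bsub>M\<^esub> G y)), smult = (\<lambda>a x. F (a \<odot>\<^bsub>M\<^esub> G x))\<rparr>"
  have "abelian_group N"
  proof (rule abelian_groupI)
    fix x assume "x \<in> carrier N"
    then obtain y where "y \<in> carrier M" "x = F y" by (auto simp: N_def)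
    then show "\<exists>z\<in>carrier N. z \<oplus>\<^bsub>N\<^esub> x = \<zero>\<^bsub>N\<^esub>"
      by (intro bexI[of _ "F (\<ominus>\<^bsub>M\<^esub> y)"]) (auto simp: N_def M.l_neg)
  qed (auto simp: N_def M.a_ac)
  then have "right_module A N"
    by (intro right_module.intro right_module_axioms.intro R.ring_axioms)
       (auto simp: N_def smult_l_distr smult_r_distr smult_mult)
  moreover have "restrict F (carrier M) \<in> mod_iso A M N"
    using inj by (auto simp: mod_iso_def mod_hom_def N_def bij_betw_def inj_on_def)
  ultimately show ?thesis
    by (auto simp: mod_isomorphic_def)
qed

lemma fin_gen_module_copy:
  fixes A :: "('a, 'z) ring_scheme" and M :: "('a, 'm, 'y) module_scheme"
  assumes "right_module A M" and "fin_gen A M"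
  shows "\<exists>N :: 'a fg_module. right_module A N \<and> mod_isomorphic A M N"
proof -
  interpret right_module A M by fact
  obtain S where S: "finite S" "S \<subseteq> carrier M" "gen_submodule A M S = carrier M"
    using assms(2) by (auto simp: fin_gen_def)
  obtain g :: "nat \<Rightarrow> 'm" and n where g: "S = g ` {i. i < n}"
    using S(1) by (auto simp: finite_conv_nat_seg_image)
  have gM [simp]: "g i \<in> carrier M" if "i < n" for i
    using that S(2) g by auto
  define C where "C v = (\<Oplus>\<^bsub>M\<^esub>i\<in>{..<n}. v i \<odot>\<^bsub>M\<^esub> g i)" for v :: "nat \<Rightarrow> 'a"
  define V where "V = {v :: nat \<Rightarrow> 'a. \<forall>i. v i \<in> carrier A}"
  have "submodule (C ` V) A M"
  proof (intro submodule.intro subgroup.intro submodule_axioms.intro, simp_all)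
    show "C ` V \<subseteq> carrier M"
      by (auto simp: C_def V_def intro!: M.finsum_closed)
    show "\<zero>\<^bsub>M\<^esub> \<in> C ` V"
      by (rule image_eqI[of _ _ "\<lambda>_. \<zero>\<^bsub>A\<^esub>"]) (auto simp: C_def V_def intro!: M.add.finprod_one_eqI[symmetric])
  next
    fix x y assume "x \<in> C ` V" "y \<in> C ` V"
    then obtain v w where vw: "x = C v" "y = C w" "v \<in> V" "w \<in> V" by auto
    then have "x \<oplus>\<^bsub>M\<^esub> y = C (\<lambda>i. v i \<oplus>\<^bsub>A\<^esub> w i)"
      unfolding vw C_def
      by (subst M.finsum_addf[symmetric]) (auto simp: V_def smult_l_distr Pi_def cong: M.finsum_cong)
    then show "x \<oplus>\<^bsub>M\<^esub> y \<in> C ` V" using vw by (auto simp: V_def)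
  next
    fix x assume "x \<in> C ` V"
    then obtain v where v: "x = C v" "v \<in> V" by auto
    have x: "x \<in> carrier M" using v by (auto simp: C_def V_def intro!: M.finsum_closed)
    have "C (\<lambda>i. \<ominus>\<^bsub>A\<^esub> v i) \<oplus>\<^bsub>M\<^esub> x =
        (\<Oplus>\<^bsub>M\<^esub>i\<in>{..<n}. (\<ominus>\<^bsub>A\<^esub> v i) \<odot>\<^bsub>M\<^esub> g i \<oplus>\<^bsub>M\<^esub> v i \<odot>\<^bsub>M\<^esub> g i)"
      using v(2) unfolding v(1) C_def by (intro M.finsum_addf[symmetric]) (auto simp: V_def)
    also have "\<dots> = (\<Oplus>\<^bsub>M\<^esub>i\<in>{..<n}. \<zero>\<^bsub>M\<^esub>)"
      using v(2) by (intro M.finsum_cong') (auto simp: V_def minus_smult M.l_neg)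
    finally have "C (\<lambda>i. \<ominus>\<^bsub>A\<^esub> v i) \<oplus>\<^bsub>M\<^esub> x = \<zero>\<^bsub>M\<^esub>" by simp
    then have "\<ominus>\<^bsub>M\<^esub> x = C (\<lambda>i. \<ominus>\<^bsub>A\<^esub> v i)"
      using v(2) x by (intro M.minus_equality) (auto simp: C_def V_def intro!: M.finsum_closed)
    then show "inv\<^bsub>add_monoid M\<^esub> x \<in> C ` V"
      using v(2) by (auto simp: V_def a_inv_def)
  next
    fix a x assume a: "a \<in> carrier A" and "x \<in> C ` V"
    then obtain v where v: "x = C v" "v \<in> V" by auto
    then have "a \<odot>\<^bsub>M\<^esub> x = C (\<lambda>i. v i \<otimes>\<^bsub>A\<^esub> a)"
      using a unfolding v C_def
      by (subst smult_finsum) (auto simp: V_def smult_mult intro!: M.finsum_cong')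
    then show "a \<odot>\<^bsub>M\<^esub> x \<in> C ` V" using a v by (auto simp: V_def)
  qed
  moreover have "S \<subseteq> C ` V"
  proof
    fix s assume "s \<in> S"
    then obtain k where k: "k < n" "s = g k" using g by auto
    have "C (\<lambda>i. if i = k then \<one>\<^bsub>A\<^esub> else \<zero>\<^bsub>A\<^esub>) =
        (\<Oplus>\<^bsub>M\<^esub>i\<in>{..<n}. if k = i then g i else \<zero>\<^bsub>M\<^esub>)"
      unfolding C_def by (rule M.finsum_cong') auto
    also have "\<dots> = s"
      using k M.finsum_singleton[of k "{..<n}" g] by auto
    finally show "s \<in> C ` V"
      by (intro image_eqI[of _ _ "\<lambda>i. if i = k then \<one>\<^bsub>A\<^esub> else \<zero>\<^bsub>A\<^esub>"]) (auto simp: V_def)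
  qed
  ultimately have "gen_submodule A M S \<subseteq> C ` V"
    by (auto simp: gen_submodule_def)
  then have surj: "carrier M \<subseteq> C ` V"
    using S(3) by simp
  have "inj_on (\<lambda>m. {v \<in> V. C v = m}) (carrier M)"
  proof (rule inj_onI)
    fix x y assume "x \<in> carrier M" and eq: "{v \<in> V. C v = x} = {v \<in> V. C v = y}"
    then obtain v where "v \<in> V" "C v = x" using surj by blast
    then show "x = y" using eq by blast
  qed
  then show ?thesis
    by (intro module_copy) auto
qed

end

theory Submission
  imports Defs "HOL-Algebra.RingHom"
begin

text \<open>
  Write \<open>l\<close> and \<open>r\<close> for left and right annihilators. Since \<open>A\<close> is QF-2 and every simple right
  module embeds in \<open>A\<close>, the socles of the modules \<open>e\<^sub>i A\<close> represent every simple module exactly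
  once. Hence left multiplication by \<open>a\<close> either kills a minimal right ideal or can be undone on
  it, so that for a maximal right ideal \<open>M\<close> the left ideal \<open>l(M)\<close>, which is the dual of \<open>A/M\<close>,
  is semisimple. By reflexivity every left homomorphism \<open>l(M) \<rightarrow> A\<close> is a right multiplication;
  applied to the projection onto a simple summand this shows that \<open>l(M)\<close> is simple, and the dual
  of \<open>l(M)\<close> is again simple.

  Now let \<open>f : I \<rightarrow> A\<close> be a homomorphism on a right ideal. If \<open>J \<subset> K\<close> are right ideals with
  \<open>K/J\<close> simple and \<open>J = r(l(J))\<close>, then simplicity of the duals gives \<open>K = r(l(K))\<close>, and an
  extension of \<open>f\<close> from \<open>J\<close> to \<open>A\<close> can be corrected by an element of \<open>l(J)\<close> to an extension from
  \<open>K\<close>. As \<open>l(K)\<close> is strictly smaller than \<open>l(J)\<close>, the descending chain condition on left ideals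
  lets this process end only at \<open>I\<close>. No length count is needed.
\<close>

section \<open>Ideals, annihilators and extension of homomorphisms\<close>

text \<open>The hypotheses speak of right modules, while extending a homomorphism needs the
  structure of the left modules \<open>left_ann A M\<close>. The bridge is a count. A simple module
  \<open>A/M\<close> embeds in \<open>A\<close> because its evaluation map is injective, so the top
  of each of the \<open>n\<close> modules \<open>e p A\<close> occurs as the socle of some
  \<open>e i A\<close>. As \<open>A\<close> is basic, different \<open>p\<close> have different
  tops; hence they use different \<open>i\<close>, every socle is used, and no two socles are
  isomorphic. If \<open>u A\<close> is minimal and \<open>a u\<close> is not zero, the isomorphic
  right ideals \<open>u A\<close> and \<open>a u A\<close> must then lie in the same
  \<open>e i A\<close>, where \<open>a\<close> acts through the corner \<open>e i A e i\<close>. An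
  element of this corner that does not kill the simple socle is injective on \<open>e i A\<close>,
  and bijective by the chain condition; so \<open>A u\<close> is simple. This still allows
  \<open>left_ann A M\<close> to be a sum of several simple modules, which is what surjectivity of
  the evaluation map excludes. Arguments about quotients, duals and covers are phrased with elements
  and annihilators; modules as such appear in the criterion of Baer and where the hypotheses are
  unpacked.\<close>

definition right_ideal :: "('a, 'z) ring_scheme \<Rightarrow> 'a set \<Rightarrow> bool" where
  "right_ideal A I \<longleftrightarrow> I \<subseteq> carrier A \<and> \<zero>\<^bsub>A\<^esub> \<in> I \<and>
     (\<forall>x\<in>I. \<forall>y\<in>I. x \<oplus>\<^bsub>A\<^esub> y \<in> I) \<and> (\<forall>x\<in>I. \<forall>a\<in>carrier A. x \<otimes>\<^bsub>A\<^esub> a \<in> I)"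

definition left_ideal :: "('a, 'z) ring_scheme \<Rightarrow> 'a set \<Rightarrow> bool" where
  "left_ideal A I \<longleftrightarrow> I \<subseteq> carrier A \<and> \<zero>\<^bsub>A\<^esub> \<in> I \<and>
     (\<forall>x\<in>I. \<forall>y\<in>I. x \<oplus>\<^bsub>A\<^esub> y \<in> I) \<and> (\<forall>x\<in>I. \<forall>a\<in>carrier A. a \<otimes>\<^bsub>A\<^esub> x \<in> I)"

definition left_ann :: "('a, 'z) ring_scheme \<Rightarrow> 'a set \<Rightarrow> 'a set" where
  "left_ann A X = {a \<in> carrier A. \<forall>x\<in>X. a \<otimes>\<^bsub>A\<^esub> x = \<zero>\<^bsub>A\<^esub>}"

definition right_ann :: "('a, 'z) ring_scheme \<Rightarrow> 'a set \<Rightarrow> 'a set" where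
  "right_ann A X = {a \<in> carrier A. \<forall>x\<in>X. x \<otimes>\<^bsub>A\<^esub> a = \<zero>\<^bsub>A\<^esub>}"

text \<open>The last clause says that \<open>a\<close> and \<open>M\<close> together generate \<open>A\<close>.\<close>

definition max_right_ideal :: "('a, 'z) ring_scheme \<Rightarrow> 'a set \<Rightarrow> bool" where
  "max_right_ideal A M \<longleftrightarrow> right_ideal A M \<and> \<one>\<^bsub>A\<^esub> \<notin> M \<and>
     (\<forall>a\<in>carrier A - M. \<exists>b\<in>carrier A. \<one>\<^bsub>A\<^esub> \<ominus>\<^bsub>A\<^esub> a \<otimes>\<^bsub>A\<^esub> b \<in> M)"

text \<open>The minimum condition, for an arbitrary predicate, so that right ideals, left ideals and
  submodules over the base ring share one notion.\<close>

definition dcc :: "('b set \<Rightarrow> bool) \<Rightarrow> bool" where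
  "dcc P \<longleftrightarrow> (\<forall>S. S \<noteq> {} \<and> (\<forall>I\<in>S. P I) \<longrightarrow> (\<exists>I\<in>S. \<forall>K\<in>S. K \<subseteq> I \<longrightarrow> K = I))"

text \<open>Unlike in \<^const>\<open>mod_hom\<close>, the values outside \<open>I\<close> are arbitrary.\<close>

definition right_hom_on :: "('a, 'z) ring_scheme \<Rightarrow> 'a set \<Rightarrow> ('a \<Rightarrow> 'a) \<Rightarrow> bool" where
  "right_hom_on A I f \<longleftrightarrow> (\<forall>x\<in>I. f x \<in> carrier A) \<and>
     (\<forall>x\<in>I. \<forall>y\<in>I. f (x \<oplus>\<^bsub>A\<^esub> y) = f x \<oplus>\<^bsub>A\<^esub> f y) \<and>
     (\<forall>x\<in>I. \<forall>a\<in>carrier A. f (x \<otimes>\<^bsub>A\<^esub> a) = f x \<otimes>\<^bsub>A\<^esub> a)"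

definition left_hom_on :: "('a, 'z) ring_scheme \<Rightarrow> 'a set \<Rightarrow> ('a \<Rightarrow> 'a) \<Rightarrow> bool" where
  "left_hom_on A I f \<longleftrightarrow> (\<forall>x\<in>I. f x \<in> carrier A) \<and>
     (\<forall>x\<in>I. \<forall>y\<in>I. f (x \<oplus>\<^bsub>A\<^esub> y) = f x \<oplus>\<^bsub>A\<^esub> f y) \<and>
     (\<forall>x\<in>I. \<forall>a\<in>carrier A. f (a \<otimes>\<^bsub>A\<^esub> x) = a \<otimes>\<^bsub>A\<^esub> f x)"

lemma dccE:
  assumes "dcc P" "S \<noteq> {}" "\<And>I. I \<in> S \<Longrightarrow> P I"
  obtains I where "I \<in> S" "\<And>K. K \<in> S \<Longrightarrow> K \<subseteq> I \<Longrightarrow> K = I"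
  using assms unfolding dcc_def by meson

lemma dcc_sequenceI:
  assumes "\<And>L. (\<And>n :: nat. P (L n)) \<Longrightarrow> (\<And>n. L (Suc n) \<subseteq> L n) \<Longrightarrow> \<exists>n. \<forall>m\<ge>n. L m = L n"
  shows "dcc P"
  unfolding dcc_def
proof (intro allI impI, rule ccontr)
  fix S assume S: "S \<noteq> {} \<and> (\<forall>I\<in>S. P I)" and no: "\<not> (\<exists>I\<in>S. \<forall>K\<in>S. K \<subseteq> I \<longrightarrow> K = I)"
  \<comment> \<open>Dependent choice: without a minimal member, every member of \<open>S\<close> has
    a strictly smaller one.\<close>
  then have "\<exists>L. \<forall>n. L n \<in> S \<and> L (Suc n) \<subset> L n"
    by (intro dependent_nat_choice) (use S in auto)
  then obtain L where "\<forall>n. L n \<in> S \<and> L (Suc n) \<subset> L n" ..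
  then have L: "L n \<in> S" "L (Suc n) \<subset> L n" for n by auto
  then obtain n where "\<forall>m\<ge>n. L m = L n" using assms[of L] S by blast
  then have "L (Suc n) = L n" using le_SucI by blast
  then show False using L(2)[of n] by simp
qed

context ring
begin

lemma right_ideal_closed: "right_ideal R I \<Longrightarrow> x \<in> I \<Longrightarrow> x \<in> carrier R"
  by (auto simp: right_ideal_def)

lemma right_ideal_smult: "right_ideal R I \<Longrightarrow> x \<in> I \<Longrightarrow> a \<in> carrier R \<Longrightarrow> x \<otimes> a \<in> I"
  by (auto simp: right_ideal_def)

lemma right_ideal_add: "right_ideal R I \<Longrightarrow> x \<in> I \<Longrightarrow> y \<in> I \<Longrightarrow> x \<oplus> y \<in> I"
  by (auto simp: right_ideal_def)

lemma right_ideal_zero: "right_ideal R I \<Longrightarrow> \<zero> \<in> I"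
  by (auto simp: right_ideal_def)

text \<open>Negation is multiplication by \<open>\<ominus> \<one>\<close>, which is why
  \<open>right_ideal\<close> asks for sums and multiples only.\<close>

lemma right_ideal_minus: "right_ideal R I \<Longrightarrow> x \<in> I \<Longrightarrow> y \<in> I \<Longrightarrow> x \<ominus> y \<in> I"
  using right_ideal_smult[of I y "\<ominus> \<one>"] right_ideal_closed[of I y]
  by (auto simp: minus_eq r_minus intro: right_ideal_add)

lemma left_ideal_closed: "left_ideal R I \<Longrightarrow> x \<in> I \<Longrightarrow> x \<in> carrier R"
  by (auto simp: left_ideal_def)

lemma left_ideal_smult: "left_ideal R I \<Longrightarrow> x \<in> I \<Longrightarrow> a \<in> carrier R \<Longrightarrow> a \<otimes> x \<in> I"
  by (auto simp: left_ideal_def)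

lemma left_ideal_add: "left_ideal R I \<Longrightarrow> x \<in> I \<Longrightarrow> y \<in> I \<Longrightarrow> x \<oplus> y \<in> I"
  by (auto simp: left_ideal_def)

lemma left_ideal_zero: "left_ideal R I \<Longrightarrow> \<zero> \<in> I"
  by (auto simp: left_ideal_def)

lemma left_ideal_minus: "left_ideal R I \<Longrightarrow> x \<in> I \<Longrightarrow> y \<in> I \<Longrightarrow> x \<ominus> y \<in> I"
  using left_ideal_smult[of I y "\<ominus> \<one>"] left_ideal_closed[of I y]
  by (auto simp: minus_eq l_minus intro: left_ideal_add)

lemma minus_distr_r: "\<lbrakk>x \<in> carrier R; y \<in> carrier R; z \<in> carrier R\<rbrakk> \<Longrightarrow> x \<otimes> (y \<ominus> z) = x \<otimes> y \<ominus> x \<otimes> z"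
  by (simp add: minus_eq r_distr r_minus)

lemma minus_distr_l: "\<lbrakk>x \<in> carrier R; y \<in> carrier R; z \<in> carrier R\<rbrakk> \<Longrightarrow> (y \<ominus> z) \<otimes> x = y \<otimes> x \<ominus> z \<otimes> x"
  by (simp add: minus_eq l_distr l_minus)

lemma minus_eq_zero_iff: "\<lbrakk>x \<in> carrier R; y \<in> carrier R\<rbrakk> \<Longrightarrow> x \<ominus> y = \<zero> \<longleftrightarrow> x = y"
proof
  assume xy: "x \<in> carrier R" "y \<in> carrier R" "x \<ominus> y = \<zero>"
  then show "x = y" using add.inv_solve_right'[of "\<zero>" x y] by (simp add: minus_eq)
qed (simp add: minus_eq r_neg)

lemma add_minus_cancel: "\<lbrakk>x \<in> carrier R; y \<in> carrier R\<rbrakk> \<Longrightarrow> y \<oplus> (x \<ominus> y) = x"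
  by (metis a_comm add.inv_solve_right' minus_closed minus_eq)

lemma left_ideal_left_ann:
  "X \<subseteq> carrier R \<Longrightarrow> left_ideal R (left_ann R X)"
  by (auto simp: left_ideal_def left_ann_def l_distr subset_eq m_assoc)

lemma right_ideal_sum:
  assumes "right_ideal R I" "z \<in> carrier R"
  shows "right_ideal R {i \<oplus> z \<otimes> a | i a. i \<in> I \<and> a \<in> carrier R}"
    and "I \<subseteq> {i \<oplus> z \<otimes> a | i a. i \<in> I \<and> a \<in> carrier R}"
    and "z \<in> {i \<oplus> z \<otimes> a | i a. i \<in> I \<and> a \<in> carrier R}"
proof -
  let ?K = "{i \<oplus> z \<otimes> a | i a. i \<in> I \<and> a \<in> carrier R}"
  note [simp] = right_ideal_closed[OF assms(1)] assms(2)
  show "I \<subseteq> ?K"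
  proof
    fix i assume "i \<in> I"
    then have "i = i \<oplus> z \<otimes> \<zero>" by simp
    with \<open>i \<in> I\<close> show "i \<in> ?K" by blast
  qed
  then have "\<zero> \<in> ?K" using right_ideal_zero[OF assms(1)] by blast
  moreover have "x \<oplus> y \<in> ?K" if x: "x \<in> ?K" and y: "y \<in> ?K" for x y
  proof -
    obtain i a where "x = i \<oplus> z \<otimes> a" "i \<in> I" "a \<in> carrier R" using x by blast
    moreover obtain j b where "y = j \<oplus> z \<otimes> b" "j \<in> I" "b \<in> carrier R" using y by blast
    ultimately have "x \<oplus> y = (i \<oplus> j) \<oplus> z \<otimes> (a \<oplus> b)" "i \<oplus> j \<in> I" "a \<oplus> b \<in> carrier R"
      using right_ideal_add[OF assms(1)] by (auto simp: r_distr a_ac)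
    then show ?thesis by blast
  qed
  moreover have "x \<otimes> c \<in> ?K" if x: "x \<in> ?K" and c: "c \<in> carrier R" for x c
  proof -
    obtain i a where "x = i \<oplus> z \<otimes> a" "i \<in> I" "a \<in> carrier R" using x by blast
    then have "x \<otimes> c = i \<otimes> c \<oplus> z \<otimes> (a \<otimes> c)" "i \<otimes> c \<in> I" "a \<otimes> c \<in> carrier R"
      using right_ideal_smult[OF assms(1)] c by (auto simp: l_distr m_assoc)
    then show ?thesis by blast
  qed
  ultimately show "right_ideal R ?K"
    unfolding right_ideal_def by auto
  show "z \<in> ?K"
  proof -
    have "z = \<zero> \<oplus> z \<otimes> \<one>" by simp
    with right_ideal_zero[OF assms(1)] show ?thesis by blast
  qed
qed

section \<open>Extension of homomorphisms from a right ideal to the ring\<close>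

text \<open>\<open>gen\<close> makes the dual \<open>left_ann R M\<close> of \<open>R/M\<close> zero
  or simple, and \<open>cogen\<close> makes \<open>u R\<close> a double annihilator. The family
  \<open>S\<close> contains only double annihilators, because an element outside \<open>J\<close>
  has to be detected by some \<open>y\<close> in \<open>left_ann R J\<close>; this same
  \<open>y\<close> then corrects the extension.\<close>

lemma extension_by_annihilators:
  assumes left_dcc: "dcc (left_ideal R)" and right_dcc: "dcc (right_ideal R)"
    and gen: "\<And>M u v. \<lbrakk>max_right_ideal R M; u \<in> left_ann R M; u \<noteq> \<zero>; v \<in> left_ann R M\<rbrakk>
        \<Longrightarrow> \<exists>b\<in>carrier R. v = b \<otimes> u"
    and cogen: "\<And>M u x. \<lbrakk>max_right_ideal R M; u \<in> left_ann R M; u \<noteq> \<zero>; x \<in> right_ann R (left_ann R {u})\<rbrakk>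
        \<Longrightarrow> \<exists>b\<in>carrier R. x = u \<otimes> b"
    and I: "right_ideal R I" and f: "right_hom_on R I f"
  shows "\<exists>c\<in>carrier R. \<forall>x\<in>I. f x = c \<otimes> x"
proof -
  define S where "S = {J. right_ideal R J \<and> J \<subseteq> I \<and> right_ann R (left_ann R J) \<subseteq> J \<and>
     (\<exists>c\<in>carrier R. \<forall>x\<in>J. f x = c \<otimes> x)}"
  have Sr: "right_ideal R J" if "J \<in> S" for J
    using that by (auto simp: S_def)
  have Il: "left_ideal R (left_ann R J)" if "J \<in> S" for J
    using that by (intro left_ideal_left_ann) (auto simp: S_def right_ideal_def)
  have f0: "f \<zero> = \<zero>"
    using f right_ideal_zero[OF I] unfolding right_hom_on_def
    by (metis r_null zero_closed)
  have "\<one> \<in> left_ann R {\<zero>}"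
    by (simp add: left_ann_def)
  have "right_ann R (left_ann R {\<zero>}) \<subseteq> {\<zero>}"
  proof
    fix x assume "x \<in> right_ann R (left_ann R {\<zero>})"
    then have "x \<in> carrier R" "\<one> \<otimes> x = \<zero>"
      using \<open>\<one> \<in> left_ann R {\<zero>}\<close> by (auto simp only: right_ann_def)
    then show "x \<in> {\<zero>}" by simp
  qed
  moreover have "\<exists>c\<in>carrier R. \<forall>x\<in>{\<zero>}. f x = c \<otimes> x"
    using f0 by (intro bexI[of _ \<zero>]) auto
  moreover have "right_ideal R {\<zero>}"
    by (auto simp: right_ideal_def)
  ultimately have "{\<zero>} \<in> S"
    using right_ideal_zero[OF I] by (simp add: S_def)
  \<comment> \<open>Minimality is asked of the annihilator: growing \<open>J\<close> shrinks
    \<open>left_ann R J\<close>, so a descending chain condition applies to an ascending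
    construction.\<close>
  then obtain J where J: "J \<in> S" and
    min: "\<And>K. K \<in> S \<Longrightarrow> left_ann R K \<subseteq> left_ann R J \<Longrightarrow> left_ann R K = left_ann R J"
  proof -
    have "left_ann R ` S \<noteq> {}" using \<open>{\<zero>} \<in> S\<close> by blast
    then obtain L where L: "L \<in> left_ann R ` S"
      and Lmin: "\<And>K. K \<in> left_ann R ` S \<Longrightarrow> K \<subseteq> L \<Longrightarrow> K = L"
      by (rule dccE[OF left_dcc]) (use Il in auto)
    obtain J where "J \<in> S" "L = left_ann R J" using L by blast
    then show thesis using Lmin that by (metis imageI)
  qed
  have Jr: "right_ideal R J" and JI: "J \<subseteq> I" and Jc: "right_ann R (left_ann R J) \<subseteq> J"
    using J unfolding S_def by blast+
  obtain c where c: "c \<in> carrier R" "\<And>x. x \<in> J \<Longrightarrow> f x = c \<otimes> x"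
    using J unfolding S_def by blast
  note [simp] = right_ideal_closed[OF Jr] right_ideal_closed[OF I]
  have "J = I"
  proof (rule ccontr)
    assume "J \<noteq> I"
    let ?T = "{K. right_ideal R K \<and> J \<subset> K \<and> K \<subseteq> I}"
    have "?T \<noteq> {}" using I JI \<open>J \<noteq> I\<close> by auto
    \<comment> \<open>\<open>K\<close> covers \<open>J\<close>, so \<open>K/J\<close> is simple;
      \<open>span\<close> says this with elements.\<close>
    then obtain K where K: "K \<in> ?T" and Kmin: "\<And>K'. K' \<in> ?T \<Longrightarrow> K' \<subseteq> K \<Longrightarrow> K' = K"
      by (rule dccE[OF right_dcc]) auto
    have Kr: "right_ideal R K" and JK: "J \<subset> K" and KI: "K \<subseteq> I" using K by auto
    note [simp] = right_ideal_closed[OF Kr]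
    have span: "\<exists>i\<in>J. \<exists>a\<in>carrier R. x = i \<oplus> z \<otimes> a" if "z \<in> K - J" "x \<in> K" for z x
    proof -
      define K' where "K' = {i \<oplus> z \<otimes> a | i a. i \<in> J \<and> a \<in> carrier R}"
      have z: "z \<in> K" "z \<notin> J" "z \<in> carrier R" using that(1) by auto
      have "i \<oplus> z \<otimes> a \<in> K" if "i \<in> J" "a \<in> carrier R" for i a
        using that z(1) JK by (meson Kr psubsetD right_ideal_add right_ideal_smult)
      then have sub: "K' \<subseteq> K" unfolding K'_def by blast
      have K': "right_ideal R K'" "J \<subseteq> K'" "z \<in> K'"
        unfolding K'_def by (rule right_ideal_sum[OF Jr z(3)])+
      then have "K' = K" using Kmin[of K'] sub KI z(2) by blast
      then show ?thesis using that(2) unfolding K'_def by blast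
    qed
    obtain k where k: "k \<in> K" "k \<notin> J" using JK by blast
    have kc [simp]: "k \<in> carrier R" using k by simp
    \<comment> \<open>The annihilator of the class of \<open>k\<close>, so \<open>R/M\<close> is
      isomorphic to \<open>K/J\<close>.\<close>
    define M where "M = {a \<in> carrier R. k \<otimes> a \<in> J}"
    have "right_ideal R M"
      unfolding right_ideal_def M_def
      by (auto simp: r_distr m_assoc[symmetric] intro: right_ideal_zero[OF Jr]
          right_ideal_add[OF Jr] right_ideal_smult[OF Jr])
    moreover have "\<exists>b\<in>carrier R. \<one> \<ominus> a \<otimes> b \<in> M" if "a \<in> carrier R - M" for a
    proof -
      have a: "a \<in> carrier R" "k \<otimes> a \<in> K - J"
        using that k by (auto simp: M_def intro: right_ideal_smult[OF Kr])
      from span[OF a(2) k(1)] obtain i b where ib: "i \<in> J" "b \<in> carrier R" "k = i \<oplus> k \<otimes> a \<otimes> b"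
        by blast
      define t where "t = k \<otimes> a \<otimes> b"
      have t: "t \<in> carrier R" "k = i \<oplus> t" using a ib by (auto simp: t_def)
      have "k \<otimes> (\<one> \<ominus> a \<otimes> b) = k \<ominus> t"
        using a(1) ib(2) by (simp add: minus_distr_r m_assoc t_def)
      also have "k \<ominus> t = i"
        by (subst t(2)) (use ib(1) t(1) in \<open>simp add: minus_eq a_assoc r_neg\<close>)
      finally have "k \<otimes> (\<one> \<ominus> a \<otimes> b) \<in> J" using ib(1) by simp
      then show ?thesis using a(1) ib(2) by (intro bexI[of _ b]) (simp_all add: M_def)
    qed
    ultimately have M: "max_right_ideal R M"
      using k by (auto simp: max_right_ideal_def M_def)
    \<comment> \<open>Right multiplication by \<open>k\<close> maps \<open>left_ann R J\<close> to
      \<open>left_ann R M\<close> with kernel \<open>left_ann R K\<close>; \<open>y\<close> shows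
      that the image is not zero.\<close>
    have "k \<notin> right_ann R (left_ann R J)" using k Jc by blast
    then obtain y where y: "y \<in> left_ann R J" "y \<otimes> k \<noteq> \<zero>"
      by (auto simp: right_ann_def)
    have yc [simp]: "y \<in> carrier R" and yJ: "\<And>j. j \<in> J \<Longrightarrow> y \<otimes> j = \<zero>"
      using y by (auto simp: left_ann_def)
    have annM: "z \<otimes> k \<in> left_ann R M" if "z \<in> left_ann R J" for z
      using that by (auto simp: left_ann_def M_def m_assoc)
    have gen': "\<exists>b\<in>carrier R. v = b \<otimes> (y \<otimes> k)" if "v \<in> left_ann R M" for v
      using gen[OF M annM[OF y(1)] y(2) that] .
    have annK: "t \<in> left_ann R K" if "t \<in> left_ann R J" "t \<otimes> k = \<zero>" for t
    proof -
      have t: "t \<in> carrier R" "\<And>j. j \<in> J \<Longrightarrow> t \<otimes> j = \<zero>" using that by (auto simp: left_ann_def)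
      have "t \<otimes> x = \<zero>" if "x \<in> K" for x
      proof -
        obtain i a where "i \<in> J" "a \<in> carrier R" "x = i \<oplus> k \<otimes> a" using span[of k x] k \<open>x \<in> K\<close> by auto
        then show ?thesis using t \<open>t \<otimes> k = \<zero>\<close> by (simp add: r_distr m_assoc[symmetric])
      qed
      then show ?thesis using t by (auto simp: left_ann_def)
    qed
    have closed: "right_ann R (left_ann R K) \<subseteq> K"
    proof
      fix x assume x: "x \<in> right_ann R (left_ann R K)"
      have xc [simp]: "x \<in> carrier R" and xK: "\<And>t. t \<in> left_ann R K \<Longrightarrow> t \<otimes> x = \<zero>"
        using x by (auto simp: right_ann_def)
      \<comment> \<open>Modulo \<open>left_ann R K\<close>, which kills \<open>x\<close>, the left
        ideal \<open>left_ann R J\<close> is generated by \<open>y\<close>. So \<open>x\<close> lies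
        in \<open>K\<close> once some multiple of \<open>k\<close> can be subtracted to make
        \<open>y\<close> kill the difference; \<open>cogen\<close> supplies the multiple.\<close>
      have "y \<otimes> x \<in> right_ann R (left_ann R {y \<otimes> k})"
      proof -
        have "a \<otimes> (y \<otimes> x) = \<zero>" if "a \<in> carrier R" "a \<otimes> (y \<otimes> k) = \<zero>" for a
        proof -
          have "a \<otimes> y \<in> left_ann R J" using that y by (auto simp: left_ann_def m_assoc)
          then have "a \<otimes> y \<in> left_ann R K" using that by (intro annK) (auto simp: m_assoc)
          then show ?thesis using xK that by (simp add: m_assoc[symmetric])
        qed
        then show ?thesis by (auto simp: right_ann_def left_ann_def)
      qed
      then obtain b where b: "b \<in> carrier R" "y \<otimes> x = y \<otimes> k \<otimes> b"
        using cogen[OF M annM[OF y(1)] y(2)] by blast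
      have "z \<otimes> (x \<ominus> k \<otimes> b) = \<zero>" if z: "z \<in> left_ann R J" for z
      proof -
        have zc [simp]: "z \<in> carrier R" using z by (auto simp: left_ann_def)
        obtain d where d: "d \<in> carrier R" "z \<otimes> k = d \<otimes> (y \<otimes> k)" using gen'[OF annM[OF z]] by blast
        have "z \<ominus> d \<otimes> y \<in> left_ann R K"
        proof (rule annK)
          show "z \<ominus> d \<otimes> y \<in> left_ann R J"
            using z y(1) d(1) JI I
            by (intro left_ideal_minus left_ideal_smult left_ideal_left_ann) (auto simp: right_ideal_def)
          show "(z \<ominus> d \<otimes> y) \<otimes> k = \<zero>" using d by (simp add: minus_distr_l m_assoc minus_eq_zero_iff)
        qed
        then have "(z \<ominus> d \<otimes> y) \<otimes> x = \<zero>" by (rule xK)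
        then have "z \<otimes> x = d \<otimes> (y \<otimes> x)" using d by (simp add: minus_distr_l m_assoc minus_eq_zero_iff)
        also have "\<dots> = d \<otimes> (y \<otimes> k) \<otimes> b" using d(1) b by (simp add: m_assoc)
        also have "\<dots> = z \<otimes> (k \<otimes> b)" using b(1) by (simp add: d(2)[symmetric] m_assoc)
        finally show ?thesis using b by (simp add: minus_distr_r minus_eq_zero_iff)
      qed
      then have "x \<ominus> k \<otimes> b \<in> right_ann R (left_ann R J)" using b by (simp add: right_ann_def)
      then have "x \<ominus> k \<otimes> b \<in> J" using Jc by blast
      then have "k \<otimes> b \<oplus> (x \<ominus> k \<otimes> b) \<in> K"
        using JK k b by (intro right_ideal_add[OF Kr] right_ideal_smult[OF Kr]) auto
      then show "x \<in> K" using b by (simp add: add_minus_cancel)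
    qed
    have fc [simp]: "f x \<in> carrier R" if "x \<in> I" for x using f that by (auto simp: right_hom_on_def)
    have kI: "k \<in> I" using k KI by auto
    \<comment> \<open>The defect of \<open>c\<close> at \<open>k\<close>. It kills \<open>M\<close>
      because \<open>f\<close> is multiplication by \<open>c\<close> on \<open>J\<close>; hence it
      is a multiple of \<open>y \<otimes> k\<close>, and adding that multiple of \<open>y\<close> to
      \<open>c\<close> repairs the value at \<open>k\<close> without changing any value on
      \<open>J\<close>.\<close>
    define v where "v = f k \<ominus> c \<otimes> k"
    have vc [simp]: "v \<in> carrier R" using c kI by (simp add: v_def)
    have "v \<otimes> a = \<zero>" if "a \<in> M" for a
    proof -
      have a: "a \<in> carrier R" "k \<otimes> a \<in> J" using that by (auto simp: M_def)
      have "f k \<otimes> a = f (k \<otimes> a)" using f a kI by (auto simp: right_hom_on_def)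
      then show ?thesis using c a kI by (simp add: v_def minus_distr_l m_assoc minus_eq_zero_iff)
    qed
    then have "v \<in> left_ann R M" by (auto simp: left_ann_def)
    then obtain b where b: "b \<in> carrier R" "v = b \<otimes> (y \<otimes> k)" using gen' by blast
    have fk: "f k = c \<otimes> k \<oplus> b \<otimes> (y \<otimes> k)"
      using add_minus_cancel[of "f k" "c \<otimes> k"] c(1) kI unfolding b(2)[symmetric] v_def by simp
    have "f x = (c \<oplus> b \<otimes> y) \<otimes> x" if "x \<in> K" for x
    proof -
      obtain i a where ia: "i \<in> J" "a \<in> carrier R" "x = i \<oplus> k \<otimes> a" using span[of k x] k \<open>x \<in> K\<close> by auto
      have iI: "i \<in> I" using ia JI by blast
      have kaI: "k \<otimes> a \<in> I" using kI ia I by (auto intro: right_ideal_smult)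
      have "f x = f i \<oplus> f k \<otimes> a"
        using f ia kI kaI iI by (simp add: right_hom_on_def)
      also have "\<dots> = c \<otimes> i \<oplus> (c \<otimes> k \<oplus> b \<otimes> (y \<otimes> k)) \<otimes> a" using c ia fk by simp
      also have "\<dots> = (c \<oplus> b \<otimes> y) \<otimes> x"
        using c b ia yJ[OF ia(1)] by (simp add: l_distr r_distr m_assoc a_ac)
      finally show ?thesis .
    qed
    then have "K \<in> S" using Kr KI closed b c by (auto simp: S_def)
    moreover have "left_ann R K \<subseteq> left_ann R J" using JK by (auto simp: left_ann_def)
    ultimately have "left_ann R K = left_ann R J" by (rule min)
    then show False using y k by (auto simp: left_ann_def)
  qed
  then show ?thesis using c by blast
qed

end

section \<open>Chain conditions and the criterion of Baer\<close>

lemma dcc_mono: "dcc P \<Longrightarrow> (\<And>L. Q L \<Longrightarrow> P L) \<Longrightarrow> dcc Q"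
  unfolding dcc_def by blast

lemma dcc_sequenceD:
  assumes "dcc P" "\<And>n :: nat. P (L n)" "\<And>n. L (Suc n) \<subseteq> L n"
  shows "\<exists>n. \<forall>m\<ge>n. L m = L n"
proof -
  have "range L \<noteq> {}" by blast
  then obtain I where I: "I \<in> range L" "\<And>K. K \<in> range L \<Longrightarrow> K \<subseteq> I \<Longrightarrow> K = I"
    by (rule dccE[OF assms(1)]) (use assms(2) in auto)
  then obtain n where n: "I = L n" by blast
  have "L m = L n" if "n \<le> m" for m
    using I(2)[of "L m"] lift_Suc_antimono_le[of L, OF assms(3) that] by (simp add: n)
  then show ?thesis by blast
qed

lemma (in right_module) submodule_iff:
  "submodule N A M \<longleftrightarrow> N \<subseteq> carrier M \<and> \<zero>\<^bsub>M\<^esub> \<in> N \<and>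
     (\<forall>x\<in>N. \<forall>y\<in>N. x \<oplus>\<^bsub>M\<^esub> y \<in> N) \<and> (\<forall>a\<in>carrier A. \<forall>x\<in>N. a \<odot>\<^bsub>M\<^esub> x \<in> N)"
  (is "_ \<longleftrightarrow> ?rhs")
proof
  assume N: "submodule N A M"
  interpret submodule N A M by fact
  show ?rhs using subset one_closed m_closed smult_closed by auto
next
  assume rhs: ?rhs
  have "inv\<^bsub>add_monoid M\<^esub> x \<in> N" if x: "x \<in> N" for x
  proof -
    have "(\<ominus> \<one>) \<odot>\<^bsub>M\<^esub> x \<in> N" "x \<in> carrier M" using rhs x by auto
    then have "\<ominus>\<^bsub>M\<^esub> x \<in> N" by (simp add: minus_smult)
    then show ?thesis by (simp add: a_inv_def)
  qed
  then show "submodule N A M"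
    using rhs by (intro submodule.intro subgroup.intro submodule_axioms.intro) auto
qed

lemma (in ring) submodule_right_regular_iff:
  "submodule I R (right_regular R) \<longleftrightarrow> right_ideal R I"
proof -
  interpret A: right_module R "right_regular R" by (rule right_module_right_regular) (rule ring_axioms)
  show ?thesis unfolding A.submodule_iff by (auto simp: right_ideal_def right_regular_def)
qed

lemma (in ring) add_minus_add:
  assumes "a \<in> carrier R" "v \<in> carrier R" "w \<in> carrier R"
  shows "(a \<oplus> v) \<ominus> (a \<oplus> w) = v \<ominus> w"
proof -
  have "(a \<oplus> v) \<ominus> (a \<oplus> w) = (v \<oplus> a) \<oplus> (\<ominus> a \<oplus> \<ominus> w)"
    using assms by (simp add: minus_eq minus_add a_comm)
  also have "\<dots> = v \<ominus> w" using assms by (simp add: a_assoc r_neg2 minus_eq)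
  finally show ?thesis .
qed

lemma (in cring) ideal_right_ideal:
  assumes "right_ideal R I" shows "ideal I R"
proof (rule idealI[OF ring_axioms])
  show "subgroup I (add_monoid R)"
  proof (intro subgroup.intro)
    fix x assume "x \<in> I"
    then have "\<zero> \<ominus> x \<in> I" "x \<in> carrier R"
      using assms by (auto intro: right_ideal_minus right_ideal_zero right_ideal_closed)
    then show "inv\<^bsub>add_monoid R\<^esub> x \<in> I" by (simp add: minus_eq a_inv_def)
  qed (use assms in \<open>auto simp: right_ideal_def\<close>)
next
  fix x a assume "x \<in> I" "a \<in> carrier R"
  then show "a \<otimes> x \<in> I" "x \<otimes> a \<in> I"
    using assms right_ideal_smult[of I x a] right_ideal_closed[of I x] by (simp_all add: m_comm)
qed

section \<open>Chain conditions of an Artin algebra\<close>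

context artin_algebra
begin

text \<open>These are the \<open>R\<close>-submodules of \<open>A\<close>. Left ideals and, as
  \<open>\<phi> r\<close> is central, right ideals are among them, so one chain condition yields
  both.\<close>

definition scalar_closed :: "'a set \<Rightarrow> bool" where
  "scalar_closed L \<longleftrightarrow> L \<subseteq> carrier A \<and> \<zero>\<^bsub>A\<^esub> \<in> L \<and> (\<forall>x\<in>L. \<forall>y\<in>L. x \<oplus>\<^bsub>A\<^esub> y \<in> L) \<and>
     (\<forall>r\<in>carrier R. \<forall>x\<in>L. \<phi> r \<otimes>\<^bsub>A\<^esub> x \<in> L)"

interpretation \<phi>: ring_hom_ring R A \<phi>
  by (intro ring_hom_ringI2 R.ring_axioms A.ring_axioms structure_map)

lemma scalar_closed_minus:
  assumes "scalar_closed L" "x \<in> L" "y \<in> L"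
  shows "x \<ominus>\<^bsub>A\<^esub> y \<in> L"
proof -
  have y: "y \<in> carrier A"
    using assms by (auto simp: scalar_closed_def)
  have "\<ominus>\<^bsub>R\<^esub> \<one>\<^bsub>R\<^esub> \<in> carrier R" by simp
  then have "\<phi> (\<ominus>\<^bsub>R\<^esub> \<one>\<^bsub>R\<^esub>) \<otimes>\<^bsub>A\<^esub> y \<in> L"
    using assms unfolding scalar_closed_def by blast
  then have "\<ominus>\<^bsub>A\<^esub> y \<in> L" using y by (simp add: A.l_minus)
  then show ?thesis using assms by (auto simp: scalar_closed_def A.minus_eq)
qed

lemma submodule_restrict_scalars_iff:
  "submodule L R (restrict_scalars \<phi> A) \<longleftrightarrow> scalar_closed L"
proof -
  have "abelian_group (restrict_scalars \<phi> A)"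
    by (rule abelian_groupI)
       (auto simp: restrict_scalars_def A.a_ac intro: bexI[of _ "\<ominus>\<^bsub>A\<^esub> _"] A.l_neg)
  \<comment> \<open>\<open>right_module\<close> reverses the order of the scalars; commutativity of
    \<open>R\<close> reconciles this with the left action by \<open>\<phi>\<close>.\<close>
  moreover have "\<phi> (a \<otimes>\<^bsub>R\<^esub> b) \<otimes>\<^bsub>A\<^esub> x = \<phi> b \<otimes>\<^bsub>A\<^esub> (\<phi> a \<otimes>\<^bsub>A\<^esub> x)"
    if "a \<in> carrier R" "b \<in> carrier R" "x \<in> carrier A" for a b x
    using that by (simp add: R.m_comm[of a b] A.m_assoc)
  ultimately interpret right_module R "restrict_scalars \<phi> A"
    by (intro right_module.intro right_module_axioms.intro R.ring_axioms)
       (auto simp: restrict_scalars_def A.l_distr A.r_distr simp del: \<phi>.hom_mult)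
  show ?thesis
    unfolding submodule_iff by (auto simp: scalar_closed_def restrict_scalars_def)
qed

lemma scalar_closed_sum:
  assumes V: "scalar_closed V" and s: "s \<in> carrier A"
  defines "W \<equiv> {\<phi> r \<otimes>\<^bsub>A\<^esub> s \<oplus>\<^bsub>A\<^esub> v | r v. r \<in> carrier R \<and> v \<in> V}"
  shows "scalar_closed W" and "insert s V \<subseteq> W"
proof -
  have Vc [simp]: "v \<in> carrier A" if "v \<in> V" for v using V that by (auto simp: scalar_closed_def)
  note [simp] = s
  have W: "\<phi> r \<otimes>\<^bsub>A\<^esub> s \<oplus>\<^bsub>A\<^esub> v \<in> W" if "r \<in> carrier R" "v \<in> V" for r v using that by (auto simp: W_def)
  have V0: "\<zero>\<^bsub>A\<^esub> \<in> V" using V by (auto simp: scalar_closed_def)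
  show ins: "insert s V \<subseteq> W"
    using W[of "\<one>\<^bsub>R\<^esub>" "\<zero>\<^bsub>A\<^esub>"] W[of "\<zero>\<^bsub>R\<^esub>"] V0 by auto
  have add: "x \<oplus>\<^bsub>A\<^esub> y \<in> W" if xy: "x \<in> W" "y \<in> W" for x y
  proof -
    obtain r v where x: "x = \<phi> r \<otimes>\<^bsub>A\<^esub> s \<oplus>\<^bsub>A\<^esub> v" "r \<in> carrier R" "v \<in> V" using xy by (auto simp: W_def)
    obtain t w where y: "y = \<phi> t \<otimes>\<^bsub>A\<^esub> s \<oplus>\<^bsub>A\<^esub> w" "t \<in> carrier R" "w \<in> V" using xy by (auto simp: W_def)
    have "x \<oplus>\<^bsub>A\<^esub> y = \<phi> (r \<oplus>\<^bsub>R\<^esub> t) \<otimes>\<^bsub>A\<^esub> s \<oplus>\<^bsub>A\<^esub> (v \<oplus>\<^bsub>A\<^esub> w)"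
      using x y by (simp add: A.l_distr A.a_ac)
    then show ?thesis using x y V W[of "r \<oplus>\<^bsub>R\<^esub> t" "v \<oplus>\<^bsub>A\<^esub> w"] by (auto simp: scalar_closed_def)
  qed
  have smult: "\<phi> t \<otimes>\<^bsub>A\<^esub> x \<in> W" if x: "x \<in> W" "t \<in> carrier R" for t x
  proof -
    obtain r v where x: "x = \<phi> r \<otimes>\<^bsub>A\<^esub> s \<oplus>\<^bsub>A\<^esub> v" "r \<in> carrier R" "v \<in> V" using x by (auto simp: W_def)
    have "\<phi> t \<otimes>\<^bsub>A\<^esub> x = \<phi> (t \<otimes>\<^bsub>R\<^esub> r) \<otimes>\<^bsub>A\<^esub> s \<oplus>\<^bsub>A\<^esub> \<phi> t \<otimes>\<^bsub>A\<^esub> v"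
      using x that by (simp add: A.r_distr A.m_assoc)
    then show ?thesis using x that V W[of "t \<otimes>\<^bsub>R\<^esub> r" "\<phi> t \<otimes>\<^bsub>A\<^esub> v"] by (auto simp: scalar_closed_def)
  qed
  have "W \<subseteq> carrier A" by (auto simp: W_def)
  then show "scalar_closed W"
    using ins V0 add smult by (auto simp: scalar_closed_def)
qed

text \<open>\<open>W\<close> is an extension of \<open>V\<close> by a cyclic module. A member of a
  descending chain is controlled by its intersection with \<open>V\<close> and by the ideal of
  coefficients of \<open>s\<close> occurring in it, and both sequences become constant.\<close>

lemma dcc_scalar_closed_sum:
  assumes V: "scalar_closed V" and s: "s \<in> carrier A" and dcc: "dcc (\<lambda>L. scalar_closed L \<and> L \<subseteq> V)"
  defines "W \<equiv> {\<phi> r \<otimes>\<^bsub>A\<^esub> s \<oplus>\<^bsub>A\<^esub> v | r v. r \<in> carrier R \<and> v \<in> V}"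
  shows "dcc (\<lambda>L. scalar_closed L \<and> L \<subseteq> W)"
proof (rule dcc_sequenceI)
  fix L :: "nat \<Rightarrow> 'a set"
  assume L: "\<And>n. scalar_closed (L n) \<and> L n \<subseteq> W" and desc: "\<And>n. L (Suc n) \<subseteq> L n"
  have Vc [simp]: "v \<in> carrier A" if "v \<in> V" for v using V that by (auto simp: scalar_closed_def)
  note [simp] = s
  define I where "I n = {r \<in> carrier R. \<exists>v\<in>V. \<phi> r \<otimes>\<^bsub>A\<^esub> s \<oplus>\<^bsub>A\<^esub> v \<in> L n}" for n
  have "right_ideal R (I n)" for n
  proof -
    have "r \<oplus>\<^bsub>R\<^esub> t \<in> I n" if rt: "r \<in> I n" "t \<in> I n" for r t
    proof -
      obtain v w where vw: "v \<in> V" "w \<in> V" "\<phi> r \<otimes>\<^bsub>A\<^esub> s \<oplus>\<^bsub>A\<^esub> v \<in> L n" "\<phi> t \<otimes>\<^bsub>A\<^esub> s \<oplus>\<^bsub>A\<^esub> w \<in> L n"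
        "r \<in> carrier R" "t \<in> carrier R" using rt by (auto simp: I_def)
      then have "(\<phi> r \<otimes>\<^bsub>A\<^esub> s \<oplus>\<^bsub>A\<^esub> v) \<oplus>\<^bsub>A\<^esub> (\<phi> t \<otimes>\<^bsub>A\<^esub> s \<oplus>\<^bsub>A\<^esub> w) \<in> L n"
        using L by (auto simp: scalar_closed_def)
      also have "(\<phi> r \<otimes>\<^bsub>A\<^esub> s \<oplus>\<^bsub>A\<^esub> v) \<oplus>\<^bsub>A\<^esub> (\<phi> t \<otimes>\<^bsub>A\<^esub> s \<oplus>\<^bsub>A\<^esub> w) =
          \<phi> (r \<oplus>\<^bsub>R\<^esub> t) \<otimes>\<^bsub>A\<^esub> s \<oplus>\<^bsub>A\<^esub> (v \<oplus>\<^bsub>A\<^esub> w)"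
        using vw by (simp add: A.l_distr A.a_ac)
      finally show ?thesis using vw V by (auto simp: I_def scalar_closed_def)
    qed
    moreover have "r \<otimes>\<^bsub>R\<^esub> t \<in> I n" if rt: "r \<in> I n" "t \<in> carrier R" for r t
    proof -
      obtain v where v: "v \<in> V" "\<phi> r \<otimes>\<^bsub>A\<^esub> s \<oplus>\<^bsub>A\<^esub> v \<in> L n" "r \<in> carrier R"
        using rt by (auto simp: I_def)
      then have "\<phi> t \<otimes>\<^bsub>A\<^esub> (\<phi> r \<otimes>\<^bsub>A\<^esub> s \<oplus>\<^bsub>A\<^esub> v) \<in> L n"
        using L rt by (auto simp: scalar_closed_def)
      also have "\<phi> t \<otimes>\<^bsub>A\<^esub> (\<phi> r \<otimes>\<^bsub>A\<^esub> s \<oplus>\<^bsub>A\<^esub> v) = \<phi> (r \<otimes>\<^bsub>R\<^esub> t) \<otimes>\<^bsub>A\<^esub> s \<oplus>\<^bsub>A\<^esub> \<phi> t \<otimes>\<^bsub>A\<^esub> v"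
        using v rt by (simp add: R.m_comm[of r t] A.r_distr A.m_assoc)
      finally show ?thesis using v rt V by (auto simp: I_def scalar_closed_def)
    qed
    moreover have "\<zero>\<^bsub>R\<^esub> \<in> I n"
      using L V by (auto simp: I_def scalar_closed_def intro!: bexI[of _ "\<zero>\<^bsub>A\<^esub>"])
    ultimately show ?thesis by (auto simp: right_ideal_def I_def)
  qed
  then have "ideal (I n) R" for n by (rule R.ideal_right_ideal)
  moreover have "I (Suc n) \<subseteq> I n" for n using desc by (auto simp: I_def)
  ultimately obtain n1 where n1: "\<And>m. m \<ge> n1 \<Longrightarrow> I m = I n1"
    using R.descending_chain[of I] by blast
  have VL: "scalar_closed (L n \<inter> V) \<and> L n \<inter> V \<subseteq> V" for n
    using L V by (auto simp: scalar_closed_def)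
  obtain n2 where n2: "\<And>m. m \<ge> n2 \<Longrightarrow> L m \<inter> V = L n2 \<inter> V"
  proof -
    have "L (Suc n) \<inter> V \<subseteq> L n \<inter> V" for n using desc by blast
    from dcc_sequenceD[OF dcc, of "\<lambda>n. L n \<inter> V", OF VL this] show thesis using that by blast
  qed
  define n where "n = max n1 n2"
  have "L m = L n" if m: "m \<ge> n" for m
  proof
    have decr: "L m \<subseteq> L n" using lift_Suc_antimono_le[of L, OF desc m] .
    then show "L m \<subseteq> L n" .
    show "L n \<subseteq> L m"
    proof
      fix x assume x: "x \<in> L n"
      then obtain r v where rv: "x = \<phi> r \<otimes>\<^bsub>A\<^esub> s \<oplus>\<^bsub>A\<^esub> v" "r \<in> carrier R" "v \<in> V"
        using L[of n] unfolding W_def by blast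
      then have "r \<in> I n" using x by (auto simp: I_def)
      then have "r \<in> I m" using n1[of n] n1[of m] m by (simp add: n_def)
      then obtain w where w: "w \<in> V" "\<phi> r \<otimes>\<^bsub>A\<^esub> s \<oplus>\<^bsub>A\<^esub> w \<in> L m" by (auto simp: I_def)
      have c: "\<phi> r \<otimes>\<^bsub>A\<^esub> s \<in> carrier A" using rv by auto
      \<comment> \<open>Two elements with the same coefficient of \<open>s\<close> differ by an
        element of \<open>V\<close>, and \<open>L n\<close> and \<open>L m\<close> have the same
        intersection with \<open>V\<close>.\<close>
      have "x \<ominus>\<^bsub>A\<^esub> (\<phi> r \<otimes>\<^bsub>A\<^esub> s \<oplus>\<^bsub>A\<^esub> w) \<in> L n"
        using L x w decr by (intro scalar_closed_minus) auto
      moreover have eq: "x \<ominus>\<^bsub>A\<^esub> (\<phi> r \<otimes>\<^bsub>A\<^esub> s \<oplus>\<^bsub>A\<^esub> w) = v \<ominus>\<^bsub>A\<^esub> w"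
        unfolding rv(1) using rv(3) w(1) c by (simp add: A.add_minus_add)
      moreover have "v \<ominus>\<^bsub>A\<^esub> w \<in> V" using rv w V by (intro scalar_closed_minus) auto
      ultimately have "v \<ominus>\<^bsub>A\<^esub> w \<in> L m" using n2[of n] n2[of m] m by (auto simp: n_def)
      then have "(\<phi> r \<otimes>\<^bsub>A\<^esub> s \<oplus>\<^bsub>A\<^esub> w) \<oplus>\<^bsub>A\<^esub> (v \<ominus>\<^bsub>A\<^esub> w) \<in> L m"
        using w L by (auto simp: scalar_closed_def)
      also have "(\<phi> r \<otimes>\<^bsub>A\<^esub> s \<oplus>\<^bsub>A\<^esub> w) \<oplus>\<^bsub>A\<^esub> (v \<ominus>\<^bsub>A\<^esub> w) = x"
        unfolding eq[symmetric] using c w(1) L[of n] x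
        by (intro A.add_minus_cancel) (auto simp: scalar_closed_def)
      finally show "x \<in> L m" .
    qed
  qed
  then show "\<exists>n. \<forall>m\<ge>n. L m = L n" by blast
qed

text \<open>Generators of \<open>A\<close> over \<open>R\<close> are adjoined one at a time to the
  zero submodule.\<close>

lemma dcc_scalar_closed: "dcc scalar_closed"
proof -
  obtain S where S: "finite S" "S \<subseteq> carrier A" "gen_submodule R (restrict_scalars \<phi> A) S = carrier A"
    using fin_gen by (auto simp: fin_gen_def restrict_scalars_def)
  have "\<exists>V. scalar_closed V \<and> S \<subseteq> V \<and> dcc (\<lambda>L. scalar_closed L \<and> L \<subseteq> V)"
    using S(1,2)
  proof (induction S rule: finite_induct)
    case empty
    have "L = {\<zero>\<^bsub>A\<^esub>}" if "scalar_closed L" "L \<subseteq> {\<zero>\<^bsub>A\<^esub>}" for L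
      using that by (auto simp: scalar_closed_def)
    then have "dcc (\<lambda>L. scalar_closed L \<and> L \<subseteq> {\<zero>\<^bsub>A\<^esub>})" unfolding dcc_def by blast
    moreover have "scalar_closed {\<zero>\<^bsub>A\<^esub>}" by (auto simp: scalar_closed_def)
    ultimately show ?case by blast
  next
    case (insert s S)
    then obtain V where V: "scalar_closed V" "S \<subseteq> V" "dcc (\<lambda>L. scalar_closed L \<and> L \<subseteq> V)" by auto
    have s: "s \<in> carrier A" using insert by auto
    show ?case using scalar_closed_sum[OF V(1) s] dcc_scalar_closed_sum[OF V(1) s V(3)] V(2) by blast
  qed
  then obtain V where V: "scalar_closed V" "S \<subseteq> V" "dcc (\<lambda>L. scalar_closed L \<and> L \<subseteq> V)" by blast
  then have "carrier A \<subseteq> V"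
    unfolding S(3)[symmetric] gen_submodule_def by (auto simp: submodule_restrict_scalars_iff)
  then show ?thesis
    by (intro dcc_mono[OF V(3)]) (auto simp: scalar_closed_def)
qed

lemma dcc_left_ideal: "dcc (left_ideal A)"
  by (rule dcc_mono[OF dcc_scalar_closed]) (auto simp: left_ideal_def scalar_closed_def)

lemma dcc_right_ideal: "dcc (right_ideal A)"
proof (rule dcc_mono[OF dcc_scalar_closed])
  fix L assume L: "right_ideal A L"
  have "\<phi> r \<otimes>\<^bsub>A\<^esub> x \<in> L" if "r \<in> carrier R" "x \<in> L" for r x
    using that L central[of r x] A.right_ideal_smult[OF L] A.right_ideal_closed[OF L] by simp
  then show "scalar_closed L" using L by (auto simp: scalar_closed_def right_ideal_def)
qed

end

section \<open>The criterion of Baer\<close>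

text \<open>Zorn's lemma is applied to graphs of partial homomorphisms on \<open>Y\<close> rather
  than to functions: the union of a chain of graphs is again one, with nothing to glue.\<close>

lemma (in ring) injective_right_regularI:
  assumes ext: "\<And>I f. right_ideal R I \<Longrightarrow> right_hom_on R I f \<Longrightarrow> \<exists>c\<in>carrier R. \<forall>x\<in>I. f x = c \<otimes> x"
  shows "injective_module TYPE('t) R (right_regular R)"
  unfolding injective_module_def
proof (intro allI impI ballI)
  fix X Y :: "('a, 't) module" and i f
  assume "right_module R X \<and> right_module R Y" and i: "i \<in> mod_hom R X Y"
    and f: "f \<in> mod_hom R X (right_regular R)" and inj: "inj_on i (carrier X)"
  then interpret X: right_module R X + Y: right_module R Y by auto
  have iX: "i x \<in> carrier Y" "i (x \<oplus>\<^bsub>X\<^esub> y) = i x \<oplus>\<^bsub>Y\<^esub> i y" "i (a \<odot>\<^bsub>X\<^esub> x) = a \<odot>\<^bsub>Y\<^esub> i x"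
    if "x \<in> carrier X" "y \<in> carrier X" "a \<in> carrier R" for x y a
    using i that by (auto simp: mod_hom_def)
  have fX: "f x \<in> carrier R" "f (x \<oplus>\<^bsub>X\<^esub> y) = f x \<oplus> f y" "f (a \<odot>\<^bsub>X\<^esub> x) = f x \<otimes> a"
    if "x \<in> carrier X" "y \<in> carrier X" "a \<in> carrier R" for x y a
    using f that by (auto simp: mod_hom_def right_regular_def)
  define good where "good G \<longleftrightarrow> G \<subseteq> carrier Y \<times> carrier R \<and> (\<lambda>x. (i x, f x)) ` carrier X \<subseteq> G \<and>
      (\<forall>y r z s. (y, r) \<in> G \<and> (z, s) \<in> G \<longrightarrow> (y \<oplus>\<^bsub>Y\<^esub> z, r \<oplus> s) \<in> G) \<and>
      (\<forall>y r. \<forall>a\<in>carrier R. (y, r) \<in> G \<longrightarrow> (a \<odot>\<^bsub>Y\<^esub> y, r \<otimes> a) \<in> G) \<and>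
      (\<forall>y r s. (y, r) \<in> G \<and> (y, s) \<in> G \<longrightarrow> r = s)" for G
  have "\<exists>G\<in>Collect good. \<forall>G'\<in>Collect good. G \<subseteq> G' \<longrightarrow> G' = G"
  proof (rule subset_Zorn_nonempty)
    let ?G = "(\<lambda>x. (i x, f x)) ` carrier X"
    have "(i x \<oplus>\<^bsub>Y\<^esub> i y, f x \<oplus> f y) \<in> ?G" if "x \<in> carrier X" "y \<in> carrier X" for x y
      using that iX(2)[of x y \<zero>] fX(2)[of x y \<zero>] by (auto intro!: image_eqI[of _ _ "x \<oplus>\<^bsub>X\<^esub> y"])
    moreover have "(a \<odot>\<^bsub>Y\<^esub> i x, f x \<otimes> a) \<in> ?G" if "x \<in> carrier X" "a \<in> carrier R" for x a
      using that iX(3)[of x x a] fX(3)[of x x a] by (auto intro!: image_eqI[of _ _ "a \<odot>\<^bsub>X\<^esub> x"])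
    moreover have "f x = f y" if "x \<in> carrier X" "y \<in> carrier X" "i x = i y" for x y
      using that inj by (simp add: inj_on_eq_iff)
    moreover have "?G \<subseteq> carrier Y \<times> carrier R"
      using iX(1)[OF _ X.M.zero_closed zero_closed] fX(1)[OF _ X.M.zero_closed zero_closed] by auto
    ultimately have "good ?G" unfolding good_def by blast
    then show "Collect good \<noteq> {}" by blast
  next
    fix C assume C: "C \<noteq> {}" "subset.chain (Collect good) C"
    then have good: "\<And>G. G \<in> C \<Longrightarrow> good G" by (auto simp: subset_chain_def)
    have two: "\<exists>G\<in>C. p \<in> G \<and> q \<in> G" if "p \<in> \<Union>C" "q \<in> \<Union>C" for p q
    proof -
      obtain G H where "G \<in> C" "p \<in> G" "H \<in> C" "q \<in> H" using \<open>p \<in> \<Union>C\<close> \<open>q \<in> \<Union>C\<close> by blast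
      moreover from this have "G \<subseteq> H \<or> H \<subseteq> G" using C(2) by (auto simp: subset_chain_def)
      ultimately show ?thesis by blast
    qed
    show "\<Union>C \<in> Collect good"
      unfolding good_def mem_Collect_eq
    proof (intro conjI allI impI ballI)
      have "G \<subseteq> carrier Y \<times> carrier R" "(\<lambda>x. (i x, f x)) ` carrier X \<subseteq> G" if "G \<in> C" for G
        using good[OF that] unfolding good_def by blast+
      then show "\<Union>C \<subseteq> carrier Y \<times> carrier R" "(\<lambda>x. (i x, f x)) ` carrier X \<subseteq> \<Union>C"
        using C(1) by blast+
    next
      fix y r z s assume "(y, r) \<in> \<Union>C \<and> (z, s) \<in> \<Union>C"
      then obtain G where "G \<in> C" "(y, r) \<in> G" "(z, s) \<in> G" using two by meson
      then show "(y \<oplus>\<^bsub>Y\<^esub> z, r \<oplus> s) \<in> \<Union>C" using good[of G] unfolding good_def by blast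
    next
      fix y r a assume "a \<in> carrier R" "(y, r) \<in> \<Union>C"
      then obtain G where "G \<in> C" "(y, r) \<in> G" by blast
      then show "(a \<odot>\<^bsub>Y\<^esub> y, r \<otimes> a) \<in> \<Union>C" using good[of G] \<open>a \<in> carrier R\<close> unfolding good_def by blast
    next
      fix y r s assume "(y, r) \<in> \<Union>C \<and> (y, s) \<in> \<Union>C"
      then obtain G where "G \<in> C" "(y, r) \<in> G" "(y, s) \<in> G" using two by meson
      then show "r = s" using good[of G] unfolding good_def by blast
    qed
  qed
  then obtain G where G: "good G" and max: "\<And>G'. good G' \<Longrightarrow> G \<subseteq> G' \<Longrightarrow> G' = G" by blast
  have Gc [simp]: "y \<in> carrier Y" "r \<in> carrier R" if "(y, r) \<in> G" for y r
    using G that by (auto simp: good_def)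
  have Ga: "(y \<oplus>\<^bsub>Y\<^esub> z, r \<oplus> s) \<in> G" if "(y, r) \<in> G" "(z, s) \<in> G" for y z r s
    using G that by (auto simp: good_def)
  have Gs: "(a \<odot>\<^bsub>Y\<^esub> y, r \<otimes> a) \<in> G" if "(y, r) \<in> G" "a \<in> carrier R" for y r a
    using G that by (auto simp: good_def)
  have Gu: "r = s" if "(y, r) \<in> G" "(y, s) \<in> G" for y r s
    using G that unfolding good_def by blast
  have Gi: "(i x, f x) \<in> G" if "x \<in> carrier X" for x
    using G that by (auto simp: good_def)
  have G0: "(\<zero>\<^bsub>Y\<^esub>, \<zero>) \<in> G"
    using Gs[OF Gi[OF X.M.zero_closed] zero_closed] iX(1)[of "\<zero>\<^bsub>X\<^esub>" "\<zero>\<^bsub>X\<^esub>" \<zero>]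
      fX(1)[of "\<zero>\<^bsub>X\<^esub>" "\<zero>\<^bsub>X\<^esub>" \<zero>] by simp
  have Gm: "(y \<ominus>\<^bsub>Y\<^esub> z, r \<ominus> s) \<in> G" if "(y, r) \<in> G" "(z, s) \<in> G" for y z r s
    using Ga[OF that(1) Gs[OF that(2), of "\<ominus> \<one>"]] that
    by (simp add: Y.minus_smult r_minus minus_eq Y.M.minus_eq)
  have total: "\<exists>r. (y, r) \<in> G" if y: "y \<in> carrier Y" for y
  proof -
    \<comment> \<open>The scalars that carry \<open>y\<close> into the domain of \<open>G\<close>.
      The homomorphism \<open>g\<close> induced on them is multiplication by some \<open>c\<close>,
      and \<open>c\<close> is the value that can be assigned to \<open>y\<close>.\<close>
    define I where "I = {a \<in> carrier R. \<exists>r. (a \<odot>\<^bsub>Y\<^esub> y, r) \<in> G}"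
    define g where "g a = (THE r. (a \<odot>\<^bsub>Y\<^esub> y, r) \<in> G)" for a
    have g: "g a = r" if "(a \<odot>\<^bsub>Y\<^esub> y, r) \<in> G" for a r
      using that Gu unfolding g_def by blast
    have gI: "(a \<odot>\<^bsub>Y\<^esub> y, g a) \<in> G" if "a \<in> I" for a
      using that g by (auto simp: I_def)
    have Iadd: "((a \<oplus> b) \<odot>\<^bsub>Y\<^esub> y, g a \<oplus> g b) \<in> G" if "a \<in> I" "b \<in> I" for a b
      using Ga[OF gI gI, OF that] that y by (simp add: I_def Y.smult_l_distr)
    have Ismult: "((a \<otimes> b) \<odot>\<^bsub>Y\<^esub> y, g a \<otimes> b) \<in> G" if "a \<in> I" "b \<in> carrier R" for a b
      using Gs[OF gI, OF that] that y by (simp add: I_def Y.smult_mult)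
    have II: "a \<in> I" if "a \<in> carrier R" "(a \<odot>\<^bsub>Y\<^esub> y, r) \<in> G" for a r
      using that by (auto simp: I_def)
    have Ic: "a \<in> carrier R" if "a \<in> I" for a
      using that by (simp add: I_def)
    have "\<zero> \<in> I" using II[of \<zero> \<zero>] G0 y by simp
    moreover have "a \<oplus> b \<in> I" if "a \<in> I" "b \<in> I" for a b
      by (rule II[OF add.m_closed Iadd]) (use that Ic in blast)+
    moreover have "a \<otimes> b \<in> I" if "a \<in> I" "b \<in> carrier R" for a b
      by (rule II[OF m_closed Ismult]) (use that Ic in blast)+
    moreover have "I \<subseteq> carrier R" using Ic by blast
    ultimately have I: "right_ideal R I"
      unfolding right_ideal_def by blast
    have "right_hom_on R I g"
      unfolding right_hom_on_def
      by (intro conjI ballI) (simp_all add: g[OF Iadd] g[OF Ismult] Gc(2)[OF gI])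
    from ext[OF I this] obtain c where c: "c \<in> carrier R" "\<And>a. a \<in> I \<Longrightarrow> g a = c \<otimes> a" by blast
    define G' where "G' = {(z \<oplus>\<^bsub>Y\<^esub> a \<odot>\<^bsub>Y\<^esub> y, r \<oplus> c \<otimes> a) | z r a. (z, r) \<in> G \<and> a \<in> carrier R}"
    have G'I: "(z \<oplus>\<^bsub>Y\<^esub> a \<odot>\<^bsub>Y\<^esub> y, r \<oplus> c \<otimes> a) \<in> G'" if "(z, r) \<in> G" "a \<in> carrier R" for z r a
      using that by (auto simp: G'_def)
    have sub: "G \<subseteq> G'"
    proof (rule subrelI)
      fix z r assume "(z, r) \<in> G"
      then show "(z, r) \<in> G'" using G'I[of z r \<zero>] c y by simp
    qed
    have "good G'"
      unfolding good_def
    proof (intro conjI allI impI ballI)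
      show "G' \<subseteq> carrier Y \<times> carrier R" using c y by (auto simp: G'_def)
      show "(\<lambda>x. (i x, f x)) ` carrier X \<subseteq> G'" using sub Gi by blast
    next
      fix z r w s assume "(z, r) \<in> G' \<and> (w, s) \<in> G'"
      then obtain z' r' a w' s' b where eq: "z = z' \<oplus>\<^bsub>Y\<^esub> a \<odot>\<^bsub>Y\<^esub> y" "r = r' \<oplus> c \<otimes> a"
          "w = w' \<oplus>\<^bsub>Y\<^esub> b \<odot>\<^bsub>Y\<^esub> y" "s = s' \<oplus> c \<otimes> b" "(z', r') \<in> G" "(w', s') \<in> G"
          "a \<in> carrier R" "b \<in> carrier R"
        unfolding G'_def by blast
      then have "z \<oplus>\<^bsub>Y\<^esub> w = (z' \<oplus>\<^bsub>Y\<^esub> w') \<oplus>\<^bsub>Y\<^esub> (a \<oplus> b) \<odot>\<^bsub>Y\<^esub> y"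
        "r \<oplus> s = (r' \<oplus> s') \<oplus> c \<otimes> (a \<oplus> b)"
        using c y by (simp_all add: Y.smult_l_distr Y.M.a_ac r_distr a_ac)
      then show "(z \<oplus>\<^bsub>Y\<^esub> w, r \<oplus> s) \<in> G'" using G'I[OF Ga] eq by simp
    next
      fix z r b assume b: "b \<in> carrier R" and "(z, r) \<in> G'"
      then obtain z' r' a where eq: "z = z' \<oplus>\<^bsub>Y\<^esub> a \<odot>\<^bsub>Y\<^esub> y" "r = r' \<oplus> c \<otimes> a"
          "(z', r') \<in> G" "a \<in> carrier R"
        unfolding G'_def by blast
      then have "b \<odot>\<^bsub>Y\<^esub> z = b \<odot>\<^bsub>Y\<^esub> z' \<oplus>\<^bsub>Y\<^esub> (a \<otimes> b) \<odot>\<^bsub>Y\<^esub> y" "r \<otimes> b = r' \<otimes> b \<oplus> c \<otimes> (a \<otimes> b)"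
        using b c y by (simp_all add: Y.smult_r_distr Y.smult_mult l_distr m_assoc)
      then show "(b \<odot>\<^bsub>Y\<^esub> z, r \<otimes> b) \<in> G'" using G'I[OF Gs] eq b by simp
    next
      fix z r s assume "(z, r) \<in> G' \<and> (z, s) \<in> G'"
      then obtain z' r' a w' s' b where eq: "z = z' \<oplus>\<^bsub>Y\<^esub> a \<odot>\<^bsub>Y\<^esub> y" "r = r' \<oplus> c \<otimes> a"
          "z = w' \<oplus>\<^bsub>Y\<^esub> b \<odot>\<^bsub>Y\<^esub> y" "s = s' \<oplus> c \<otimes> b" "(z', r') \<in> G" "(w', s') \<in> G"
          "a \<in> carrier R" "b \<in> carrier R"
        unfolding G'_def by blast
      have cl: "z' \<in> carrier Y" "w' \<in> carrier Y" "a \<odot>\<^bsub>Y\<^esub> y \<in> carrier Y" "b \<odot>\<^bsub>Y\<^esub> y \<in> carrier Y"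
        "r' \<in> carrier R" "s' \<in> carrier R" "c \<otimes> a \<in> carrier R" "c \<otimes> b \<in> carrier R"
        using eq y c by auto
      \<comment> \<open>Single-valuedness of \<open>G'\<close>: two expressions for \<open>z\<close>
        differ by \<open>b \<ominus> a\<close> in the coefficient of \<open>y\<close>. So
        \<open>b \<ominus> a\<close> lies in \<open>I\<close>, where \<open>G\<close> already
        prescribes multiplication by \<open>c\<close>.\<close>
      have "z' \<ominus>\<^bsub>Y\<^esub> w' = (z \<ominus>\<^bsub>Y\<^esub> a \<odot>\<^bsub>Y\<^esub> y) \<ominus>\<^bsub>Y\<^esub> (z \<ominus>\<^bsub>Y\<^esub> b \<odot>\<^bsub>Y\<^esub> y)"
        by (subst (1) eq(1), subst (1) eq(3))
           (use cl in \<open>simp add: Y.M.minus_eq Y.M.a_assoc Y.M.r_neg\<close>)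
      also have "\<dots> = b \<odot>\<^bsub>Y\<^esub> y \<ominus>\<^bsub>Y\<^esub> a \<odot>\<^bsub>Y\<^esub> y"
        using cl eq(1) by (simp add: Y.M.minus_eq Y.M.minus_add Y.M.a_ac Y.M.r_neg1 Y.M.r_neg2)
      also have "\<dots> = (b \<ominus> a) \<odot>\<^bsub>Y\<^esub> y"
        using eq y by (simp add: minus_eq Y.M.minus_eq Y.smult_l_distr Y.minus_smult)
      finally have "((b \<ominus> a) \<odot>\<^bsub>Y\<^esub> y, r' \<ominus> s') \<in> G" using Gm[OF eq(5,6)] by simp
      then have "r' \<ominus> s' = c \<otimes> (b \<ominus> a)" using g c(2)[of "b \<ominus> a"] eq by (auto simp: I_def)
      then have "r' \<ominus> s' = c \<otimes> b \<ominus> c \<otimes> a" using c eq by (simp add: minus_distr_r)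
      then have "s' \<oplus> (r' \<ominus> s') \<oplus> c \<otimes> a = s' \<oplus> (c \<otimes> b \<ominus> c \<otimes> a) \<oplus> c \<otimes> a" by simp
      also have "\<dots> = s' \<oplus> c \<otimes> b" using cl by (simp add: minus_eq a_assoc l_neg)
      finally show "r = s" using cl eq by (simp add: add_minus_cancel)
    qed
    then have "G' = G" using max sub by blast
    moreover have "(\<zero>\<^bsub>Y\<^esub> \<oplus>\<^bsub>Y\<^esub> \<one> \<odot>\<^bsub>Y\<^esub> y, \<zero> \<oplus> c \<otimes> \<one>) \<in> G'" using G'I[OF G0] by blast
    ultimately show ?thesis using y by auto
  qed
  define h where "h = (\<lambda>y\<in>carrier Y. THE r. (y, r) \<in> G)"
  have h: "h y = r" if "(y, r) \<in> G" for y r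
    using that Gu unfolding h_def by auto
  then have hG: "(y, h y) \<in> G" if "y \<in> carrier Y" for y
    using total[OF that] by blast
  have "h y \<in> carrier R" if "y \<in> carrier Y" for y
    using Gc(2)[OF hG[OF that]] .
  then have "h \<in> mod_hom R Y (right_regular R)"
    unfolding mod_hom_def right_regular_def
    using h[OF Ga[OF hG hG]] h[OF Gs[OF hG]] by (simp add: h_def PiE_iff)
  moreover have "\<forall>x\<in>carrier X. h (i x) = f x" using h Gi by blast
  ultimately show "\<exists>h\<in>mod_hom R Y (right_regular R). \<forall>x\<in>carrier X. h (i x) = f x" by blast
qed

section \<open>Minimal right ideals\<close>

text \<open>Equivalently, \<open>u A\<close> is a minimal right ideal: every nonzero multiple of
  \<open>u\<close> gives \<open>u\<close> back.\<close>

definition min_right :: "('a, 'z) ring_scheme \<Rightarrow> 'a \<Rightarrow> bool" where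
  "min_right A u \<longleftrightarrow> u \<in> carrier A \<and> u \<noteq> \<zero>\<^bsub>A\<^esub> \<and>
     (\<forall>a\<in>carrier A. u \<otimes>\<^bsub>A\<^esub> a \<noteq> \<zero>\<^bsub>A\<^esub> \<longrightarrow> (\<exists>b\<in>carrier A. u \<otimes>\<^bsub>A\<^esub> a \<otimes>\<^bsub>A\<^esub> b = u))"

context ring
begin

lemma min_rightD:
  assumes "min_right R u"
  shows "u \<in> carrier R" "u \<noteq> \<zero>"
    "\<lbrakk>a \<in> carrier R; u \<otimes> a \<noteq> \<zero>\<rbrakk> \<Longrightarrow> \<exists>b\<in>carrier R. u \<otimes> a \<otimes> b = u"
  using assms unfolding min_right_def by blast+

lemma right_ideal_principal:
  assumes "u \<in> carrier R"
  shows "right_ideal R {u \<otimes> a | a. a \<in> carrier R}"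
proof -
  have "u \<otimes> a \<oplus> u \<otimes> b \<in> {u \<otimes> a | a. a \<in> carrier R}" if "a \<in> carrier R" "b \<in> carrier R" for a b
    using that assms by (auto intro!: exI[of _ "a \<oplus> b"] simp: r_distr)
  moreover have "u \<otimes> a \<otimes> b \<in> {u \<otimes> a | a. a \<in> carrier R}" if "a \<in> carrier R" "b \<in> carrier R" for a b
    using that assms by (auto intro!: exI[of _ "a \<otimes> b"] simp: m_assoc)
  moreover have "\<zero> \<in> {u \<otimes> a | a. a \<in> carrier R}"
    using assms by (auto intro!: exI[of _ \<zero>])
  moreover have "{u \<otimes> a | a. a \<in> carrier R} \<subseteq> carrier R" using assms by auto
  ultimately show ?thesis unfolding right_ideal_def by blast
qed

text \<open>The generator of a minimal member among the nonzero principal right ideals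
  \<open>z b R\<close>.\<close>

lemma min_right_exists:
  assumes dcc: "dcc (right_ideal R)" and z: "z \<in> carrier R" "z \<noteq> \<zero>"
  shows "\<exists>b\<in>carrier R. min_right R (z \<otimes> b)"
proof -
  define P where "P y = {y \<otimes> a | a. a \<in> carrier R}" for y
  define B where "B = {b \<in> carrier R. z \<otimes> b \<noteq> \<zero>}"
  have "\<one> \<in> B" using z by (simp add: B_def)
  then have ne: "(\<lambda>b. P (z \<otimes> b)) ` B \<noteq> {}" by blast
  have ri: "right_ideal R I" if I: "I \<in> (\<lambda>b. P (z \<otimes> b)) ` B" for I
  proof -
    obtain b where "b \<in> B" "I = P (z \<otimes> b)" using I by blast
    then show ?thesis using z(1) unfolding P_def by (simp add: B_def right_ideal_principal)
  qed
  obtain I where I: "I \<in> (\<lambda>b. P (z \<otimes> b)) ` B"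
    and min: "\<And>K. K \<in> (\<lambda>b. P (z \<otimes> b)) ` B \<Longrightarrow> K \<subseteq> I \<Longrightarrow> K = I"
    by (rule dccE[OF dcc ne ri]) (assumption, blast)
  obtain b where "b \<in> B" and bI: "I = P (z \<otimes> b)" using I by blast
  then have b: "b \<in> carrier R" "z \<otimes> b \<noteq> \<zero>" by (simp_all add: B_def)
  have "\<exists>c\<in>carrier R. z \<otimes> b \<otimes> a \<otimes> c = z \<otimes> b" if a: "a \<in> carrier R" "z \<otimes> b \<otimes> a \<noteq> \<zero>" for a
  proof -
    have eq: "z \<otimes> (b \<otimes> a) = z \<otimes> b \<otimes> a" using z a b by (simp add: m_assoc)
    have "z \<otimes> (b \<otimes> a) \<noteq> \<zero>" "b \<otimes> a \<in> carrier R" using a b eq by auto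
    then have "P (z \<otimes> (b \<otimes> a)) \<in> (\<lambda>b. P (z \<otimes> b)) ` B" by (intro imageI) (simp add: B_def)
    moreover have "P (z \<otimes> (b \<otimes> a)) \<subseteq> I"
    proof
      fix x assume "x \<in> P (z \<otimes> (b \<otimes> a))"
      then obtain c where "c \<in> carrier R" "x = z \<otimes> b \<otimes> a \<otimes> c" unfolding eq P_def by blast
      then have "x = z \<otimes> b \<otimes> (a \<otimes> c)" "a \<otimes> c \<in> carrier R" using z a b by (auto simp: m_assoc)
      then show "x \<in> I" unfolding bI P_def by blast
    qed
    ultimately have "P (z \<otimes> (b \<otimes> a)) = I" by (rule min)
    moreover have "z \<otimes> b \<otimes> \<one> \<in> I" unfolding bI P_def by blast
    ultimately have "z \<otimes> b \<in> {z \<otimes> b \<otimes> a \<otimes> c | c. c \<in> carrier R}" using z b eq by (simp add: P_def)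
    then obtain c where "c \<in> carrier R" "z \<otimes> b = z \<otimes> b \<otimes> a \<otimes> c" by blast
    then show ?thesis by (intro bexI[of _ c]) simp_all
  qed
  then have "min_right R (z \<otimes> b)" unfolding min_right_def using z b by blast
  then show ?thesis using b(1) by blast
qed

lemma min_right_smult:
  assumes u: "min_right R u" and c: "c \<in> carrier R" "u \<otimes> c \<noteq> \<zero>"
  shows "min_right R (u \<otimes> c)"
  unfolding min_right_def
proof (intro conjI ballI impI)
  note [simp] = min_rightD(1)[OF u]
  show "u \<otimes> c \<in> carrier R" "u \<otimes> c \<noteq> \<zero>" using c by auto
  fix a assume a: "a \<in> carrier R" "u \<otimes> c \<otimes> a \<noteq> \<zero>"
  then obtain b where b: "b \<in> carrier R" "u \<otimes> (c \<otimes> a) \<otimes> b = u"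
    using min_rightD(3)[OF u, of "c \<otimes> a"] c by (auto simp: m_assoc)
  have "u \<otimes> c \<otimes> a \<otimes> (b \<otimes> c) = (u \<otimes> (c \<otimes> a) \<otimes> b) \<otimes> c" using a(1) b(1) c(1) by (simp add: m_assoc)
  also have "\<dots> = u \<otimes> c" by (simp only: b(2))
  finally show "\<exists>b\<in>carrier R. u \<otimes> c \<otimes> a \<otimes> b = u \<otimes> c" using b(1) c(1) by blast
qed

text \<open>Left multiplication by \<open>x\<close> is a homomorphism on the simple module
  \<open>u R\<close>; if it is not zero, its kernel is.\<close>

lemma min_right_mult_nonzero:
  assumes u: "min_right R u" and x: "x \<in> carrier R" "x \<otimes> u \<noteq> \<zero>" and a: "a \<in> carrier R" "u \<otimes> a \<noteq> \<zero>"
  shows "x \<otimes> u \<otimes> a \<noteq> \<zero>"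
proof
  note [simp] = min_rightD(1)[OF u]
  assume 0: "x \<otimes> u \<otimes> a = \<zero>"
  obtain b where b: "b \<in> carrier R" "u \<otimes> a \<otimes> b = u" using min_rightD(3)[OF u] a by blast
  have "x \<otimes> u = x \<otimes> (u \<otimes> a \<otimes> b)" by (simp only: b(2))
  also have "\<dots> = (x \<otimes> u \<otimes> a) \<otimes> b" using x(1) a(1) b(1) by (simp add: m_assoc)
  also have "\<dots> = \<zero>" using b(1) by (simp add: 0)
  finally show False using x(2) by simp
qed

lemma min_right_mult:
  assumes u: "min_right R u" and x: "x \<in> carrier R" "x \<otimes> u \<noteq> \<zero>"
  shows "min_right R (x \<otimes> u)"
  unfolding min_right_def
proof (intro conjI ballI impI)
  note [simp] = min_rightD(1)[OF u]
  show "x \<otimes> u \<in> carrier R" "x \<otimes> u \<noteq> \<zero>" using x by auto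
  fix a assume a: "a \<in> carrier R" "x \<otimes> u \<otimes> a \<noteq> \<zero>"
  then have "u \<otimes> a \<noteq> \<zero>" using x by (auto simp: m_assoc)
  then obtain b where b: "b \<in> carrier R" "u \<otimes> a \<otimes> b = u" using min_rightD(3)[OF u] a by blast
  have "x \<otimes> u \<otimes> a \<otimes> b = x \<otimes> (u \<otimes> a \<otimes> b)" using a(1) b(1) x(1) by (simp add: m_assoc)
  also have "\<dots> = x \<otimes> u" by (simp only: b(2))
  finally show "\<exists>b\<in>carrier R. x \<otimes> u \<otimes> a \<otimes> b = x \<otimes> u" using b(1) by blast
qed

text \<open>\<open>u R\<close> is a nonzero image of the simple module \<open>R/M\<close>.\<close>

lemma min_right_left_ann:
  assumes M: "max_right_ideal R M" and u: "u \<in> left_ann R M" "u \<noteq> \<zero>"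
  shows "min_right R u"
  unfolding min_right_def
proof (intro conjI ballI impI)
  have uM: "u \<in> carrier R" "\<And>m. m \<in> M \<Longrightarrow> u \<otimes> m = \<zero>" using u by (auto simp: left_ann_def)
  show "u \<in> carrier R" "u \<noteq> \<zero>" by fact+
  fix a assume a: "a \<in> carrier R" "u \<otimes> a \<noteq> \<zero>"
  then have "a \<in> carrier R - M" using uM(2) by auto
  then obtain b where b: "b \<in> carrier R" "\<one> \<ominus> a \<otimes> b \<in> M" using M by (auto simp: max_right_ideal_def)
  have "u \<otimes> (\<one> \<ominus> a \<otimes> b) = \<zero>" using uM(2)[OF b(2)] .
  then have "u = u \<otimes> a \<otimes> b" using uM(1) a(1) b(1) by (simp add: minus_distr_r minus_eq_zero_iff m_assoc)
  then show "\<exists>b\<in>carrier R. u \<otimes> a \<otimes> b = u" using b(1) by (intro bexI[of _ b]) simp_all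
qed

text \<open>An injective endomorphism of the artinian module \<open>f R\<close> is bijective. The
  endomorphism is left multiplication by \<open>x\<close>, and the endomorphism ring is the corner
  \<open>f R f\<close>.\<close>

lemma corner_inverse:
  assumes dcc: "dcc (right_ideal R)"
    and f: "f \<in> carrier R" "f \<otimes> f = f" and x: "x \<in> carrier R" "f \<otimes> x = x" "x \<otimes> f = x"
    and inj: "\<And>z. \<lbrakk>z \<in> carrier R; f \<otimes> z = z; x \<otimes> z = \<zero>\<rbrakk> \<Longrightarrow> z = \<zero>"
  shows "\<exists>y\<in>carrier R. f \<otimes> y = y \<and> y \<otimes> f = y \<and> y \<otimes> x = f \<and> x \<otimes> y = f"
proof -
  define T where "T k = x [^] k \<otimes> f" for k :: nat
  have Tc [simp]: "T k \<in> carrier R" for k using f x by (simp add: T_def)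
  have TS: "T (Suc k) = T k \<otimes> x" for k
    using f(1) x by (simp add: T_def m_assoc)
  let ?I = "\<lambda>k. {T k \<otimes> a | a. a \<in> carrier R}"
  have sub: "?I (Suc k) \<subseteq> ?I k" for k
  proof
    fix z assume "z \<in> ?I (Suc k)"
    then obtain a where a: "a \<in> carrier R" "z = T k \<otimes> x \<otimes> a" unfolding TS by blast
    then have "z = T k \<otimes> (x \<otimes> a)" "x \<otimes> a \<in> carrier R" using x by (auto simp: m_assoc)
    then show "z \<in> ?I k" by blast
  qed
  from dcc_sequenceD[OF dcc, of ?I, OF right_ideal_principal[OF Tc] sub]
  obtain k where k: "\<forall>m\<ge>k. ?I m = ?I k" ..
  have "?I (Suc k) = ?I k" by (rule k[rule_format]) simp
  moreover have "T k \<otimes> \<one> \<in> ?I k" by blast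
  ultimately have "T k \<in> ?I (Suc k)" by simp
  then obtain a where a: "a \<in> carrier R" "T k = T k \<otimes> x \<otimes> a" unfolding TS by blast
  have Tinj: "z = \<zero>" if "z \<in> carrier R" "f \<otimes> z = z" "T k \<otimes> z = \<zero>" for z k
    using that
  proof (induction k arbitrary: z)
    case 0
    then show ?case using f(1) by (simp add: T_def)
  next
    case (Suc k)
    have "T k \<otimes> (x \<otimes> z) = \<zero>" "f \<otimes> (x \<otimes> z) = x \<otimes> z" "x \<otimes> z \<in> carrier R"
      using Suc.prems x f(1) by (auto simp: TS m_assoc[symmetric])
    then have "x \<otimes> z = \<zero>" using Suc.IH by blast
    then show ?case using inj Suc.prems by blast
  qed
  have Tf: "T k \<otimes> f = T k" using f x by (simp add: T_def m_assoc)
  \<comment> \<open>The images of the powers stabilise, so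
    \<open>T k = T k \<otimes> x \<otimes> a\<close>; cancelling the injective \<open>T k\<close>
    leaves \<open>x \<otimes> a = f\<close>.\<close>
  have "f \<ominus> x \<otimes> a = \<zero>"
  proof (rule Tinj)
    show "f \<ominus> x \<otimes> a \<in> carrier R" using a f x by simp
    show "f \<otimes> (f \<ominus> x \<otimes> a) = f \<ominus> x \<otimes> a"
      using a(1) f x by (simp add: minus_distr_r m_assoc[symmetric])
    have "T k \<otimes> (f \<ominus> x \<otimes> a) = T k \<otimes> f \<ominus> T k \<otimes> x \<otimes> a"
      using a(1) f(1) x(1) by (simp add: minus_distr_r m_assoc)
    also have "\<dots> = \<zero>" unfolding Tf a(2)[symmetric] by (simp add: minus_eq_zero_iff)
    finally show "T k \<otimes> (f \<ominus> x \<otimes> a) = \<zero>" .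
  qed
  then have xa: "x \<otimes> a = f" using a(1) f(1) x(1) by (simp add: minus_eq_zero_iff)
  define y where "y = f \<otimes> a \<otimes> f"
  have y: "y \<in> carrier R" "f \<otimes> y = y" "y \<otimes> f = y"
    using a(1) f by (auto simp: y_def m_assoc) (simp add: m_assoc[symmetric])
  have "x \<otimes> y = (x \<otimes> f) \<otimes> a \<otimes> f" using a(1) f(1) x(1) by (simp add: y_def m_assoc)
  also have "\<dots> = f" using xa f x by simp
  finally have xy: "x \<otimes> y = f" .
  \<comment> \<open>A right inverse of an injective map is also a left inverse.\<close>
  have "y \<otimes> x \<ominus> f = \<zero>"
  proof (rule inj)
    show "y \<otimes> x \<ominus> f \<in> carrier R" using y f x by simp
    show "f \<otimes> (y \<otimes> x \<ominus> f) = y \<otimes> x \<ominus> f"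
      using y f x by (simp add: minus_distr_r m_assoc[symmetric])
    have "x \<otimes> (y \<otimes> x \<ominus> f) = x \<otimes> y \<otimes> x \<ominus> x \<otimes> f" using y(1) f(1) x(1) by (simp add: minus_distr_r m_assoc)
    then show "x \<otimes> (y \<otimes> x \<ominus> f) = \<zero>" using x by (simp add: xy minus_eq_zero_iff)
  qed
  then have "y \<otimes> x = f" using y f x by (simp add: minus_eq_zero_iff)
  then show ?thesis using y xy by blast
qed

end

section \<open>Basic QF-2 rings in terms of idempotents\<close>

text \<open>
  The axiom \<open>noniso\<close> says that \<open>e i A\<close> and \<open>e j A\<close> are not isomorphic for \<open>i \<noteq> j\<close>. As
  \<open>left_ann R M\<close> is the dual of \<open>A/M\<close>, the last two axioms say that the evaluation map of \<open>A/M\<close>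
  is injective and surjective.
\<close>

locale basic_qf2 = ring R for R (structure) +
  fixes e :: "nat \<Rightarrow> 'a" and n :: nat
  assumes dcc_right: "dcc (right_ideal R)"
    and e_closed [simp]: "i < n \<Longrightarrow> e i \<in> carrier R"
    and e_idem [simp]: "i < n \<Longrightarrow> e i \<otimes> e i = e i"
    and e_nonzero: "i < n \<Longrightarrow> e i \<noteq> \<zero>"
    and e_zero: "\<lbrakk>u \<in> carrier R; \<And>k. k < n \<Longrightarrow> e k \<otimes> u = \<zero>\<rbrakk> \<Longrightarrow> u = \<zero>"
    and e_single: "\<lbrakk>i < n; u \<in> carrier R; \<And>k. \<lbrakk>k < n; k \<noteq> i\<rbrakk> \<Longrightarrow> e k \<otimes> u = \<zero>\<rbrakk> \<Longrightarrow> e i \<otimes> u = u"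
    and noniso: "\<lbrakk>i < n; j < n; b \<in> carrier R; c \<in> carrier R; e j \<otimes> b = b; b \<otimes> e i = b;
        e i \<otimes> c = c; c \<otimes> e j = c; c \<otimes> b = e i; b \<otimes> c = e j\<rbrakk> \<Longrightarrow> i = j"
    and simple_socle: "\<lbrakk>i < n; min_right R u; min_right R v; e i \<otimes> u = u; e i \<otimes> v = v\<rbrakk>
        \<Longrightarrow> \<exists>b\<in>carrier R. v = u \<otimes> b"
    and reflexive_inj: "\<lbrakk>max_right_ideal R M; a \<in> carrier R; \<And>u. u \<in> left_ann R M \<Longrightarrow> u \<otimes> a = \<zero>\<rbrakk> \<Longrightarrow> a \<in> M"
    and reflexive_surj: "\<lbrakk>max_right_ideal R M; left_hom_on R (left_ann R M) h\<rbrakk>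
        \<Longrightarrow> \<exists>a\<in>carrier R. \<forall>u\<in>left_ann R M. h u = u \<otimes> a"
begin

text \<open>
  By \<open>simple_socle\<close>, an element that does not kill the socle acts injectively on \<open>e i A\<close>.
\<close>

lemma corner_unit:
  assumes i: "i < n" and x: "x \<in> carrier R" "e i \<otimes> x = x" "x \<otimes> e i = x"
    and u: "min_right R u" "e i \<otimes> u = u" "x \<otimes> u \<noteq> \<zero>"
  shows "\<exists>y\<in>carrier R. e i \<otimes> y = y \<and> y \<otimes> e i = y \<and> y \<otimes> x = e i \<and> x \<otimes> y = e i"
proof (rule corner_inverse[OF dcc_right])
  show "e i \<in> carrier R" "e i \<otimes> e i = e i" using i by auto
  fix z assume z: "z \<in> carrier R" "e i \<otimes> z = z" "x \<otimes> z = \<zero>"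
  show "z = \<zero>"
  proof (rule ccontr)
    assume "z \<noteq> \<zero>"
    then obtain b where b: "b \<in> carrier R" "min_right R (z \<otimes> b)" using min_right_exists[OF dcc_right z(1)] by blast
    have "e i \<otimes> (z \<otimes> b) = z \<otimes> b" using i z b(1) by (simp add: m_assoc[symmetric])
    then obtain c where c: "c \<in> carrier R" "u = z \<otimes> b \<otimes> c"
      using simple_socle[OF i b(2) u(1) _ u(2)] by blast
    then have "x \<otimes> u = (x \<otimes> z) \<otimes> (b \<otimes> c)" using x(1) z(1) b(1) by (simp add: m_assoc)
    then show False using u(3) z(3) b(1) c(1) by simp
  qed
qed (use x in auto)

text \<open>The corner at \<open>e p\<close> is local. If \<open>x\<close> killed the socle of
  \<open>e p R\<close>, then \<open>e p \<ominus> x\<close> would act on it as the identity and be a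
  unit; but \<open>w\<close> is not zero and kills \<open>e p \<ominus> x\<close>.\<close>

lemma corner_unit_of_fixed:
  assumes p: "p < n" and w: "w \<in> carrier R" "w \<noteq> \<zero>" "w \<otimes> e p = w"
    and x: "x \<in> carrier R" "e p \<otimes> x = x" "x \<otimes> e p = x" "w \<otimes> x = w"
  shows "\<exists>y\<in>carrier R. e p \<otimes> y = y \<and> y \<otimes> e p = y \<and> y \<otimes> x = e p \<and> x \<otimes> y = e p"
proof -
  obtain d where d: "d \<in> carrier R" "min_right R (e p \<otimes> d)"
    using min_right_exists[OF dcc_right _ e_nonzero[OF p]] p by auto
  define u where "u = e p \<otimes> d"
  have u: "min_right R u" "e p \<otimes> u = u" "u \<in> carrier R" "u \<noteq> \<zero>"
    using d p min_rightD(2)[OF d(2)] by (auto simp: u_def m_assoc[symmetric])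
  have "x \<otimes> u \<noteq> \<zero>"
  proof
    assume xu: "x \<otimes> u = \<zero>"
    let ?z = "e p \<ominus> x"
    have "?z \<otimes> u = e p \<otimes> u \<ominus> x \<otimes> u" using p x(1) u(3) by (simp add: minus_distr_l)
    then have "?z \<otimes> u = u" using u xu by (simp add: minus_eq)
    moreover have z: "?z \<in> carrier R" "e p \<otimes> ?z = ?z" "?z \<otimes> e p = ?z"
      using p x by (auto simp: minus_distr_l minus_distr_r)
    ultimately obtain y where y: "y \<in> carrier R" "?z \<otimes> y = e p"
      using corner_unit[OF p z u(1,2)] u(4) by auto
    have "w = w \<otimes> (?z \<otimes> y)" using y(2) w(3) by simp
    also have "\<dots> = (w \<otimes> e p \<ominus> w \<otimes> x) \<otimes> y" using w(1) p x(1) y(1) by (simp add: minus_distr_r m_assoc[symmetric])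
    also have "\<dots> = \<zero>" using w x(4) y(1) by (simp add: minus_eq r_neg)
    finally show False using w(2) by simp
  qed
  then show ?thesis using corner_unit[OF p x(1-3) u(1,2)] by blast
qed

text \<open>
  If \<open>w A = w' A\<close> is a nonzero image of both \<open>e p A\<close> and \<open>e q A\<close>, then the lifts \<open>b\<close> and \<open>c\<close> of the
  identity are mutually inverse up to units of the local rings at \<open>e p\<close> and \<open>e q\<close>.
\<close>

lemma projective_cover_unique:
  assumes pq: "p < n" "q < n"
    and w: "w \<in> carrier R" "w \<noteq> \<zero>" "w \<otimes> e p = w"
    and w': "w' \<in> carrier R" "w' \<otimes> e q = w'"
    and b': "b' \<in> carrier R" "w = w' \<otimes> b'" and c': "c' \<in> carrier R" "w' = w \<otimes> c'"
  shows "p = q"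
proof -
  \<comment> \<open>Cut down to homomorphisms between \<open>e p R\<close> and \<open>e q R\<close>;
    \<open>w\<close> and \<open>w'\<close> absorb the idempotents.\<close>
  define b where "b = e q \<otimes> b' \<otimes> e p"
  define c where "c = e p \<otimes> c' \<otimes> e q"
  note ep = e_idem[OF pq(1)] e_closed[OF pq(1)] and eq = e_idem[OF pq(2)] e_closed[OF pq(2)]
  have b: "b \<in> carrier R" "e q \<otimes> b = b" "b \<otimes> e p = b"
    using b'(1) ep eq by (auto simp: b_def m_assoc) (simp add: m_assoc[symmetric])
  have c: "c \<in> carrier R" "e p \<otimes> c = c" "c \<otimes> e q = c"
    using c'(1) ep eq by (auto simp: c_def m_assoc) (simp add: m_assoc[symmetric])
  have "w' \<otimes> b = (w' \<otimes> e q) \<otimes> b' \<otimes> e p" using w'(1) b'(1) ep eq by (simp add: b_def m_assoc)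
  also have "\<dots> = w" unfolding w'(2) b'(2)[symmetric] by (rule w(3))
  finally have wb: "w' \<otimes> b = w" .
  have "w \<otimes> c = (w \<otimes> e p) \<otimes> c' \<otimes> e q" using w(1) c'(1) ep eq by (simp add: c_def m_assoc)
  also have "\<dots> = w'" unfolding w(3) c'(2)[symmetric] by (rule w'(2))
  finally have wc: "w \<otimes> c = w'" .
  have w'0: "w' \<noteq> \<zero>" using wb w(2) b(1) by auto
  have "w \<otimes> (c \<otimes> b) = w" using w(1) b(1) c(1) wb wc by (simp add: m_assoc[symmetric])
  moreover have "e p \<otimes> (c \<otimes> b) = c \<otimes> b" "c \<otimes> b \<otimes> e p = c \<otimes> b"
    using b c ep by (simp_all add: m_assoc[symmetric]) (simp add: m_assoc)
  ultimately obtain y where y: "y \<in> carrier R" "e p \<otimes> y = y" "y \<otimes> (c \<otimes> b) = e p"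
    using corner_unit_of_fixed[OF pq(1) w, of "c \<otimes> b"] b(1) c(1) by auto
  have "w' \<otimes> (b \<otimes> c) = w'" using w'(1) b(1) c(1) wb wc by (simp add: m_assoc[symmetric])
  moreover have "e q \<otimes> (b \<otimes> c) = b \<otimes> c" "b \<otimes> c \<otimes> e q = b \<otimes> c"
    using b c eq by (simp_all add: m_assoc[symmetric]) (simp add: m_assoc)
  ultimately obtain z where z: "z \<in> carrier R" "z \<otimes> e q = z" "b \<otimes> c \<otimes> z = e q"
    using corner_unit_of_fixed[OF pq(2) w'(1) w'0 w'(2), of "b \<otimes> c"] b(1) c(1) by auto
  \<comment> \<open>\<open>y \<otimes> c\<close> is a left inverse of \<open>b\<close> and
    \<open>c \<otimes> z\<close> a right inverse, so they agree.\<close>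
  have "y \<otimes> c = y \<otimes> c \<otimes> (b \<otimes> c \<otimes> z)" using y(1) c eq by (simp add: z(3) m_assoc)
  also have "\<dots> = (y \<otimes> (c \<otimes> b)) \<otimes> c \<otimes> z" using y(1) b(1) c(1) z(1) by (simp add: m_assoc)
  also have "\<dots> = c \<otimes> z" by (simp add: y(3) c(2))
  finally have yc: "y \<otimes> c = c \<otimes> z" .
  show ?thesis
  proof (rule noniso[OF pq b(1) _ b(2,3)])
    show "y \<otimes> c \<in> carrier R" using y c by simp
    show "e p \<otimes> (y \<otimes> c) = y \<otimes> c" "y \<otimes> c \<otimes> e q = y \<otimes> c"
      using y(1,2) c ep eq by (simp_all add: m_assoc[symmetric]) (simp add: m_assoc)
    show "y \<otimes> c \<otimes> b = e p" using y(1) b(1) c(1) y(3) by (simp add: m_assoc)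
    show "b \<otimes> (y \<otimes> c) = e q" unfolding yc using b(1) c(1) z(1,3) by (simp add: m_assoc)
  qed
qed

section \<open>The bijection between tops and socles\<close>

text \<open>The second condition puts \<open>(1 - e i) R\<close> inside \<open>M\<close>, which
  makes \<open>R/M\<close> a simple quotient of \<open>e i R\<close>.\<close>

lemma max_right_ideal_exists:
  assumes i: "i < n"
  shows "\<exists>M. max_right_ideal R M \<and> (\<forall>a\<in>carrier R. a \<ominus> e i \<otimes> a \<in> M)"
proof -
  let ?A = "{M. right_ideal R M \<and> \<one> \<notin> M \<and> (\<forall>a\<in>carrier R. a \<ominus> e i \<otimes> a \<in> M)}"
  have "\<exists>M\<in>?A. \<forall>M'\<in>?A. M \<subseteq> M' \<longrightarrow> M' = M"
  proof (rule subset_Zorn_nonempty)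
    \<comment> \<open>\<open>f R\<close> is the least candidate; it is proper because
      \<open>e i\<close> kills it.\<close>
    define f where "f = \<one> \<ominus> e i"
    have f: "f \<in> carrier R" using i by (simp add: f_def)
    have fa: "f \<otimes> a = a \<ominus> e i \<otimes> a" if "a \<in> carrier R" for a
      using that i by (simp add: f_def minus_distr_l)
    have "\<one> \<noteq> f \<otimes> a" if a: "a \<in> carrier R" for a
    proof
      assume 1: "\<one> = f \<otimes> a"
      have "e i = e i \<otimes> (f \<otimes> a)" using i unfolding 1[symmetric] by simp
      also have "\<dots> = \<zero>" using i a by (simp add: fa minus_distr_r m_assoc[symmetric] minus_eq_zero_iff)
      finally show False using e_nonzero[OF i] by simp
    qed
    then have "\<one> \<notin> {f \<otimes> a | a. a \<in> carrier R}" by blast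
    moreover have "a \<ominus> e i \<otimes> a \<in> {f \<otimes> a | a. a \<in> carrier R}" if "a \<in> carrier R" for a
      using fa[OF that] that by (metis (mono_tags, lifting) mem_Collect_eq)
    ultimately have "{f \<otimes> a | a. a \<in> carrier R} \<in> ?A"
      using right_ideal_principal[OF f] by blast
    then show "?A \<noteq> {}" by blast
  next
    fix C assume C: "C \<noteq> {}" "subset.chain ?A C"
    then have sub: "C \<subseteq> ?A" by (auto simp: subset_chain_def)
    then have ri: "\<And>N. N \<in> C \<Longrightarrow> right_ideal R N" by blast
    have "x \<oplus> y \<in> \<Union>C" if "x \<in> \<Union>C" "y \<in> \<Union>C" for x y
    proof -
      obtain G H where GH: "G \<in> C" "x \<in> G" "H \<in> C" "y \<in> H"
        using \<open>x \<in> \<Union>C\<close> \<open>y \<in> \<Union>C\<close> by blast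
      then have "G \<subseteq> H \<or> H \<subseteq> G" using C(2) by (auto simp: subset_chain_def)
      then show ?thesis
        using GH right_ideal_add[OF ri[OF GH(1)], of x y] right_ideal_add[OF ri[OF GH(3)], of x y] by blast
    qed
    moreover have "x \<otimes> a \<in> \<Union>C" if "x \<in> \<Union>C" "a \<in> carrier R" for x a
      using that right_ideal_smult[OF ri, of _ x a] by blast
    moreover have "\<zero> \<in> \<Union>C" using C(1) right_ideal_zero[OF ri] by blast
    moreover have "\<Union>C \<subseteq> carrier R" using right_ideal_closed[OF ri] by blast
    ultimately have "right_ideal R (\<Union>C)" unfolding right_ideal_def by blast
    moreover have "\<one> \<notin> \<Union>C" using sub by blast
    moreover have "a \<ominus> e i \<otimes> a \<in> \<Union>C" if "a \<in> carrier R" for a using sub C(1) that by blast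
    ultimately show "\<Union>C \<in> ?A" by blast
  qed
  then obtain M where M: "M \<in> ?A" and max: "\<forall>M'\<in>?A. M \<subseteq> M' \<longrightarrow> M' = M" ..
  have Mr: "right_ideal R M" and M1: "\<one> \<notin> M" and Me: "\<And>a. a \<in> carrier R \<Longrightarrow> a \<ominus> e i \<otimes> a \<in> M"
    using M by simp_all
  have "\<exists>b\<in>carrier R. \<one> \<ominus> a \<otimes> b \<in> M" if a: "a \<in> carrier R" "a \<notin> M" for a
  proof -
    define K where "K = {m \<oplus> a \<otimes> b | m b. m \<in> M \<and> b \<in> carrier R}"
    have K: "right_ideal R K" "M \<subseteq> K" "a \<in> K"
      unfolding K_def by (rule right_ideal_sum[OF Mr a(1)])+
    have "\<one> \<in> K"
    proof (rule ccontr)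
      assume "\<one> \<notin> K"
      then have "K \<in> ?A" using K(1,2) Me by (simp add: subset_iff)
      then have "K = M" using max K(2) by simp
      then show False using K(3) a(2) by simp
    qed
    then obtain m b where mb: "m \<in> M" "b \<in> carrier R" "\<one> = m \<oplus> a \<otimes> b" unfolding K_def by blast
    have mc: "m \<in> carrier R" using right_ideal_closed[OF Mr mb(1)] .
    have "\<one> \<ominus> a \<otimes> b = m"
      by (subst mb(3)) (use a(1) mb(2) mc in \<open>simp add: minus_eq a_assoc r_neg\<close>)
    then show ?thesis using mb(1,2) by (intro bexI[of _ b]) simp_all
  qed
  then have "max_right_ideal R M" using Mr M1 by (simp add: max_right_ideal_def)
  then show ?thesis using Me by blast
qed

text \<open>
  The permutation \<open>j\<close> sends \<open>p\<close> to the unique \<open>i\<close> such that the socle of \<open>e i A\<close> is isomorphic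
  to the top of \<open>e p A\<close>: it is injective because a simple module has only one projective
  cover, hence surjective.
\<close>

lemma socle_permutation:
  obtains w j where "\<And>p. p < n \<Longrightarrow> j p < n" "\<And>p. p < n \<Longrightarrow> min_right R (w p)"
    "\<And>p. p < n \<Longrightarrow> e (j p) \<otimes> w p = w p" "\<And>p. p < n \<Longrightarrow> w p \<otimes> e p = w p"
    "\<And>i. i < n \<Longrightarrow> \<exists>p<n. i = j p"
proof -
  have "\<exists>i w. i < n \<and> min_right R w \<and> e i \<otimes> w = w \<and> w \<otimes> e p = w" if p: "p < n" for p
  proof -
    obtain M where M: "max_right_ideal R M" "\<And>a. a \<in> carrier R \<Longrightarrow> a \<ominus> e p \<otimes> a \<in> M"
      using max_right_ideal_exists[OF p] by blast
    have "\<one> \<notin> M" using M(1) by (simp add: max_right_ideal_def)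
    \<comment> \<open>Injectivity of the evaluation map: the class of one is not killed by all
      homomorphisms from \<open>R/M\<close> to \<open>R\<close>, and these are the elements of
      \<open>left_ann R M\<close>.\<close>
    then obtain u where u: "u \<in> left_ann R M" "u \<otimes> \<one> \<noteq> \<zero>"
      using reflexive_inj[OF M(1) one_closed] by blast
    have uc: "u \<in> carrier R" using u by (simp add: left_ann_def)
    have "u \<otimes> (\<one> \<ominus> e p \<otimes> \<one>) = \<zero>" using u(1) M(2)[of \<one>] by (simp add: left_ann_def)
    then have up: "u \<otimes> e p = u" using uc p by (simp add: minus_distr_r minus_eq_zero_iff)
    have u0: "u \<noteq> \<zero>" using u(2) uc by simp
    have um: "min_right R u" using min_right_left_ann[OF M(1) u(1) u0] .
    \<comment> \<open>A nonzero component moves the copy of \<open>R/M\<close> into the socle of a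
      single \<open>e i R\<close>.\<close>
    obtain i where i: "i < n" "e i \<otimes> u \<noteq> \<zero>" using e_zero[OF uc] u0 by blast
    have "min_right R (e i \<otimes> u)" using min_right_mult[OF um _ i(2)] i(1) by simp
    moreover have "e i \<otimes> (e i \<otimes> u) = e i \<otimes> u" using i(1) uc by (simp add: m_assoc[symmetric])
    moreover have "e i \<otimes> u \<otimes> e p = e i \<otimes> u" using i(1) uc p by (simp add: m_assoc up)
    ultimately show ?thesis using i(1) by blast
  qed
  then obtain j w where jw: "\<And>p. p < n \<Longrightarrow> j p < n \<and> min_right R (w p) \<and> e (j p) \<otimes> w p = w p \<and> w p \<otimes> e p = w p"
    by metis
  have inj: "p = q" if "p < n" "q < n" "j p = j q" for p q
  proof -
    have wp: "min_right R (w p)" "e (j p) \<otimes> w p = w p" "w p \<otimes> e p = w p"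
      and wq: "min_right R (w q)" "e (j p) \<otimes> w q = w q" "w q \<otimes> e q = w q" and jp: "j p < n"
      using jw[OF that(1)] jw[OF that(2)] that(3) by auto
    \<comment> \<open>For equal indices, \<open>w p\<close> and \<open>w q\<close> generate the same
      simple socle, which is then an image of both \<open>e p R\<close> and
      \<open>e q R\<close>.\<close>
    obtain b where b: "b \<in> carrier R" "w p = w q \<otimes> b" using simple_socle[OF jp wq(1) wp(1) wq(2) wp(2)] by blast
    obtain c where c: "c \<in> carrier R" "w q = w p \<otimes> c" using simple_socle[OF jp wp(1) wq(1) wp(2) wq(2)] by blast
    show ?thesis
      using projective_cover_unique[OF that(1,2) min_rightD(1,2)[OF wp(1)] wp(3) min_rightD(1)[OF wq(1)] wq(3) b c] .
  qed
  have "j ` {..<n} = {..<n}"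
    by (rule endo_inj_surj) (use jw inj in \<open>auto intro: inj_onI\<close>)
  then have "\<exists>p<n. i = j p" if "i < n" for i
    using that by (metis imageE lessThan_iff)
  then show thesis using that jw by blast
qed

text \<open>\<open>e i \<otimes> u\<close> and \<open>e k \<otimes> (a \<otimes> u)\<close> generate
  nonzero images of the simple module \<open>u R\<close>, that is, isomorphic simple right ideals in
  \<open>e i R\<close> and \<open>e k R\<close>. By \<open>socle_permutation\<close> these socles
  are images of \<open>e p R\<close> and \<open>e q R\<close> with \<open>i = j p\<close> and
  \<open>k = j q\<close>, and uniqueness of the cover forces \<open>p = q\<close>.\<close>

lemma socle_components:
  assumes u: "min_right R u" and a: "a \<in> carrier R" and ik: "i < n" "k < n"
    and iu: "e i \<otimes> u \<noteq> \<zero>" and kau: "e k \<otimes> (a \<otimes> u) \<noteq> \<zero>"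
  shows "i = k"
proof -
  obtain w j where j: "\<And>p. p < n \<Longrightarrow> j p < n" and w: "\<And>p. p < n \<Longrightarrow> min_right R (w p)"
    and jw: "\<And>p. p < n \<Longrightarrow> e (j p) \<otimes> w p = w p" and we: "\<And>p. p < n \<Longrightarrow> w p \<otimes> e p = w p"
    and surj: "\<And>i. i < n \<Longrightarrow> \<exists>p<n. i = j p"
    by (rule socle_permutation) (rule that)
  obtain p where p: "p < n" "i = j p" using surj[OF ik(1)] by blast
  obtain q where q: "q < n" "k = j q" using surj[OF ik(2)] by blast
  note [simp] = min_rightD(1)[OF u] a e_closed[OF ik(1)] e_closed[OF ik(2)] e_closed[OF p(1)] e_closed[OF q(1)]
  have iu': "min_right R (e i \<otimes> u)" "e i \<otimes> (e i \<otimes> u) = e i \<otimes> u"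
    using min_right_mult[OF u _ iu] ik(1) by (simp_all add: m_assoc[symmetric])
  obtain c' where c': "c' \<in> carrier R" "w p = e i \<otimes> u \<otimes> c'"
    using simple_socle[OF ik(1) iu'(1) w[OF p(1)] iu'(2)] jw[OF p(1)] p(2) by blast
  \<comment> \<open>Ending in \<open>e p\<close>, the factor \<open>c\<close> makes
    \<open>v \<otimes> c\<close> generate an image of \<open>e p R\<close>; it is nonzero because
    \<open>u \<otimes> c\<close> is.\<close>
  define c where "c = c' \<otimes> e p"
  have c: "c \<in> carrier R" "c \<otimes> e p = c" using c'(1) p(1) by (simp_all add: c_def m_assoc)
  have "e i \<otimes> u \<otimes> c = w p \<otimes> e p" unfolding c'(2) using c'(1) by (simp add: c_def m_assoc)
  then have "e i \<otimes> (u \<otimes> c) \<noteq> \<zero>" using we[OF p(1)] min_rightD(2)[OF w[OF p(1)]] c(1) by (simp add: m_assoc)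
  then have uc: "u \<otimes> c \<noteq> \<zero>" by auto
  define v where "v = e k \<otimes> a \<otimes> u"
  have v: "v \<in> carrier R" "v \<noteq> \<zero>" using kau by (simp_all add: v_def m_assoc)
  have vm: "min_right R v" using min_right_mult[OF u, of "e k \<otimes> a"] v(2) by (simp add: v_def)
  have vc0: "v \<otimes> c \<noteq> \<zero>"
    unfolding v_def using min_right_mult_nonzero[OF u _ _ c(1) uc, of "e k \<otimes> a"] v(2) by (simp add: v_def)
  have vcm: "min_right R (v \<otimes> c)" using min_right_smult[OF vm c(1) vc0] .
  have vce: "e k \<otimes> (v \<otimes> c) = v \<otimes> c" using c(1) ik(2) by (simp add: v_def m_assoc[symmetric])
  have vcp: "v \<otimes> c \<otimes> e p = v \<otimes> c" using v(1) c by (simp add: m_assoc)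
  have wq: "e k \<otimes> w q = w q" using jw[OF q(1)] q(2) by simp
  obtain b where b: "b \<in> carrier R" "v \<otimes> c = w q \<otimes> b" using simple_socle[OF ik(2) w[OF q(1)] vcm wq vce] by blast
  obtain d where d: "d \<in> carrier R" "w q = v \<otimes> c \<otimes> d" using simple_socle[OF ik(2) vcm w[OF q(1)] vce wq] by blast
  have "p = q"
    using projective_cover_unique[OF p(1) q(1) min_rightD(1,2)[OF vcm] vcp min_rightD(1)[OF w[OF q(1)]] we[OF q(1)] b d] .
  then show ?thesis using p q by simp
qed

text \<open>This makes \<open>R u\<close> a minimal left ideal. By \<open>socle_components\<close>,
  \<open>u\<close> and \<open>a \<otimes> u\<close> lie in the same \<open>e i R\<close>, so
  \<open>a\<close> may be replaced by \<open>e i \<otimes> a \<otimes> e i\<close>. That element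
  does not kill the socle and is a unit of the corner by \<open>corner_unit\<close>.\<close>

lemma min_right_left_simple:
  assumes u: "min_right R u" and a: "a \<in> carrier R" "a \<otimes> u \<noteq> \<zero>"
  shows "\<exists>b\<in>carrier R. u = b \<otimes> (a \<otimes> u)"
proof -
  note uc [simp] = min_rightD(1)[OF u]
  obtain i where i: "i < n" "e i \<otimes> u \<noteq> \<zero>" using e_zero[OF uc] min_rightD(2)[OF u] by blast
  note [simp] = e_closed[OF i(1)] a(1)
  have "e k \<otimes> u = \<zero>" if k: "k < n" "k \<noteq> i" for k
    using socle_components[OF u one_closed i(1) k(1) i(2)] k(2) by auto
  then have eu: "e i \<otimes> u = u" by (intro e_single[OF i(1)]) simp
  have "e k \<otimes> (a \<otimes> u) = \<zero>" if k: "k < n" "k \<noteq> i" for k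
    using socle_components[OF u a(1) i(1) k(1) i(2)] k(2) by auto
  then have eau: "e i \<otimes> (a \<otimes> u) = a \<otimes> u" by (intro e_single[OF i(1)]) simp
  define x where "x = e i \<otimes> a \<otimes> e i"
  have x: "x \<in> carrier R" "e i \<otimes> x = x" "x \<otimes> e i = x"
    using i(1) by (auto simp: x_def m_assoc) (simp add: m_assoc[symmetric])
  have xu: "x \<otimes> u = a \<otimes> u" by (simp add: x_def m_assoc eu eau)
  then obtain y where y: "y \<in> carrier R" "y \<otimes> x = e i"
    using corner_unit[OF i(1) x u eu] a(2) by auto
  have "y \<otimes> (a \<otimes> u) = (y \<otimes> x) \<otimes> u" using y(1) x(1) by (simp add: xu[symmetric] m_assoc)
  also have "\<dots> = u" by (simp add: y(2) eu)
  finally show ?thesis using y(1) by (intro bexI[of _ y]) simp_all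
qed

end

section \<open>Duals of simple modules\<close>

context basic_qf2
begin

text \<open>
  If \<open>V\<close> is a complement of \<open>A u\<close> in \<open>l(M)\<close>, the projection onto \<open>A u\<close> is right multiplication by
  some \<open>a\<close> with \<open>u a = u\<close>, so \<open>a \<notin> M\<close>; but \<open>M\<close> is the annihilator of each nonzero element of \<open>V\<close>,
  and \<open>V a = 0\<close>. Hence \<open>V = 0\<close>.
\<close>

lemma left_ann_generated:
  assumes M: "max_right_ideal R M" and u: "u \<in> left_ann R M" "u \<noteq> \<zero>" and v: "v \<in> left_ann R M"
  shows "\<exists>b\<in>carrier R. v = b \<otimes> u"
proof (rule ccontr)
  assume no: "\<not> ?thesis"
  let ?L = "left_ann R M"
  have Mr: "right_ideal R M" using M by (simp add: max_right_ideal_def)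
  then have Ll: "left_ideal R ?L" by (intro left_ideal_left_ann) (auto simp: right_ideal_def)
  note Lc = left_ideal_closed[OF Ll]
  have uc [simp]: "u \<in> carrier R" and vc [simp]: "v \<in> carrier R" using u v Lc by auto
  have simple: "\<exists>b\<in>carrier R. t = b \<otimes> (a \<otimes> t)" if "t \<in> ?L" "a \<in> carrier R" "a \<otimes> t \<noteq> \<zero>" for a t
  proof -
    have "t \<noteq> \<zero>" using that by auto
    then show ?thesis using min_right_left_simple[OF min_right_left_ann[OF M that(1)]] that by blast
  qed
  \<comment> \<open>Each nonzero element of \<open>left_ann R M\<close> generates a simple left
    module, so a submodule maximal among those avoiding \<open>u\<close> is a complement of
    \<open>R u\<close>.\<close>
  define A where "A = {V. left_ideal R V \<and> V \<subseteq> ?L \<and> u \<notin> V}"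
  have "\<exists>V\<in>A. \<forall>V'\<in>A. V \<subseteq> V' \<longrightarrow> V' = V"
  proof (rule subset_Zorn_nonempty)
    have "left_ideal R {\<zero>}" by (auto simp: left_ideal_def)
    then have "{\<zero>} \<in> A" using u(2) left_ideal_zero[OF Ll] by (simp add: A_def)
    then show "A \<noteq> {}" by blast
  next
    fix C assume C: "C \<noteq> {}" "subset.chain A C"
    have sub: "left_ideal R N" "N \<subseteq> ?L" "u \<notin> N" if "N \<in> C" for N
      using C(2) that by (auto simp: subset_chain_def A_def)
    have "x \<oplus> y \<in> \<Union>C" if "x \<in> \<Union>C" "y \<in> \<Union>C" for x y
    proof -
      obtain G H where GH: "G \<in> C" "x \<in> G" "H \<in> C" "y \<in> H"
        using \<open>x \<in> \<Union>C\<close> \<open>y \<in> \<Union>C\<close> by blast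
      then have "G \<subseteq> H \<or> H \<subseteq> G" using C(2) by (auto simp: subset_chain_def)
      then show ?thesis
        using GH left_ideal_add[OF sub(1)[OF GH(1)], of x y] left_ideal_add[OF sub(1)[OF GH(3)], of x y]
        by blast
    qed
    moreover have "a \<otimes> x \<in> \<Union>C" if "x \<in> \<Union>C" "a \<in> carrier R" for x a
      using that left_ideal_smult[OF sub(1), of _ x a] by blast
    moreover have "\<zero> \<in> \<Union>C" using C(1) left_ideal_zero[OF sub(1)] by blast
    moreover have "\<Union>C \<subseteq> carrier R" using left_ideal_closed[OF sub(1)] by blast
    ultimately have "left_ideal R (\<Union>C)" unfolding left_ideal_def by blast
    moreover have "\<Union>C \<subseteq> ?L" using sub(2) by (rule Union_least)
    moreover have "u \<notin> \<Union>C" using sub(3) by blast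
    ultimately show "\<Union>C \<in> A" by (simp add: A_def)
  qed
  then obtain V where V: "V \<in> A" and max: "\<forall>V'\<in>A. V \<subseteq> V' \<longrightarrow> V' = V" ..
  have Vl: "left_ideal R V" and VL: "V \<subseteq> ?L" and uV: "u \<notin> V" using V by (simp_all add: A_def)
  note Vc = left_ideal_closed[OF Vl]
  have disj: "a \<otimes> u = \<zero>" if a: "a \<in> carrier R" "a \<otimes> u \<in> V" for a
  proof (rule ccontr)
    assume "a \<otimes> u \<noteq> \<zero>"
    then obtain b where "b \<in> carrier R" "u = b \<otimes> (a \<otimes> u)" using simple[OF u(1) a(1)] by blast
    then have "u \<in> V" using left_ideal_smult[OF Vl a(2)] by metis
    then show False using uV by simp
  qed
  have decomp: "\<exists>s\<in>V. \<exists>a\<in>carrier R. t = s \<oplus> a \<otimes> u" if t: "t \<in> ?L" for t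
  proof (cases "t \<in> V")
    case True
    then have "t = t \<oplus> \<zero> \<otimes> u" using Vc by simp
    then show ?thesis using True by blast
  next
    case False
    have tc: "t \<in> carrier R" using Lc[OF t] .
    \<comment> \<open>\<open>V + R t\<close> is larger than \<open>V\<close>, so it contains
      \<open>u\<close>; simplicity of \<open>R t\<close> allows the equation to be solved for
      \<open>t\<close>.\<close>
    define W where "W = {s \<oplus> a \<otimes> t | s a. s \<in> V \<and> a \<in> carrier R}"
    have WI: "s \<oplus> a \<otimes> t \<in> W" if "s \<in> V" "a \<in> carrier R" for s a using that by (auto simp: W_def)
    have WE: "\<exists>s a. s \<in> V \<and> a \<in> carrier R \<and> x = s \<oplus> a \<otimes> t" if "x \<in> W" for x
      using that by (auto simp: W_def)
    have tW: "t \<in> W" using WI[OF left_ideal_zero[OF Vl] one_closed] tc by simp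
    have VW: "V \<subseteq> W"
    proof
      fix s assume "s \<in> V"
      then show "s \<in> W" using WI[of s \<zero>] tc Vc by simp
    qed
    have "x \<oplus> y \<in> W" if xy: "x \<in> W" "y \<in> W" for x y
    proof -
      obtain s a where sa: "s \<in> V" "a \<in> carrier R" "x = s \<oplus> a \<otimes> t" using WE[OF xy(1)] by blast
      obtain r b where rb: "r \<in> V" "b \<in> carrier R" "y = r \<oplus> b \<otimes> t" using WE[OF xy(2)] by blast
      have "x \<oplus> y = (s \<oplus> r) \<oplus> (a \<oplus> b) \<otimes> t"
        unfolding sa(3) rb(3) using sa(1,2) rb(1,2) tc Vc by (simp add: l_distr a_ac)
      then show ?thesis using WI[OF left_ideal_add[OF Vl sa(1) rb(1)], of "a \<oplus> b"] sa(2) rb(2) by simp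
    qed
    moreover have "c \<otimes> x \<in> W" if xc: "x \<in> W" "c \<in> carrier R" for x c
    proof -
      obtain s a where sa: "s \<in> V" "a \<in> carrier R" "x = s \<oplus> a \<otimes> t" using WE[OF xc(1)] by blast
      have "c \<otimes> x = c \<otimes> s \<oplus> (c \<otimes> a) \<otimes> t"
        unfolding sa(3) using sa(1,2) xc(2) tc Vc by (simp add: r_distr m_assoc)
      then show ?thesis using WI[OF left_ideal_smult[OF Vl sa(1) xc(2)], of "c \<otimes> a"] sa(2) xc(2) by simp
    qed
    moreover have WL: "W \<subseteq> ?L"
    proof
      fix x assume "x \<in> W"
      then obtain s a where sa: "s \<in> V" "a \<in> carrier R" "x = s \<oplus> a \<otimes> t" using WE by blast
      show "x \<in> ?L"
        unfolding sa(3) using sa(1,2) VL by (intro left_ideal_add[OF Ll] left_ideal_smult[OF Ll t]) auto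
    qed
    moreover have "\<zero> \<in> W" using VW left_ideal_zero[OF Vl] by blast
    moreover have "W \<subseteq> carrier R" using WL Lc by blast
    ultimately have "left_ideal R W" unfolding left_ideal_def by blast
    moreover have "W \<noteq> V" using tW False by blast
    ultimately have "u \<in> W" using max VW WL by (auto simp: A_def)
    then obtain s a where sa: "s \<in> V" "a \<in> carrier R" "u = s \<oplus> a \<otimes> t" using WE by blast
    have sc: "s \<in> carrier R" using Vc[OF sa(1)] .
    have at0: "a \<otimes> t \<noteq> \<zero>"
    proof
      assume "a \<otimes> t = \<zero>"
      then have "u = s" using sa(3) sc by simp
      then show False using uV sa(1) by simp
    qed
    obtain b where b: "b \<in> carrier R" "t = b \<otimes> (a \<otimes> t)" using simple[OF t sa(2) at0] by blast
    have "(\<ominus> b \<otimes> s) \<oplus> b \<otimes> u = (\<ominus> b \<otimes> s) \<oplus> (b \<otimes> s \<oplus> b \<otimes> (a \<otimes> t))"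
      unfolding sa(3) using b(1) sc sa(2) tc by (simp add: r_distr)
    also have "\<dots> = b \<otimes> (a \<otimes> t)" using b(1) sc sa(2) tc by (simp add: l_minus r_neg1)
    also have "\<dots> = t" by (rule b(2)[symmetric])
    finally have "t = (\<ominus> b \<otimes> s) \<oplus> b \<otimes> u" by simp
    moreover have "\<ominus> b \<otimes> s \<in> V" using left_ideal_smult[OF Vl sa(1), of "\<ominus> b"] b(1) by simp
    ultimately show ?thesis using b(1) by blast
  qed
  \<comment> \<open>The projection onto \<open>R u\<close>; it is well defined because
    \<open>disj\<close> makes \<open>V\<close> and \<open>R u\<close> meet in zero only.\<close>
  define pr where "pr t = (THE y. \<exists>s\<in>V. \<exists>a\<in>carrier R. t = s \<oplus> a \<otimes> u \<and> y = a \<otimes> u)" for t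
  have pr: "pr (s \<oplus> a \<otimes> u) = a \<otimes> u" if sa: "s \<in> V" "a \<in> carrier R" for s a
    unfolding pr_def
  proof (rule the_equality)
    show "\<exists>s'\<in>V. \<exists>a'\<in>carrier R. s \<oplus> a \<otimes> u = s' \<oplus> a' \<otimes> u \<and> a \<otimes> u = a' \<otimes> u"
      using sa by blast
    fix y assume "\<exists>s'\<in>V. \<exists>a'\<in>carrier R. s \<oplus> a \<otimes> u = s' \<oplus> a' \<otimes> u \<and> y = a' \<otimes> u"
    then obtain r b where rb: "r \<in> V" "b \<in> carrier R" "s \<oplus> a \<otimes> u = r \<oplus> b \<otimes> u" "y = b \<otimes> u" by blast
    have cl: "s \<in> carrier R" "r \<in> carrier R" "a \<otimes> u \<in> carrier R" "b \<otimes> u \<in> carrier R"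
      using sa rb(1,2) Vc by auto
    have "(b \<ominus> a) \<otimes> u = (s \<oplus> b \<otimes> u) \<ominus> (s \<oplus> a \<otimes> u)"
      using cl sa(2) rb(2) by (simp add: minus_distr_l add_minus_add)
    also have "\<dots> = (b \<otimes> u \<oplus> s) \<ominus> (b \<otimes> u \<oplus> r)"
      unfolding rb(3) using cl by (simp add: a_comm)
    also have "\<dots> = s \<ominus> r" using cl by (simp add: add_minus_add)
    finally have "(b \<ominus> a) \<otimes> u \<in> V" using left_ideal_minus[OF Vl sa(1) rb(1)] by simp
    then have "(b \<ominus> a) \<otimes> u = \<zero>" using disj sa(2) rb(2) by simp
    then show "y = a \<otimes> u" using rb(2,4) sa(2) by (simp add: minus_distr_l minus_eq_zero_iff)
  qed
  have "left_hom_on R ?L pr"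
    unfolding left_hom_on_def
  proof (intro conjI ballI)
    fix x assume "x \<in> ?L"
    then obtain s a where sa: "s \<in> V" "a \<in> carrier R" "x = s \<oplus> a \<otimes> u" using decomp by blast
    have sc: "s \<in> carrier R" using Vc[OF sa(1)] .
    show "pr x \<in> carrier R" unfolding sa(3) using sa(1,2) by (simp add: pr)
    show "pr (x \<oplus> y) = pr x \<oplus> pr y" if "y \<in> ?L" for y
    proof -
      obtain r b where rb: "r \<in> V" "b \<in> carrier R" "y = r \<oplus> b \<otimes> u"
        using decomp[OF \<open>y \<in> ?L\<close>] by blast
      have rc: "r \<in> carrier R" using Vc[OF rb(1)] .
      have "x \<oplus> y = (s \<oplus> r) \<oplus> (a \<oplus> b) \<otimes> u"
        unfolding sa(3) rb(3) using sc rc sa(2) rb(2) by (simp add: l_distr a_ac)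
      then have "pr (x \<oplus> y) = (a \<oplus> b) \<otimes> u"
        using pr[OF left_ideal_add[OF Vl sa(1) rb(1)], of "a \<oplus> b"] sa(2) rb(2) by simp
      then show ?thesis unfolding sa(3) rb(3) using sa(1,2) rb(1,2) by (simp add: pr l_distr)
    qed
    show "pr (c \<otimes> x) = c \<otimes> pr x" if "c \<in> carrier R" for c
    proof -
      have "c \<otimes> x = c \<otimes> s \<oplus> (c \<otimes> a) \<otimes> u"
        unfolding sa(3) using sc sa(2) that by (simp add: r_distr m_assoc)
      then have "pr (c \<otimes> x) = (c \<otimes> a) \<otimes> u"
        using pr[OF left_ideal_smult[OF Vl sa(1) that], of "c \<otimes> a"] sa(2) that by simp
      then show ?thesis unfolding sa(3) using sa(1,2) that by (simp add: pr m_assoc)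
    qed
  qed
  then obtain a where a: "a \<in> carrier R" "\<forall>t\<in>?L. pr t = t \<otimes> a" using reflexive_surj[OF M] by blast
  have "pr u = u" using pr[OF left_ideal_zero[OF Vl] one_closed] by simp
  then have "u \<otimes> a = u" using a(2) u(1) by simp
  then have "a \<notin> M" using u by (auto simp: left_ann_def)
  then obtain b where b: "b \<in> carrier R" "\<one> \<ominus> a \<otimes> b \<in> M" using M a(1) by (auto simp: max_right_ideal_def)
  \<comment> \<open>\<open>s\<close> is killed by \<open>a\<close> and, lying in
    \<open>left_ann R M\<close>, also by \<open>\<one> \<ominus> a \<otimes> b\<close>; hence by
    \<open>\<one>\<close>.\<close>
  have V0: "s = \<zero>" if s: "s \<in> V" for s
  proof -
    have sc: "s \<in> carrier R" and sL: "s \<in> ?L" using Vc[OF s] s VL by auto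
    have "pr s = \<zero>" using pr[OF s zero_closed] sc by simp
    then have "s \<otimes> a = \<zero>" using a(2) sL by simp
    then have "s \<otimes> (\<one> \<ominus> a \<otimes> b) = s"
      using sc a(1) b(1) by (simp add: minus_distr_r m_assoc[symmetric]) (simp add: minus_eq)
    moreover have "s \<otimes> (\<one> \<ominus> a \<otimes> b) = \<zero>" using sL b(2) by (simp add: left_ann_def)
    ultimately show ?thesis by simp
  qed
  obtain s a' where sa: "s \<in> V" "a' \<in> carrier R" "v = s \<oplus> a' \<otimes> u" using decomp[OF v] by blast
  then have "v = a' \<otimes> u" using V0[OF sa(1)] by simp
  then show False using no sa(2) by blast
qed

text \<open>Since \<open>left_ann R {u}\<close> kills \<open>x\<close>, the assignment
  \<open>b \<otimes> u \<mapsto> b \<otimes> x\<close> is a well-defined left homomorphism on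
  \<open>left_ann R M = R u\<close>. Surjectivity of the evaluation map, used here a second time,
  makes it a right multiplication; its value at \<open>u\<close> is \<open>x\<close>.\<close>

lemma right_ann_left_ann:
  assumes M: "max_right_ideal R M" and u: "u \<in> left_ann R M" "u \<noteq> \<zero>"
    and x: "x \<in> right_ann R (left_ann R {u})"
  shows "\<exists>b\<in>carrier R. x = u \<otimes> b"
proof -
  let ?L = "left_ann R M"
  have uc [simp]: "u \<in> carrier R" using u by (simp add: left_ann_def)
  have xc [simp]: "x \<in> carrier R" and x0: "\<And>b. b \<in> carrier R \<Longrightarrow> b \<otimes> u = \<zero> \<Longrightarrow> b \<otimes> x = \<zero>"
    using x by (auto simp: right_ann_def left_ann_def)
  define h where "h t = (THE y. \<exists>b\<in>carrier R. t = b \<otimes> u \<and> y = b \<otimes> x)" for t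
  have h: "h (b \<otimes> u) = b \<otimes> x" if b: "b \<in> carrier R" for b
    unfolding h_def
  proof (rule the_equality)
    show "\<exists>c\<in>carrier R. b \<otimes> u = c \<otimes> u \<and> b \<otimes> x = c \<otimes> x" using b by blast
    fix y assume "\<exists>c\<in>carrier R. b \<otimes> u = c \<otimes> u \<and> y = c \<otimes> x"
    then obtain c where c: "c \<in> carrier R" "b \<otimes> u = c \<otimes> u" "y = c \<otimes> x" by blast
    have "(c \<ominus> b) \<otimes> u = \<zero>" using b c(1,2) by (simp add: minus_distr_l minus_eq_zero_iff)
    then have "(c \<ominus> b) \<otimes> x = \<zero>" using x0 b c(1) by simp
    then show "y = b \<otimes> x" using b c(1,3) by (simp add: minus_distr_l minus_eq_zero_iff)
  qed
  have "left_hom_on R ?L h"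
    unfolding left_hom_on_def
  proof (intro conjI ballI)
    fix t assume "t \<in> ?L"
    then obtain b where b: "b \<in> carrier R" "t = b \<otimes> u" using left_ann_generated[OF M u] by blast
    show "h t \<in> carrier R" using b by (simp add: h)
    show "h (t \<oplus> s) = h t \<oplus> h s" if s: "s \<in> ?L" for s
    proof -
      obtain c where c: "c \<in> carrier R" "s = c \<otimes> u" using left_ann_generated[OF M u s] by blast
      then show ?thesis using b h[of "b \<oplus> c"] by (simp add: h l_distr)
    qed
    show "h (a \<otimes> t) = a \<otimes> h t" if "a \<in> carrier R" for a
      using that b h[of "a \<otimes> b"] by (simp add: h m_assoc)
  qed
  then obtain a where a: "a \<in> carrier R" "\<forall>t\<in>?L. h t = t \<otimes> a" using reflexive_surj[OF M] by blast
  have "h u = x" using h[OF one_closed] by simp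
  then have "x = u \<otimes> a" using a(2) u(1) by simp
  then show ?thesis using a(1) by blast
qed

lemma selfinjective_of_dcc_left:
  assumes "dcc (left_ideal R)"
  shows "selfinjective TYPE('t) R"
  unfolding selfinjective_def
  by (rule injective_right_regularI, rule extension_by_annihilators[OF assms dcc_right])
     (erule left_ann_generated right_ann_left_ann; assumption)+

end

section \<open>The socle of an indecomposable projective module\<close>

lemma mod_homD:
  assumes "f \<in> mod_hom A M N"
  shows "x \<in> carrier M \<Longrightarrow> f x \<in> carrier N"
    and "\<lbrakk>x \<in> carrier M; y \<in> carrier M\<rbrakk> \<Longrightarrow> f (x \<oplus>\<^bsub>M\<^esub> y) = f x \<oplus>\<^bsub>N\<^esub> f y"
    and "\<lbrakk>a \<in> carrier A; x \<in> carrier M\<rbrakk> \<Longrightarrow> f (a \<odot>\<^bsub>M\<^esub> x) = a \<odot>\<^bsub>N\<^esub> f x"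
  using assms by (auto simp: mod_hom_def)

lemma mod_homI:
  assumes "\<And>x. x \<in> carrier M \<Longrightarrow> f x \<in> carrier N"
    and "\<And>x y. \<lbrakk>x \<in> carrier M; y \<in> carrier M\<rbrakk> \<Longrightarrow> f (x \<oplus>\<^bsub>M\<^esub> y) = f x \<oplus>\<^bsub>N\<^esub> f y"
    and "\<And>a x. \<lbrakk>a \<in> carrier A; x \<in> carrier M\<rbrakk> \<Longrightarrow> f (a \<odot>\<^bsub>M\<^esub> x) = a \<odot>\<^bsub>N\<^esub> f x"
    and "f \<in> extensional (carrier M)"
  shows "f \<in> mod_hom A M N"
  using assms by (auto simp: mod_hom_def PiE_iff)

context right_module
begin

lemma submoduleD:
  assumes "submodule U A M"
  shows "U \<subseteq> carrier M" "\<zero>\<^bsub>M\<^esub> \<in> U" "\<lbrakk>x \<in> U; y \<in> U\<rbrakk> \<Longrightarrow> x \<oplus>\<^bsub>M\<^esub> y \<in> U"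
    "\<lbrakk>a \<in> carrier A; x \<in> U\<rbrakk> \<Longrightarrow> a \<odot>\<^bsub>M\<^esub> x \<in> U"
  using assms unfolding submodule_iff by blast+

lemma right_module_submodule:
  assumes U: "submodule U A M"
  shows "right_module A (M\<lparr>carrier := U\<rparr>)"
proof -
  note D = submoduleD[OF U]
  have Uc: "x \<in> carrier M" if "x \<in> U" for x using D(1) that by blast
  have "abelian_group (M\<lparr>carrier := U\<rparr>)"
  proof (rule abelian_groupI)
    fix x assume "x \<in> carrier (M\<lparr>carrier := U\<rparr>)"
    then have x: "x \<in> U" by simp
    have "(\<ominus> \<one>) \<odot>\<^bsub>M\<^esub> x \<in> U" using D(4)[OF _ x] by simp
    then have "\<ominus>\<^bsub>M\<^esub> x \<in> U" using Uc[OF x] by (simp add: minus_smult)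
    then show "\<exists>y\<in>carrier (M\<lparr>carrier := U\<rparr>). y \<oplus>\<^bsub>M\<lparr>carrier := U\<rparr>\<^esub> x = \<zero>\<^bsub>M\<lparr>carrier := U\<rparr>\<^esub>"
      using Uc[OF x] by (intro bexI[of _ "\<ominus>\<^bsub>M\<^esub> x"]) (simp_all add: M.l_neg)
  qed (use D Uc in \<open>simp_all add: M.a_ac\<close>)
  then show ?thesis
    by (intro right_module.intro right_module_axioms.intro R.ring_axioms)
       (use D Uc in \<open>simp_all add: smult_l_distr smult_r_distr smult_mult\<close>)
qed

lemma submodule_of_submodule_iff:
  assumes U: "submodule U A M"
  shows "submodule V A (M\<lparr>carrier := U\<rparr>) \<longleftrightarrow> submodule V A M \<and> V \<subseteq> U"
proof -
  interpret U: right_module A "M\<lparr>carrier := U\<rparr>" using right_module_submodule[OF U] .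
  show ?thesis unfolding U.submodule_iff submodule_iff using submoduleD(1)[OF U] by auto
qed

lemma gen_submodule_least:
  "\<lbrakk>submodule N A M; S \<subseteq> N\<rbrakk> \<Longrightarrow> gen_submodule A M S \<subseteq> N"
  by (auto simp: gen_submodule_def)

lemma submodule_carrier: "submodule (carrier M) A M"
  by (simp add: submodule_iff)

lemma submodule_gen_submodule:
  assumes "S \<subseteq> carrier M"
  shows "submodule (gen_submodule A M S) A M"
proof -
  have "gen_submodule A M S \<subseteq> carrier M"
    by (rule gen_submodule_least[OF submodule_carrier assms])
  then show ?thesis
    unfolding submodule_iff by (auto simp: gen_submodule_def dest: submoduleD)
qed

text \<open>A simple submodule lies in the socle, and a simple socle has no other nonzero submodule
  than itself.\<close>

lemma simple_submodule_eq_socle: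
  assumes soc: "simple_module A (M\<lparr>carrier := socle A M\<rparr>)"
    and U: "submodule U A M" "simple_module A (M\<lparr>carrier := U\<rparr>)"
  shows "U = socle A M"
proof -
  define S where "S = \<Union>{N. submodule N A M \<and> simple_module A (M\<lparr>carrier := N\<rparr>)}"
  have socle: "socle A M = gen_submodule A M S" by (simp add: socle_def S_def)
  have "S \<subseteq> carrier M" unfolding S_def by (rule Union_least) (simp add: submoduleD(1))
  then have S: "submodule (socle A M) A M" unfolding socle by (rule submodule_gen_submodule)
  have "U \<subseteq> S" unfolding S_def by (rule Union_upper) (simp add: U)
  then have "U \<subseteq> socle A M" by (auto simp: socle gen_submodule_def)
  then have "submodule U A (M\<lparr>carrier := socle A M\<rparr>)" using U(1) by (simp add: submodule_of_submodule_iff[OF S])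
  then have "U = {\<zero>\<^bsub>M\<^esub>} \<or> U = socle A M" using soc unfolding simple_module_def by simp
  then show ?thesis using U(2) unfolding simple_module_def by simp
qed

end

section \<open>Modules generated by an idempotent\<close>

context ring
begin

text \<open>\<open>QF2\<close> quantifies over modules of type \<open>fg_module\<close>, so
  \<open>f R\<close> is replaced by its copy \<open>N\<close> under \<open>\<theta>\<close>, and its
  properties are carried over. The copies of \<open>u R\<close> and \<open>v R\<close> are then both
  the simple socle of \<open>N\<close>.\<close>

lemma idempotent_simple_socle:
  assumes qf2: "QF2 R" and f: "f \<in> carrier R" "f \<otimes> f = f"
    and ind: "indecomposable_module R ((right_regular R)\<lparr>carrier := {x \<in> carrier R. f \<otimes> x = x}\<rparr>)"
    and u: "min_right R u" "f \<otimes> u = u" and v: "min_right R v" "f \<otimes> v = v"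
  shows "\<exists>b\<in>carrier R. v = u \<otimes> b"
proof -
  define P where "P = {x \<in> carrier R. f \<otimes> x = x}"
  define PM where "PM = (right_regular R)\<lparr>carrier := P\<rparr>"
  interpret A: right_module R "right_regular R" by (rule right_module_right_regular) (rule ring_axioms)
  have P: "right_ideal R P"
    using f by (auto simp: right_ideal_def P_def r_distr m_assoc[symmetric])
  then have Psub: "submodule P R (right_regular R)" by (simp add: submodule_right_regular_iff)
  interpret PM: right_module R PM unfolding PM_def by (rule A.right_module_submodule[OF Psub])
  have PM [simp]: "carrier PM = P" "x \<oplus>\<^bsub>PM\<^esub> y = x \<oplus> y" "a \<odot>\<^bsub>PM\<^esub> x = x \<otimes> a" "\<zero>\<^bsub>PM\<^esub> = \<zero>" for x y a
    by (simp_all add: PM_def right_regular_def)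
  have PD: "x \<in> carrier R" "f \<otimes> x = x" if "x \<in> P" for x using that by (auto simp: P_def)
  have fP: "f \<in> P" using f by (simp add: P_def)
  note Pm = right_ideal_smult[OF P] and Pa = right_ideal_add[OF P]
  have "gen_submodule R PM {f} = P"
  proof
    show "gen_submodule R PM {f} \<subseteq> P"
      using PM.gen_submodule_least[OF PM.submodule_carrier, of "{f}"] fP by simp
    show "P \<subseteq> gen_submodule R PM {f}"
    proof
      fix x assume x: "x \<in> P"
      have "x \<in> N" if "submodule N R PM" "f \<in> N" for N
        using PM.submoduleD(4)[OF that(1) PD(1)[OF x] that(2)] PD(2)[OF x] by simp
      then show "x \<in> gen_submodule R PM {f}" by (auto simp: gen_submodule_def)
    qed
  qed
  then have "fin_gen R PM" using fP unfolding fin_gen_def by (intro exI[of _ "{f}"]) simp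
  then obtain N :: "'a fg_module" where N: "right_module R N" and iso: "mod_isomorphic R PM N"
    using fin_gen_module_copy[OF PM.right_module_axioms] by blast
  interpret N: right_module R N by (rule N)
  obtain \<theta> where hom: "\<theta> \<in> mod_hom R PM N" and bij: "bij_betw \<theta> P (carrier N)"
    using iso by (auto simp: mod_isomorphic_def mod_iso_def)
  have \<theta>c: "\<theta> x \<in> carrier N" if "x \<in> P" for x using mod_homD(1)[OF hom] that by simp
  have \<theta>a: "\<theta> (x \<oplus> y) = \<theta> x \<oplus>\<^bsub>N\<^esub> \<theta> y" if "x \<in> P" "y \<in> P" for x y
    using mod_homD(2)[OF hom] that by simp
  have \<theta>s: "\<theta> (x \<otimes> a) = a \<odot>\<^bsub>N\<^esub> \<theta> x" if "x \<in> P" "a \<in> carrier R" for x a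
    using mod_homD(3)[OF hom] that by simp
  have \<theta>0: "\<theta> \<zero> = \<zero>\<^bsub>N\<^esub>" using \<theta>s[OF fP zero_closed] \<theta>c[OF fP] f by simp
  have \<theta>inj: "x = y" if "\<theta> x = \<theta> y" "x \<in> P" "y \<in> P" for x y
    using bij that by (auto simp: bij_betw_def inj_on_def)
  have \<theta>surj: "\<exists>x\<in>P. z = \<theta> x" if "z \<in> carrier N" for z
    using bij that by (auto simp: bij_betw_def)
  have \<theta>f: "\<theta> x = x \<odot>\<^bsub>N\<^esub> \<theta> f" if "x \<in> P" for x
    using \<theta>s[OF fP PD(1)[OF that]] PD(2)[OF that] by simp
  have fgN: "fin_gen R N"
  proof -
    have "carrier N \<subseteq> gen_submodule R N {\<theta> f}"
    proof
      fix z assume "z \<in> carrier N"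
      then obtain x where x: "x \<in> P" "z = \<theta> x" using \<theta>surj by blast
      have "z \<in> L" if "submodule L R N" "\<theta> f \<in> L" for L
        using N.submoduleD(4)[OF that(1) PD(1)[OF x(1)] that(2)] \<theta>f[OF x(1)] x(2) by simp
      then show "z \<in> gen_submodule R N {\<theta> f}" by (auto simp: gen_submodule_def)
    qed
    moreover have "gen_submodule R N {\<theta> f} \<subseteq> carrier N"
      using N.gen_submodule_least[OF N.submodule_carrier, of "{\<theta> f}"] \<theta>c[OF fP] by simp
    ultimately show ?thesis
      using \<theta>c[OF fP] unfolding fin_gen_def by (intro exI[of _ "{\<theta> f}"]) simp
  qed
  have projN: "projective_module TYPE((nat \<Rightarrow> 'a) set) R N"
    unfolding projective_module_def
  proof (intro allI impI ballI)
    fix X Y :: "'a fg_module" and p g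
    assume XY: "right_module R X \<and> right_module R Y" and p: "p \<in> mod_hom R X Y"
      and g: "g \<in> mod_hom R N Y" and surj: "p ` carrier X = carrier Y"
    interpret X: right_module R X using XY by blast
    have "g (\<theta> f) \<in> p ` carrier X" using mod_homD(1)[OF g \<theta>c[OF fP]] surj by simp
    \<comment> \<open>A homomorphism from \<open>f R\<close> is lifted through its generator:
      \<open>x0\<close> lies over \<open>g (\<theta> f)\<close>, and
      \<open>\<theta> x \<mapsto> x0 x\<close> lifts \<open>g\<close> because
      \<open>f \<otimes> x = x\<close>.\<close>
    then obtain x0 where x0: "x0 \<in> carrier X" "p x0 = g (\<theta> f)" by auto
    define \<sigma> where "\<sigma> = inv_into P \<theta>"
    have \<sigma>: "\<sigma> (\<theta> x) = x" if "x \<in> P" for x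
      using bij that by (simp add: \<sigma>_def bij_betw_def)
    let ?h = "\<lambda>z\<in>carrier N. \<sigma> z \<odot>\<^bsub>X\<^esub> x0"
    have h: "?h (\<theta> x) = x \<odot>\<^bsub>X\<^esub> x0" if "x \<in> P" for x
      using that \<theta>c \<sigma> by simp
    have hm: "?h \<in> mod_hom R N X"
    proof (rule mod_homI)
      fix z assume "z \<in> carrier N"
      then obtain x where x: "x \<in> P" "z = \<theta> x" using \<theta>surj by blast
      show "?h z \<in> carrier X" unfolding x(2) h[OF x(1)] using PD(1)[OF x(1)] x0(1) by simp
      show "?h (z \<oplus>\<^bsub>N\<^esub> w) = ?h z \<oplus>\<^bsub>X\<^esub> ?h w" if "w \<in> carrier N" for w
      proof -
        obtain y where y: "y \<in> P" "w = \<theta> y" using \<theta>surj \<open>w \<in> carrier N\<close> by blast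
        have "?h (\<theta> (x \<oplus> y)) = ?h (\<theta> x) \<oplus>\<^bsub>X\<^esub> ?h (\<theta> y)"
          unfolding h[OF x(1)] h[OF y(1)] h[OF Pa[OF x(1) y(1)]]
          using PD(1)[OF x(1)] PD(1)[OF y(1)] x0(1) by (rule X.smult_l_distr)
        then show ?thesis unfolding x(2) y(2) \<theta>a[OF x(1) y(1)] .
      qed
      show "?h (a \<odot>\<^bsub>N\<^esub> z) = a \<odot>\<^bsub>X\<^esub> ?h z" if a: "a \<in> carrier R" for a
      proof -
        have "?h (\<theta> (x \<otimes> a)) = a \<odot>\<^bsub>X\<^esub> ?h (\<theta> x)"
          unfolding h[OF x(1)] h[OF Pm[OF x(1) a]]
          using PD(1)[OF x(1)] a x0(1) by (rule X.smult_mult)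
        then show ?thesis unfolding x(2) \<theta>s[OF x(1) a] .
      qed
    qed simp
    have hp: "p (?h z) = g z" if "z \<in> carrier N" for z
    proof -
      obtain x where x: "x \<in> P" "z = \<theta> x" using \<theta>surj \<open>z \<in> carrier N\<close> by blast
      have "p (?h z) = x \<odot>\<^bsub>Y\<^esub> g (\<theta> f)"
        unfolding x(2) h[OF x(1)] using mod_homD(3)[OF p PD(1)[OF x(1)] x0(1)] x0(2) by simp
      also have "\<dots> = g z"
        using mod_homD(3)[OF g PD(1)[OF x(1)] \<theta>c[OF fP]] \<theta>f[OF x(1)] x(2) by simp
      finally show ?thesis .
    qed
    show "\<exists>h\<in>mod_hom R N X. \<forall>x\<in>carrier N. p (h x) = g x"
      by (rule bexI[OF _ hm], rule ballI, rule hp)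
  qed
  have indN: "indecomposable_module R N"
    unfolding indecomposable_module_def
  proof (intro conjI allI impI)
    have "P \<noteq> {\<zero>}"
      using ind by (simp add: indecomposable_module_def right_regular_def P_def)
    then obtain x where x: "x \<in> P" "x \<noteq> \<zero>" using fP by blast
    then have "\<theta> x \<noteq> \<zero>\<^bsub>N\<^esub>" using \<theta>inj[of x \<zero>] \<theta>0 right_ideal_zero[OF P] by auto
    then show "carrier N \<noteq> {\<zero>\<^bsub>N\<^esub>}" using \<theta>c[OF x(1)] by blast
    fix U L assume UL: "submodule U R N \<and> submodule L R N \<and> U \<inter> L = {\<zero>\<^bsub>N\<^esub>} \<and> U <+>\<^bsub>N\<^esub> L = carrier N"
    then have U: "submodule U R N" and L: "submodule L R N" and UL0: "U \<inter> L = {\<zero>\<^bsub>N\<^esub>}"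
      and ULN: "U <+>\<^bsub>N\<^esub> L = carrier N" by blast+
    \<comment> \<open>Decompositions of \<open>N\<close> are pulled back along
      \<open>\<theta>\<close> to decompositions of \<open>f R\<close>.\<close>
    define pre where "pre W = {x \<in> P. \<theta> x \<in> W}" for W
    have sub: "submodule (pre W) R PM" if W: "submodule W R N" for W
      unfolding PM.submodule_iff
    proof (intro conjI ballI)
      show "pre W \<subseteq> carrier PM" "\<zero>\<^bsub>PM\<^esub> \<in> pre W"
        using N.submoduleD(2)[OF W] \<theta>0 right_ideal_zero[OF P] by (auto simp: pre_def)
      fix x assume x: "x \<in> pre W"
      show "x \<oplus>\<^bsub>PM\<^esub> y \<in> pre W" if "y \<in> pre W" for y
        using x that N.submoduleD(3)[OF W] Pa by (simp add: pre_def \<theta>a)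
      show "a \<odot>\<^bsub>PM\<^esub> x \<in> pre W" if "a \<in> carrier R" for a
        using x that N.submoduleD(4)[OF W] Pm by (simp add: pre_def \<theta>s)
    qed
    have zero: "W = {\<zero>\<^bsub>N\<^esub>}" if W: "submodule W R N" "pre W = {\<zero>}" for W
    proof
      show "W \<subseteq> {\<zero>\<^bsub>N\<^esub>}"
      proof
        fix z assume z: "z \<in> W"
        then obtain x where x: "x \<in> P" "z = \<theta> x" using \<theta>surj N.submoduleD(1)[OF W(1)] by blast
        then have "x \<in> pre W" using z by (simp add: pre_def)
        then show "z \<in> {\<zero>\<^bsub>N\<^esub>}" using W(2) x(2) \<theta>0 by simp
      qed
      show "{\<zero>\<^bsub>N\<^esub>} \<subseteq> W" using N.submoduleD(2)[OF W(1)] by simp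
    qed
    have int: "pre U \<inter> pre L = {\<zero>}"
    proof
      show "pre U \<inter> pre L \<subseteq> {\<zero>}"
      proof
        fix x assume "x \<in> pre U \<inter> pre L"
        then have x: "x \<in> P" "\<theta> x \<in> U \<inter> L" by (auto simp: pre_def)
        then have "\<theta> x = \<theta> \<zero>" using UL0 \<theta>0 by simp
        then show "x \<in> {\<zero>}" using \<theta>inj x(1) right_ideal_zero[OF P] by simp
      qed
      show "{\<zero>} \<subseteq> pre U \<inter> pre L"
        using PM.submoduleD(2)[OF sub[OF U]] PM.submoduleD(2)[OF sub[OF L]] by simp
    qed
    have sum: "pre U <+>\<^bsub>PM\<^esub> pre L = P"
    proof
      show "pre U <+>\<^bsub>PM\<^esub> pre L \<subseteq> P"
        using Pa by (auto simp: set_add_def set_mult_def pre_def)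
      show "P \<subseteq> pre U <+>\<^bsub>PM\<^esub> pre L"
      proof
        fix x assume x: "x \<in> P"
        then have "\<theta> x \<in> U <+>\<^bsub>N\<^esub> L" using ULN \<theta>c by simp
        then obtain s t where st: "s \<in> U" "t \<in> L" "\<theta> x = s \<oplus>\<^bsub>N\<^esub> t"
          by (auto simp: set_add_def set_mult_def)
        obtain y where y: "y \<in> P" "s = \<theta> y" using \<theta>surj N.submoduleD(1)[OF U] st(1) by blast
        obtain z where z: "z \<in> P" "t = \<theta> z" using \<theta>surj N.submoduleD(1)[OF L] st(2) by blast
        have "\<theta> x = \<theta> (y \<oplus> z)" using st(3) y z \<theta>a by simp
        then have "x = y \<oplus> z" using \<theta>inj x Pa[OF y(1) z(1)] by blast
        moreover have "y \<in> pre U" "z \<in> pre L" using y z st by (simp_all add: pre_def)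
        ultimately show "x \<in> pre U <+>\<^bsub>PM\<^esub> pre L" by (auto simp: set_add_def set_mult_def)
      qed
    qed
    have "pre U = {\<zero>} \<or> pre L = {\<zero>}"
      using ind sub[OF U] sub[OF L] int sum
      unfolding indecomposable_module_def P_def[symmetric] PM_def[symmetric] by simp
    then show "U = {\<zero>\<^bsub>N\<^esub>} \<or> L = {\<zero>\<^bsub>N\<^esub>}" using zero[OF U] zero[OF L] by blast
  qed
  have soc: "simple_module R (N\<lparr>carrier := socle R N\<rparr>)"
    using qf2 N fgN projN indN unfolding QF2_def by simp
  have socle: "\<theta> t \<in> socle R N \<and> (\<forall>z\<in>socle R N. \<exists>a\<in>carrier R. z = \<theta> (t \<otimes> a))"
    if t: "min_right R t" "f \<otimes> t = t" for t
  proof -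
    \<comment> \<open>The copy of \<open>t R\<close>: a simple submodule of \<open>N\<close>, hence
      equal to its socle.\<close>
    define U where "U = {\<theta> (t \<otimes> a) | a. a \<in> carrier R}"
    have tc: "t \<in> carrier R" and tP: "t \<in> P" using min_rightD(1)[OF t(1)] t(2) by (simp_all add: P_def)
    have UI: "\<theta> (t \<otimes> a) \<in> U" if "a \<in> carrier R" for a
      unfolding U_def using that by (intro CollectI exI conjI) (rule refl)
    have UE: "\<exists>a\<in>carrier R. z = \<theta> (t \<otimes> a)" if "z \<in> U" for z
      using that unfolding U_def by blast
    have U: "submodule U R N"
      unfolding N.submodule_iff
    proof (intro conjI ballI subsetI)
      show "\<zero>\<^bsub>N\<^esub> \<in> U" using UI[OF zero_closed] tc \<theta>0 by simp
      fix x assume "x \<in> U"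
      then obtain a where a: "a \<in> carrier R" "x = \<theta> (t \<otimes> a)" using UE by blast
      show "x \<in> carrier N" unfolding a(2) by (rule \<theta>c[OF Pm[OF tP a(1)]])
      show "x \<oplus>\<^bsub>N\<^esub> y \<in> U" if y: "y \<in> U" for y
      proof -
        obtain b where b: "b \<in> carrier R" "y = \<theta> (t \<otimes> b)" using UE[OF y] by blast
        have "x \<oplus>\<^bsub>N\<^esub> y = \<theta> (t \<otimes> (a \<oplus> b))"
          using \<theta>a[OF Pm[OF tP a(1)] Pm[OF tP b(1)]] a b tc by (simp add: r_distr)
        then show ?thesis using UI[of "a \<oplus> b"] a(1) b(1) by simp
      qed
      show "b \<odot>\<^bsub>N\<^esub> x \<in> U" if b: "b \<in> carrier R" for b
      proof -
        have "b \<odot>\<^bsub>N\<^esub> x = \<theta> (t \<otimes> (a \<otimes> b))"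
          using \<theta>s[OF Pm[OF tP a(1)] b] a b tc by (simp add: m_assoc)
        then show ?thesis using UI[of "a \<otimes> b"] a(1) b by simp
      qed
    qed
    have tU: "\<theta> t \<in> U" using UI[OF one_closed] tc by simp
    have "simple_module R (N\<lparr>carrier := U\<rparr>)"
      unfolding simple_module_def N.submodule_of_submodule_iff[OF U]
    proof (intro conjI allI impI)
      have "\<theta> t \<noteq> \<zero>\<^bsub>N\<^esub>"
        using \<theta>inj[of t \<zero>] \<theta>0 tP right_ideal_zero[OF P] min_rightD(2)[OF t(1)] by auto
      then show "carrier (N\<lparr>carrier := U\<rparr>) \<noteq> {\<zero>\<^bsub>N\<lparr>carrier := U\<rparr>\<^esub>}"
        using tU by auto
      fix V assume V: "submodule V R N \<and> V \<subseteq> U"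
      note VD = N.submoduleD[OF conjunct1[OF V]]
      have "V = U" if "V \<noteq> {\<zero>\<^bsub>N\<^esub>}"
      proof -
        obtain z where z: "z \<in> V" "z \<noteq> \<zero>\<^bsub>N\<^esub>" using \<open>V \<noteq> {\<zero>\<^bsub>N\<^esub>}\<close> VD(2) by blast
        obtain a where a: "a \<in> carrier R" "z = \<theta> (t \<otimes> a)" using UE[OF subsetD[OF conjunct2[OF V] z(1)]] by blast
        have "t \<otimes> a \<noteq> \<zero>" using z(2) \<theta>0 unfolding a(2) by metis
        then obtain b where b: "b \<in> carrier R" "t \<otimes> a \<otimes> b = t" using min_rightD(3)[OF t(1) a(1)] by blast
        have "\<theta> t = b \<odot>\<^bsub>N\<^esub> z" unfolding a(2) using \<theta>s[OF Pm[OF tP a(1)] b(1)] unfolding b(2) .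
        then have tV: "\<theta> t \<in> V" using VD(4)[OF b(1) z(1)] by simp
        have "U \<subseteq> V"
        proof
          fix y assume "y \<in> U"
          then obtain c where c: "c \<in> carrier R" "y = \<theta> (t \<otimes> c)" using UE by blast
          show "y \<in> V" using VD(4)[OF c(1) tV] \<theta>s[OF tP c(1)] c(2) by simp
        qed
        then show ?thesis using conjunct2[OF V] by (rule equalityI[rotated])
      qed
      then show "V = {\<zero>\<^bsub>N\<lparr>carrier := U\<rparr>\<^esub>} \<or> V = carrier (N\<lparr>carrier := U\<rparr>)"
        by (cases "V = {\<zero>\<^bsub>N\<^esub>}") simp_all
    qed
    then have "U = socle R N" by (rule N.simple_submodule_eq_socle[OF soc U])
    moreover have "\<forall>z\<in>U. \<exists>a\<in>carrier R. z = \<theta> (t \<otimes> a)" using UE by (rule ballI)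
    ultimately show ?thesis using tU by simp
  qed
  have uP: "u \<in> P" and vP: "v \<in> P" using min_rightD(1)[OF u(1)] min_rightD(1)[OF v(1)] u v by (simp_all add: P_def)
  obtain a where a: "a \<in> carrier R" "\<theta> v = \<theta> (u \<otimes> a)"
    using socle[OF u] conjunct1[OF socle[OF v]] by blast
  then have "v = u \<otimes> a" using \<theta>inj[OF _ vP Pm[OF uP a(1)]] by simp
  then show ?thesis using a(1) by blast
qed

end

section \<open>Reflexive simple modules and the idempotents of a basic ring\<close>

context ring
begin

text \<open>The coset of \<open>a\<close> is encoded as the set of constant functions with values in
  \<open>a + M\<close>. This places \<open>R/M\<close> in the type \<open>fg_module\<close>, over
  which the hypothesis on simple modules quantifies.\<close>

lemma quotient_module_copy:
  assumes M: "right_ideal R M"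
  shows "\<exists>(N :: 'a fg_module) q. right_module R N \<and> q \<in> mod_hom R (right_regular R) N \<and>
    q ` carrier R = carrier N \<and> (\<forall>a\<in>carrier R. q a = \<zero>\<^bsub>N\<^esub> \<longleftrightarrow> a \<in> M)"
proof -
  note Mm = right_ideal_minus[OF M] and Ma = right_ideal_add[OF M] and Ms = right_ideal_smult[OF M]
    and M0 = right_ideal_zero[OF M] and Mc = right_ideal_closed[OF M]
  \<comment> \<open>\<open>undefined\<close> off the carrier makes \<open>q\<close> extensional, as
    \<open>mod_hom\<close> demands.\<close>
  define q :: "'a \<Rightarrow> (nat \<Rightarrow> 'a) set" where "q a =
    (if a \<in> carrier R then {(\<lambda>_. b) | b. b \<in> carrier R \<and> a \<ominus> b \<in> M} else undefined)" for a
  have mem: "(\<lambda>_. b) \<in> q a \<longleftrightarrow> a \<ominus> b \<in> M" if "a \<in> carrier R" "b \<in> carrier R" for a b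
    using that by (auto simp: q_def fun_eq_iff)
  have sub: "q a \<subseteq> q b" if ab: "a \<in> carrier R" "b \<in> carrier R" "b \<ominus> a \<in> M" for a b
  proof
    fix z assume "z \<in> q a"
    then obtain c where c: "z = (\<lambda>_. c)" "c \<in> carrier R" "a \<ominus> c \<in> M" using ab(1) by (auto simp: q_def)
    have "(b \<ominus> a) \<oplus> (a \<ominus> c) = b \<ominus> c"
      using ab(1,2) c(2) by (simp add: minus_eq a_assoc r_neg2 r_neg1)
    then have "b \<ominus> c \<in> M" using Ma[OF ab(3) c(3)] by simp
    then show "z \<in> q b" unfolding c(1) using mem[OF ab(2) c(2)] by simp
  qed
  have q_eq: "q a = q b \<longleftrightarrow> a \<ominus> b \<in> M" if ab: "a \<in> carrier R" "b \<in> carrier R" for a b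
  proof
    assume "q a = q b"
    moreover have "(\<lambda>_. b) \<in> q b" using mem[OF ab(2,2)] ab(2) M0 by (simp add: minus_eq r_neg)
    ultimately show "a \<ominus> b \<in> M" using mem[OF ab] by simp
  next
    assume m: "a \<ominus> b \<in> M"
    have "b \<ominus> a = \<zero> \<ominus> (a \<ominus> b)" using ab by (simp add: minus_eq minus_add a_comm)
    then have "b \<ominus> a \<in> M" using Mm[OF M0 m] by simp
    then show "q a = q b" using sub[OF ab] sub[OF ab(2,1) m] by blast
  qed
  \<comment> \<open>A choice of representatives; by \<open>Gm\<close> they change only by elements
    of \<open>M\<close>, so the operations of \<open>N\<close> do not depend on it.\<close>
  define G where "G = inv_into (carrier R) q"
  have G: "G (q a) \<in> carrier R" "q (G (q a)) = q a" if "a \<in> carrier R" for a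
    using that by (simp_all add: G_def inv_into_into f_inv_into_f)
  have Gm: "G (q a) \<ominus> a \<in> M" if "a \<in> carrier R" for a
    using q_eq[OF G(1)[OF that] that] G(2)[OF that] by simp
  define N :: "'a fg_module" where "N =
     \<lparr>carrier = q ` carrier R, monoid.mult = undefined, one = undefined,
      ring.zero = q \<zero>, add = (\<lambda>x y. q (G x \<oplus> G y)), smult = (\<lambda>a x. q (G x \<otimes> a))\<rparr>"
  have N [simp]: "carrier N = q ` carrier R" "\<zero>\<^bsub>N\<^esub> = q \<zero>" by (simp_all add: N_def)
  have add: "q a \<oplus>\<^bsub>N\<^esub> q b = q (a \<oplus> b)" if ab: "a \<in> carrier R" "b \<in> carrier R" for a b
  proof -
    have "(G (q a) \<oplus> G (q b)) \<ominus> (a \<oplus> b) = (G (q a) \<ominus> a) \<oplus> (G (q b) \<ominus> b)"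
      using ab G(1)[OF ab(1)] G(1)[OF ab(2)] by (simp add: minus_eq minus_add a_ac)
    then have "(G (q a) \<oplus> G (q b)) \<ominus> (a \<oplus> b) \<in> M" using Ma[OF Gm[OF ab(1)] Gm[OF ab(2)]] by simp
    then show ?thesis using ab G(1) by (simp add: N_def q_eq)
  qed
  have smult: "c \<odot>\<^bsub>N\<^esub> q a = q (a \<otimes> c)" if ac: "a \<in> carrier R" "c \<in> carrier R" for a c
  proof -
    from Ms[OF Gm[OF ac(1)] ac(2)] have "G (q a) \<otimes> c \<ominus> a \<otimes> c \<in> M" using ac G(1) by (simp add: minus_distr_l)
    then show ?thesis using ac G(1) by (simp add: N_def q_eq)
  qed
  have "abelian_group N"
  proof (rule abelian_groupI)
    fix x assume "x \<in> carrier N"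
    then obtain a where "a \<in> carrier R" "x = q a" by auto
    then show "\<exists>y\<in>carrier N. y \<oplus>\<^bsub>N\<^esub> x = \<zero>\<^bsub>N\<^esub>"
      by (intro bexI[of _ "q (\<ominus> a)"]) (simp_all add: add l_neg)
  qed (auto simp: add a_ac)
  then have "right_module R N"
    by (intro right_module.intro right_module_axioms.intro ring_axioms)
       (auto simp: add smult r_distr l_distr m_assoc)
  moreover have "q \<in> mod_hom R (right_regular R) N"
  proof (rule mod_homI)
    show "q \<in> extensional (carrier (right_regular R))"
      by (simp add: q_def extensional_def right_regular_def)
  qed (simp_all add: right_regular_def add smult)
  moreover have "q a = \<zero>\<^bsub>N\<^esub> \<longleftrightarrow> a \<in> M" if "a \<in> carrier R" for a
    using q_eq[OF that zero_closed] that by (simp add: minus_eq)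
  ultimately show ?thesis using N(1) by metis
qed

lemma simple_quotient:
  assumes N: "right_module R N" and q: "q \<in> mod_hom R (right_regular R) N" "q ` carrier R = carrier N"
    and ker: "\<And>a. a \<in> carrier R \<Longrightarrow> q a = \<zero>\<^bsub>N\<^esub> \<longleftrightarrow> a \<in> M" and M: "max_right_ideal R M"
  shows "simple_module R N"
proof -
  interpret N: right_module R N by (rule N)
  have qc: "q a \<in> carrier N" if "a \<in> carrier R" for a
    using mod_homD(1)[OF q(1)] that by (simp add: right_regular_def)
  have qa: "q (a \<oplus> b) = q a \<oplus>\<^bsub>N\<^esub> q b" if "a \<in> carrier R" "b \<in> carrier R" for a b
    using mod_homD(2)[OF q(1)] that by (simp add: right_regular_def)
  have qs: "q (a \<otimes> b) = b \<odot>\<^bsub>N\<^esub> q a" if "a \<in> carrier R" "b \<in> carrier R" for a b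
    using mod_homD(3)[OF q(1)] that by (simp add: right_regular_def)
  have surj: "\<exists>a\<in>carrier R. z = q a" if "z \<in> carrier N" for z using q(2) that by blast
  have "q \<one> \<noteq> \<zero>\<^bsub>N\<^esub>" using ker[OF one_closed] M by (simp add: max_right_ideal_def)
  then have "carrier N \<noteq> {\<zero>\<^bsub>N\<^esub>}" using qc[OF one_closed] by blast
  moreover have "V = carrier N" if V: "submodule V R N" "V \<noteq> {\<zero>\<^bsub>N\<^esub>}" for V
  proof -
    note VD = N.submoduleD[OF V(1)]
    obtain z where z: "z \<in> V" "z \<noteq> \<zero>\<^bsub>N\<^esub>" using V(2) VD(2) by blast
    obtain a where a: "a \<in> carrier R" "z = q a" using surj VD(1) z(1) by blast
    have "a \<in> carrier R - M" using z(2) ker[OF a(1)] a by simp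
    then obtain b where b: "b \<in> carrier R" "\<one> \<ominus> a \<otimes> b \<in> M" using M by (auto simp: max_right_ideal_def)
    have "q \<one> = q (a \<otimes> b \<oplus> (\<one> \<ominus> a \<otimes> b))" using a(1) b(1) by (simp add: add_minus_cancel)
    also have "\<dots> = b \<odot>\<^bsub>N\<^esub> z"
      using a b ker[of "\<one> \<ominus> a \<otimes> b"] N.smult_closed[OF b(1) qc[OF a(1)]] by (simp add: qa qs)
    finally have 1: "q \<one> \<in> V" using VD(4)[OF b(1) z(1)] by simp
    have "carrier N \<subseteq> V"
    proof
      fix y assume "y \<in> carrier N"
      then obtain c where c: "c \<in> carrier R" "y = q c" using surj by blast
      show "y \<in> V" using VD(4)[OF c(1) 1] qs[OF one_closed c(1)] c by simp
    qed
    then show ?thesis using VD(1) by (rule equalityI[rotated])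
  qed
  ultimately show ?thesis unfolding simple_module_def by blast
qed

text \<open>The map \<open>g \<mapsto> g (q \<one>)\<close> identifies the dual of \<open>N\<close>
  with \<open>left_ann R M\<close>, and evaluation at \<open>q a\<close> becomes right
  multiplication by \<open>a\<close>. The two conclusions are injectivity and surjectivity of the
  evaluation map after this identification.\<close>

lemma reflexive_quotient:
  assumes N: "right_module R N" and q: "q \<in> mod_hom R (right_regular R) N" "q ` carrier R = carrier N"
    and ker: "\<And>a. a \<in> carrier R \<Longrightarrow> q a = \<zero>\<^bsub>N\<^esub> \<longleftrightarrow> a \<in> M" and M: "right_ideal R M"
    and refl: "reflexive_module R N"
  shows "\<lbrakk>a \<in> carrier R; \<And>u. u \<in> left_ann R M \<Longrightarrow> u \<otimes> a = \<zero>\<rbrakk> \<Longrightarrow> a \<in> M"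
    and "left_hom_on R (left_ann R M) h \<Longrightarrow> \<exists>a\<in>carrier R. \<forall>u\<in>left_ann R M. h u = u \<otimes> a"
proof -
  interpret N: right_module R N by (rule N)
  have qc: "q a \<in> carrier N" if "a \<in> carrier R" for a
    using mod_homD(1)[OF q(1)] that by (simp add: right_regular_def)
  have qa: "q (a \<oplus> b) = q a \<oplus>\<^bsub>N\<^esub> q b" if "a \<in> carrier R" "b \<in> carrier R" for a b
    using mod_homD(2)[OF q(1)] that by (simp add: right_regular_def)
  have qs: "q (a \<otimes> b) = b \<odot>\<^bsub>N\<^esub> q a" if "a \<in> carrier R" "b \<in> carrier R" for a b
    using mod_homD(3)[OF q(1)] that by (simp add: right_regular_def)
  have surj: "\<exists>a\<in>carrier R. z = q a" if "z \<in> carrier N" for z using q(2) that by blast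
  have Mc: "m \<in> carrier R" if "m \<in> M" for m using right_ideal_closed[OF M that] .
  let ?D = "dual_of_right R N"
  have gD: "g (q a) \<in> carrier R" "g (q (a \<oplus> b)) = g (q a) \<oplus> g (q b)" "g (q (a \<otimes> b)) = g (q a) \<otimes> b"
    if "g \<in> carrier ?D" "a \<in> carrier R" "b \<in> carrier R" for g a b
  proof -
    have g: "g \<in> mod_hom R N (right_regular R)" using that(1) by (simp add: dual_of_right_def)
    show "g (q a) \<in> carrier R" "g (q (a \<oplus> b)) = g (q a) \<oplus> g (q b)" "g (q (a \<otimes> b)) = g (q a) \<otimes> b"
      using mod_homD(1)[OF g qc[OF that(2)]] mod_homD(2)[OF g qc[OF that(2)] qc[OF that(3)]]
        mod_homD(3)[OF g that(3) qc[OF that(2)]] that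
      by (simp_all add: qa qs right_regular_def)
  qed
  have g1: "g (q a) = g (q \<one>) \<otimes> a" if "g \<in> carrier ?D" "a \<in> carrier R" for g a
    using gD(3)[OF that(1) one_closed that(2)] that(2) by simp
  have gL: "g (q \<one>) \<in> left_ann R M" if g: "g \<in> carrier ?D" for g
  proof -
    have "g (q \<one>) \<otimes> m = \<zero>" if m: "m \<in> M" for m
    proof -
      have "q m = q \<zero>" using ker[OF Mc[OF m]] ker[OF zero_closed] m right_ideal_zero[OF M] by simp
      then have "g (q \<one>) \<otimes> m = g (q \<one>) \<otimes> \<zero>" using g1[OF g Mc[OF m]] g1[OF g zero_closed] by simp
      then show ?thesis using gD(1)[OF g one_closed one_closed] by simp
    qed
    then show ?thesis using gD(1)[OF g one_closed one_closed] by (simp add: left_ann_def)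
  qed
  have bij: "bij_betw (eval_map R N) (carrier N) (carrier (dual_of_left R ?D))"
    using refl by (simp add: reflexive_module_def mod_iso_def)
  have eval: "eval_map R N (q a) = (\<lambda>g\<in>carrier ?D. g (q a))" if "a \<in> carrier R" for a
    using qc[OF that] by (simp add: eval_map_def)
  show "a \<in> M" if a: "a \<in> carrier R" and ann: "\<And>u. u \<in> left_ann R M \<Longrightarrow> u \<otimes> a = \<zero>"
  proof -
    have "g (q a) = g (q \<zero>)" if g: "g \<in> carrier ?D" for g
      using g1[OF g a] g1[OF g zero_closed] ann[OF gL[OF g]] gD(1)[OF g one_closed one_closed] by simp
    then have "eval_map R N (q a) = eval_map R N (q \<zero>)"
      unfolding eval[OF a] eval[OF zero_closed] by (rule restrict_ext)
    then have "q a = q \<zero>"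
      using bij qc[OF a] qc[OF zero_closed] by (auto simp: bij_betw_def inj_on_def)
    then show ?thesis using ker[OF a] ker[OF zero_closed] right_ideal_zero[OF M] by simp
  qed
  show "\<exists>a\<in>carrier R. \<forall>u\<in>left_ann R M. h u = u \<otimes> a" if h: "left_hom_on R (left_ann R M) h"
  proof -
    \<comment> \<open>\<open>h\<close> transported to the dual of \<open>N\<close>; as an element of
      the double dual it is evaluation at some \<open>q a\<close>.\<close>
    let ?H = "\<lambda>g\<in>carrier ?D. h (g (q \<one>))"
    interpret D: left_module R ?D by (rule left_module_dual_of_right[OF N])
    have q1: "q \<one> \<in> carrier N" using qc[OF one_closed] .
    have "?H \<in> mod_hom R ?D (left_regular R)"
    proof (rule mod_homI)
      fix g assume g: "g \<in> carrier ?D"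
      show "?H g \<in> carrier (left_regular R)"
        using g gL[OF g] h by (simp add: left_regular_def left_hom_on_def)
      show "?H (g \<oplus>\<^bsub>?D\<^esub> g') = ?H g \<oplus>\<^bsub>left_regular R\<^esub> ?H g'" if g': "g' \<in> carrier ?D" for g'
      proof -
        have "(g \<oplus>\<^bsub>?D\<^esub> g') (q \<one>) = g (q \<one>) \<oplus> g' (q \<one>)" using q1 by (simp add: dual_of_right_def)
        then show ?thesis
          using g g' gL[OF g] gL[OF g'] h D.a_closed[OF g g'] by (simp add: left_regular_def left_hom_on_def)
      qed
      show "?H (b \<odot>\<^bsub>?D\<^esub> g) = b \<odot>\<^bsub>left_regular R\<^esub> ?H g" if b: "b \<in> carrier R" for b
      proof -
        have "(b \<odot>\<^bsub>?D\<^esub> g) (q \<one>) = b \<otimes> g (q \<one>)" using q1 by (simp add: dual_of_right_def)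
        then show ?thesis
          using g gL[OF g] h D.smult_closed[OF b g] b by (simp add: left_regular_def left_hom_on_def)
      qed
    qed simp
    then have "?H \<in> eval_map R N ` carrier N"
      using bij by (simp add: bij_betw_def dual_of_left_def)
    then obtain z where z: "z \<in> carrier N" "?H = eval_map R N z" by blast
    obtain a where a: "a \<in> carrier R" "z = q a" using surj[OF z(1)] by blast
    have "h u = u \<otimes> a" if u: "u \<in> left_ann R M" for u
    proof -
      have uc: "u \<in> carrier R" and u0: "\<And>m. m \<in> M \<Longrightarrow> u \<otimes> m = \<zero>" using u by (auto simp: left_ann_def)
      define G where "G = inv_into (carrier R) q"
      have G: "G (q b) \<in> carrier R" "q (G (q b)) = q b" if "b \<in> carrier R" for b
        using that by (simp_all add: G_def inv_into_into f_inv_into_f)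
      \<comment> \<open>The functional with value \<open>u\<close> at \<open>q \<one>\<close>, which
        inverts the identification.\<close>
      let ?g = "\<lambda>z\<in>carrier N. u \<otimes> G z"
      have g: "?g (q b) = u \<otimes> b" if b: "b \<in> carrier R" for b
      proof -
        have c: "G (q b) \<ominus> b \<in> carrier R" using G(1)[OF b] b by simp
        have "q (b \<oplus> (G (q b) \<ominus> b)) = q b"
          using G[OF b] b by (simp add: add_minus_cancel)
        then have e: "q b \<oplus>\<^bsub>N\<^esub> q (G (q b) \<ominus> b) = q b"
          unfolding qa[OF b c] .
        have "q (G (q b) \<ominus> b) = \<zero>\<^bsub>N\<^esub>"
          using N.M.add.l_cancel_one[OF qc[OF b] qc[OF c]] e by simp
        then have "G (q b) \<ominus> b \<in> M" using ker[OF c] by simp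
        from u0[OF this] have "u \<otimes> G (q b) = u \<otimes> b"
          using uc b G(1)[OF b] by (simp add: minus_distr_r minus_eq_zero_iff)
        then show ?thesis using qc[OF b] by simp
      qed
      have "?g \<in> mod_hom R N (right_regular R)"
      proof (rule mod_homI)
        fix x assume "x \<in> carrier N"
        then obtain b where b: "b \<in> carrier R" "x = q b" using surj by blast
        show "?g x \<in> carrier (right_regular R)"
          unfolding b(2) g[OF b(1)] using uc b(1) by (simp add: right_regular_def)
        show "?g (x \<oplus>\<^bsub>N\<^esub> y) = ?g x \<oplus>\<^bsub>right_regular R\<^esub> ?g y" if y: "y \<in> carrier N" for y
        proof -
          obtain c where c: "c \<in> carrier R" "y = q c" using surj[OF y] by blast
          show ?thesis
            unfolding b(2) c(2) qa[OF b(1) c(1), symmetric] g[OF b(1)] g[OF c(1)] g[OF a_closed[OF b(1) c(1)]]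
            using uc b(1) c(1) by (simp add: right_regular_def r_distr)
        qed
        show "?g (c \<odot>\<^bsub>N\<^esub> x) = c \<odot>\<^bsub>right_regular R\<^esub> ?g x" if c: "c \<in> carrier R" for c
          unfolding b(2) qs[OF b(1) c, symmetric] g[OF b(1)] g[OF m_closed[OF b(1) c]]
          using uc b(1) c by (simp add: right_regular_def m_assoc)
      qed simp
      then have gc: "?g \<in> carrier ?D" by (simp add: dual_of_right_def)
      have "h u = h (?g (q \<one>))" unfolding g[OF one_closed] using uc by simp
      also have "\<dots> = ?H ?g" using gc by simp
      also have "\<dots> = eval_map R N (q a) ?g" unfolding z(2) a(2) ..
      also have "\<dots> = ?g (q a)" unfolding eval[OF a(1)] using gc by simp
      also have "\<dots> = u \<otimes> a" by (rule g[OF a(1)])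
      finally show ?thesis .
    qed
    then show ?thesis using a(1) by blast
  qed
qed

section \<open>The idempotents of a direct decomposition\<close>

text \<open>The \<open>e i\<close> are the components of \<open>\<one>\<close>, and
  \<open>e i \<otimes> x\<close> is the component of \<open>x\<close> in \<open>P i\<close>. The
  last two conclusions draw from the expansion of \<open>u\<close> into its components what is
  wanted, without mentioning a finite sum.\<close>

lemma idempotents_of_decomposition:
  fixes n :: nat
  assumes dec: "internal_direct_sum R (right_regular R) {..<n} P"
  shows "\<exists>e. (\<forall>i<n. e i \<in> carrier R \<and> P i = {x \<in> carrier R. e i \<otimes> x = x} \<and> e i \<otimes> e i = e i) \<and>
    (\<forall>u\<in>carrier R. (\<forall>k<n. e k \<otimes> u = \<zero>) \<longrightarrow> u = \<zero>) \<and>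
    (\<forall>i<n. \<forall>u\<in>carrier R. (\<forall>k<n. k \<noteq> i \<longrightarrow> e k \<otimes> u = \<zero>) \<longrightarrow> e i \<otimes> u = u)"
proof -
  interpret A: right_module R "right_regular R" by (rule right_module_right_regular) (rule ring_axioms)
  let ?A = "right_regular R"
  have A [simp]: "carrier ?A = carrier R" "\<zero>\<^bsub>?A\<^esub> = \<zero>" "x \<oplus>\<^bsub>?A\<^esub> y = x \<oplus> y" "a \<odot>\<^bsub>?A\<^esub> x = x \<otimes> a" for x y a
    by (simp_all add: right_regular_def)
  have Pr: "right_ideal R (P i)" if "i < n" for i
    using dec that by (simp add: internal_direct_sum_def submodule_right_regular_iff)
  have uniq: "\<exists>!p. p \<in> (\<Pi>\<^sub>E i\<in>{..<n}. P i) \<and> m = (\<Oplus>\<^bsub>?A\<^esub>i\<in>{..<n}. p i)" if "m \<in> carrier R" for m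
    using dec that unfolding internal_direct_sum_def by simp
  obtain e where e: "e \<in> (\<Pi>\<^sub>E i\<in>{..<n}. P i)" "\<one> = (\<Oplus>\<^bsub>?A\<^esub>i\<in>{..<n}. e i)"
    using uniq[OF one_closed] by blast
  have eP: "e i \<in> P i" and ec: "e i \<in> carrier R" if "i < n" for i
    using e(1) that right_ideal_closed[OF Pr[OF that]] by auto
  have sum: "u = (\<Oplus>\<^bsub>?A\<^esub>i\<in>{..<n}. e i \<otimes> u)" if u: "u \<in> carrier R" for u
  proof -
    have "u = u \<odot>\<^bsub>?A\<^esub> (\<Oplus>\<^bsub>?A\<^esub>i\<in>{..<n}. e i)" using u by (simp add: e(2)[symmetric])
    also have "\<dots> = (\<Oplus>\<^bsub>?A\<^esub>i\<in>{..<n}. u \<odot>\<^bsub>?A\<^esub> e i)"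
      using u ec by (intro A.smult_finsum) auto
    finally show ?thesis by simp
  qed
  have comp: "e i \<otimes> u = (if i = k then u else \<zero>)" if ik: "i < n" "k < n" and u: "u \<in> P k" for i k u
  proof -
    have uc: "u \<in> carrier R" using right_ideal_closed[OF Pr[OF ik(2)] u] .
    \<comment> \<open>Two expansions of \<open>u\<close>: the one from \<open>sum\<close> and the
      one with \<open>u\<close> alone in position \<open>k\<close>. Uniqueness yields idempotency
      and orthogonality together.\<close>
    let ?p = "\<lambda>i\<in>{..<n}. e i \<otimes> u" and ?d = "\<lambda>i\<in>{..<n}. if k = i then u else \<zero>"
    have "?p \<in> (\<Pi>\<^sub>E i\<in>{..<n}. P i)"
      using right_ideal_smult[OF Pr eP uc] by auto
    moreover have "u = (\<Oplus>\<^bsub>?A\<^esub>i\<in>{..<n}. ?p i)"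
    proof -
      have "(\<Oplus>\<^bsub>?A\<^esub>i\<in>{..<n}. ?p i) = (\<Oplus>\<^bsub>?A\<^esub>i\<in>{..<n}. e i \<otimes> u)"
        using ec uc by (intro A.M.finsum_cong') auto
      then show ?thesis using sum[OF uc] by simp
    qed
    moreover have "?d \<in> (\<Pi>\<^sub>E i\<in>{..<n}. P i)"
      using u right_ideal_zero[OF Pr] by auto
    moreover have "u = (\<Oplus>\<^bsub>?A\<^esub>i\<in>{..<n}. ?d i)"
    proof -
      have "(\<Oplus>\<^bsub>?A\<^esub>i\<in>{..<n}. ?d i) = (\<Oplus>\<^bsub>?A\<^esub>i\<in>{..<n}. if k = i then u else \<zero>\<^bsub>?A\<^esub>)"
        using uc by (intro A.M.finsum_cong') auto
      also have "\<dots> = u" using A.M.finsum_singleton[of k "{..<n}" "\<lambda>_. u"] ik(2) uc by simp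
      finally show ?thesis by simp
    qed
    ultimately have "?p = ?d" using uniq[OF uc] by blast
    then have "?p i = ?d i" by (rule fun_cong)
    then show ?thesis using ik(1) by auto
  qed
  show ?thesis
  proof (intro exI[of _ e] conjI allI impI ballI)
    show "e i \<in> carrier R" if "i < n" for i using ec that .
    show "P i = {x \<in> carrier R. e i \<otimes> x = x}" if i: "i < n" for i
    proof (rule Set.set_eqI)
      fix x
      show "x \<in> P i \<longleftrightarrow> x \<in> {x \<in> carrier R. e i \<otimes> x = x}"
      proof
        assume "x \<in> P i"
        then show "x \<in> {x \<in> carrier R. e i \<otimes> x = x}"
          using comp[OF i i] right_ideal_closed[OF Pr[OF i]] by simp
      next
        assume "x \<in> {x \<in> carrier R. e i \<otimes> x = x}"
        then show "x \<in> P i" using right_ideal_smult[OF Pr[OF i] eP[OF i], of x] by simp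
      qed
    qed
    show "e i \<otimes> e i = e i" if "i < n" for i using comp[OF that that eP[OF that]] by simp
    show "u = \<zero>" if u: "u \<in> carrier R" "\<forall>k<n. e k \<otimes> u = \<zero>" for u
    proof -
      have "(\<Oplus>\<^bsub>?A\<^esub>i\<in>{..<n}. e i \<otimes> u) = \<zero>\<^bsub>?A\<^esub>"
        by (rule A.M.add.finprod_one_eqI) (simp add: u(2))
      then show ?thesis using sum[OF u(1)] by simp
    qed
    show "e i \<otimes> u = u"
      if i: "i < n" and u: "u \<in> carrier R" "\<forall>k<n. k \<noteq> i \<longrightarrow> e k \<otimes> u = \<zero>" for i u
    proof -
      have "(\<Oplus>\<^bsub>?A\<^esub>k\<in>{..<n}. e k \<otimes> u) = (\<Oplus>\<^bsub>?A\<^esub>k\<in>{..<n}. if i = k then e i \<otimes> u else \<zero>\<^bsub>?A\<^esub>)"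
        using u ec i by (intro A.M.finsum_cong') auto
      also have "\<dots> = e i \<otimes> u"
        using A.M.finsum_singleton[of i "{..<n}" "\<lambda>_. e i \<otimes> u"] i u(1) ec by simp
      finally show ?thesis using sum[OF u(1)] by simp
    qed
  qed
qed

text \<open>Left multiplications by \<open>b\<close> and \<open>c\<close> are inverse to each other.
  This links the nonisomorphic summands of \<open>basic_ring\<close> to the elementwise axiom
  \<open>noniso\<close>.\<close>

lemma corner_isomorphism:
  assumes f: "f \<in> carrier R" "g \<in> carrier R" and b: "b \<in> carrier R" "g \<otimes> b = b" "b \<otimes> f = b"
    and c: "c \<in> carrier R" "f \<otimes> c = c" "c \<otimes> g = c" and inv: "c \<otimes> b = f" "b \<otimes> c = g"
  shows "mod_isomorphic R ((right_regular R)\<lparr>carrier := {x \<in> carrier R. f \<otimes> x = x}\<rparr>)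
    ((right_regular R)\<lparr>carrier := {x \<in> carrier R. g \<otimes> x = x}\<rparr>)"
proof -
  let ?P = "{x \<in> carrier R. f \<otimes> x = x}" and ?Q = "{x \<in> carrier R. g \<otimes> x = x}"
  let ?h = "\<lambda>x\<in>?P. b \<otimes> x"
  have P: "x \<oplus> y \<in> ?P" "x \<otimes> a \<in> ?P" if "x \<in> ?P" "y \<in> ?P" "a \<in> carrier R" for x y a
    using that f by (simp_all add: r_distr m_assoc[symmetric])
  have Q: "b \<otimes> x \<in> ?Q" if "x \<in> carrier R" for x
    using that f b(1) b(2) by (simp add: m_assoc[symmetric])
  have P': "c \<otimes> x \<in> ?P" if "x \<in> carrier R" for x
    using that f c(1) c(2) by (simp add: m_assoc[symmetric])
  have cb: "c \<otimes> (b \<otimes> x) = x" if "x \<in> ?P" for x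
    using that b(1) c(1) inv(1) by (simp add: m_assoc[symmetric])
  have bc: "b \<otimes> (c \<otimes> x) = x" if "x \<in> ?Q" for x
    using that b(1) c(1) inv(2) by (simp add: m_assoc[symmetric])
  have "bij_betw ?h ?P ?Q"
  proof (rule bij_betw_byWitness[of _ "\<lambda>x. c \<otimes> x"])
    show "\<forall>x\<in>?P. c \<otimes> ?h x = x" using cb by simp
    show "\<forall>x\<in>?Q. ?h (c \<otimes> x) = x" using bc P' by simp
    show "?h ` ?P \<subseteq> ?Q" using Q by (auto simp del: mem_Collect_eq)
    show "(\<lambda>x. c \<otimes> x) ` ?Q \<subseteq> ?P" using P' by blast
  qed
  moreover have "?h \<in> mod_hom R ((right_regular R)\<lparr>carrier := ?P\<rparr>) ((right_regular R)\<lparr>carrier := ?Q\<rparr>)"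
  proof (rule mod_homI)
    fix x assume "x \<in> carrier ((right_regular R)\<lparr>carrier := ?P\<rparr>)"
    then have x: "x \<in> ?P" by simp
    then show "?h x \<in> carrier ((right_regular R)\<lparr>carrier := ?Q\<rparr>)" using Q by simp
    show "?h (x \<oplus>\<^bsub>(right_regular R)\<lparr>carrier := ?P\<rparr>\<^esub> y) =
        ?h x \<oplus>\<^bsub>(right_regular R)\<lparr>carrier := ?Q\<rparr>\<^esub> ?h y"
      if "y \<in> carrier ((right_regular R)\<lparr>carrier := ?P\<rparr>)" for y
    proof -
      have "y \<in> ?P" using that by simp
      then show ?thesis using x P(1)[OF x, of y \<zero>] b(1) by (simp add: right_regular_def r_distr)
    qed
    show "?h (a \<odot>\<^bsub>(right_regular R)\<lparr>carrier := ?P\<rparr>\<^esub> x) = a \<odot>\<^bsub>(right_regular R)\<lparr>carrier := ?Q\<rparr>\<^esub> ?h x"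
      if "a \<in> carrier R" for a
      using x P(2)[OF x x that] b(1) that by (simp add: right_regular_def m_assoc)
  qed simp
  ultimately show ?thesis unfolding mod_isomorphic_def mod_iso_def by auto
qed

lemma basic_qf2_idempotents:
  assumes dcc: "dcc (right_ideal R)" and basic: "basic_ring R" and qf2: "QF2 R"
    and refl: "\<forall>S :: 'a fg_module. right_module R S \<and> simple_module R S \<longrightarrow> reflexive_module R S"
  shows "\<exists>e n. basic_qf2 R e n"
proof -
  obtain n :: nat and P where dec: "internal_direct_sum R (right_regular R) {..<n} P"
    and ind: "\<And>i. i < n \<Longrightarrow> indecomposable_module R ((right_regular R)\<lparr>carrier := P i\<rparr>)"
    and noniso: "\<And>i j. \<lbrakk>i < n; j < n; i \<noteq> j\<rbrakk> \<Longrightarrow>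
      \<not> mod_isomorphic R ((right_regular R)\<lparr>carrier := P i\<rparr>) ((right_regular R)\<lparr>carrier := P j\<rparr>)"
    using basic unfolding basic_ring_def by blast
  obtain e where e: "\<forall>i<n. e i \<in> carrier R \<and> P i = {x \<in> carrier R. e i \<otimes> x = x} \<and> e i \<otimes> e i = e i"
    and zero: "\<forall>u\<in>carrier R. (\<forall>k<n. e k \<otimes> u = \<zero>) \<longrightarrow> u = \<zero>"
    and single: "\<forall>i<n. \<forall>u\<in>carrier R. (\<forall>k<n. k \<noteq> i \<longrightarrow> e k \<otimes> u = \<zero>) \<longrightarrow> e i \<otimes> u = u"
    using idempotents_of_decomposition[OF dec] by (elim exE conjE) (rule that)
  have ec: "e i \<in> carrier R" and P: "P i = {x \<in> carrier R. e i \<otimes> x = x}" and idem: "e i \<otimes> e i = e i"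
    if "i < n" for i
    using e that by blast+
  \<comment> \<open>Copying \<open>R/M\<close>, its simplicity and its reflexivity, packaged as an
    elimination rule; the two axioms on \<open>left_ann R M\<close> then differ only in the half of
    \<open>reflexive_quotient\<close> applied.\<close>
  have reflexive: thesis
    if M: "max_right_ideal R M"
      and *: "\<And>(N :: 'a fg_module) q. \<lbrakk>right_module R N; q \<in> mod_hom R (right_regular R) N;
        q ` carrier R = carrier N; \<And>a. a \<in> carrier R \<Longrightarrow> q a = \<zero>\<^bsub>N\<^esub> \<longleftrightarrow> a \<in> M;
        right_ideal R M; reflexive_module R N\<rbrakk> \<Longrightarrow> thesis"
    for M thesis
  proof -
    have Mr: "right_ideal R M" using M by (simp add: max_right_ideal_def)
    obtain N :: "'a fg_module" and q where N: "right_module R N"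
      and q: "q \<in> mod_hom R (right_regular R) N" "q ` carrier R = carrier N"
      and ker: "\<forall>a\<in>carrier R. q a = \<zero>\<^bsub>N\<^esub> \<longleftrightarrow> a \<in> M"
      using quotient_module_copy[OF Mr] by (elim exE conjE) (rule that)
    have "simple_module R N" using simple_quotient[OF N q _ M] ker by simp
    then have "reflexive_module R N" using refl N by simp
    then show thesis using *[OF N q _ Mr] ker by simp
  qed
  have "basic_qf2 R e n"
  proof (intro basic_qf2.intro basic_qf2_axioms.intro ring_axioms dcc)
    show "e i \<noteq> \<zero>" if i: "i < n" for i
    proof
      assume 0: "e i = \<zero>"
      have "P i = {\<zero>}" unfolding P[OF i] 0 by auto
      then show False using ind[OF i] by (simp add: indecomposable_module_def right_regular_def)
    qed
    show "i = j" if "i < n" "j < n" "b \<in> carrier R" "c \<in> carrier R" "e j \<otimes> b = b" "b \<otimes> e i = b"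
        "e i \<otimes> c = c" "c \<otimes> e j = c" "c \<otimes> b = e i" "b \<otimes> c = e j" for i j b c
    proof (rule ccontr)
      assume "i \<noteq> j"
      have "mod_isomorphic R ((right_regular R)\<lparr>carrier := P i\<rparr>) ((right_regular R)\<lparr>carrier := P j\<rparr>)"
        unfolding P[OF that(1)] P[OF that(2)]
        by (rule corner_isomorphism[OF ec[OF that(1)] ec[OF that(2)] that(3,5,6,4,7-10)])
      then show False using noniso[OF that(1,2) \<open>i \<noteq> j\<close>] by blast
    qed
    show "\<exists>b\<in>carrier R. v = u \<otimes> b"
      if "i < n" "min_right R u" "min_right R v" "e i \<otimes> u = u" "e i \<otimes> v = v" for i u v
      using idempotent_simple_socle[OF qf2 ec[OF that(1)] idem[OF that(1)] ind[OF that(1), unfolded P[OF that(1)]]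
          that(2,4,3,5)] .
  next
    fix M a assume M: "max_right_ideal R M" and a: "a \<in> carrier R" "\<And>u. u \<in> left_ann R M \<Longrightarrow> u \<otimes> a = \<zero>"
    show "a \<in> M" by (rule reflexive[OF M], rule reflexive_quotient(1)[OF _ _ _ _ _ _ a])
  next
    fix M h assume M: "max_right_ideal R M" and h: "left_hom_on R (left_ann R M) h"
    show "\<exists>a\<in>carrier R. \<forall>u\<in>left_ann R M. h u = u \<otimes> a"
      by (rule reflexive[OF M], rule reflexive_quotient(2)[OF _ _ _ _ _ _ h])
  next
    show "e i \<in> carrier R" "e i \<otimes> e i = e i" if "i < n" for i using ec[OF that] idem[OF that] .
    show "u = \<zero>" if "u \<in> carrier R" "\<And>k. k < n \<Longrightarrow> e k \<otimes> u = \<zero>" for u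
      by (rule zero[rule_format, OF that])
    show "e i \<otimes> u = u"
      if "i < n" "u \<in> carrier R" "\<And>k. \<lbrakk>k < n; k \<noteq> i\<rbrakk> \<Longrightarrow> e k \<otimes> u = \<zero>" for i u
      by (rule single[rule_format, OF that])
  qed
  then show ?thesis by blast
qed

end

theorem proposition3p10:
  fixes R :: "('r, 'q) ring_scheme" and \<phi> :: "'r \<Rightarrow> 'a" and A :: "('a, 'z) ring_scheme"
  assumes "artin_algebra R \<phi> A"
    and "basic_ring A"
    and "\<not> semisimple_ring A"
    and "QF2 A"
    and "\<forall>S :: 'a fg_module. right_module A S \<and> simple_module A S \<longrightarrow> reflexive_module A S"
  shows "selfinjective TYPE('t) A"
proof -
  interpret artin_algebra R \<phi> A by fact
  obtain e n where "basic_qf2 A e n"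
    using A.basic_qf2_idempotents[OF dcc_right_ideal assms(2,4,5)] by blast
  then show ?thesis by (rule basic_qf2.selfinjective_of_dcc_left) (rule dcc_left_ideal)
qed

end
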